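(* Suppose $S$ is an $E$-unitary inverse semigroup. Then $S$ has weak containment if and only if its maximum group homomorphic image $G(S)$ is amenable.
   Context: All inverse semigroups and groups are discrete. An inverse semigroup is a semigroup $S$ in which each $s$ has a unique $s^*$ with $s = ss^*s$ and $s^* = s^*ss^*$. The maximum group homomorphic image $G(S)$ is the quotient of $S$ obtained by identifying $s,t \in S$ whenever $es = et$ for some idempotent $e$; the quotient map is $\sigma : S \to G(S)$. $S$ is $E$-unitary if $\ker\sigma = \sigma^{-1}(1_{G(S)})$ consists solely of idempotents. $\mathbb{C}S$ is the complex $*$-algebra of finite formal sums over $S$, with product extending that of $S$ and involution $(\sum \alpha_s s)^* = \sum \overline{\alpha_s}\, s^*$. A representation of $S$ is a map $\pi$ from $S$ to the partial isometries on a Hilbert space with $\pi(st)=\pi(s)\pi(t)$ and $\pi(s^* )=\pi(s)^*$. The full $C^*$-algebra $C^*(S)$ is the completion of $\mathbb{C}S$ in the norm $\|f\|_{C^*(S)} = \sup_\pi \|\pi(f)\|$ over all representations $\pi$ of $S$. The left regular representation $\Lambda$ of $S$ on $\ell^2(S)$ is given by $\Lambda(a)\delta_b = \delta_{ab}$ if $a^*ab = b$, and $\Lambda(a)\delta_b = 0$ otherwise. It induces a $*$-homomorphism $\Lambda : C^*(S) \to \mathcal{B}(\ell^2(S))$ with image denoted $C^*_r(S)$. $S$ has weak containment if $\Lambda : C^*(S) \to C^*_r(S)$ is an isomorphism. *)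

theory Defs
  imports
    "HOL-Analysis.Analysis"
    "HOL-Algebra.Group"
    "HOL-Library.Function_Algebras"
    "HOL-Library.Poly_Mapping"
begin

section \<open>Inverse semigroups and the maximum group homomorphic image\<close>

class inverse_semigroup = semigroup_mult +
  assumes ex1_inverse: "\<exists>!t. s * t * s = s \<and> t * s * t = t"

definition inv_star :: "'a::inverse_semigroup \<Rightarrow> 'a"
  where "inv_star s = (THE t. s * t * s = s \<and> t * s * t = t)"

definition idem :: "'a::inverse_semigroup \<Rightarrow> bool"
  where "idem e \<longleftrightarrow> e * e = e"

definition sigma_rel :: "('a::inverse_semigroup \<times> 'a) set"
  where "sigma_rel = {(s, t). \<exists>e. idem e \<and> e * s = e * t}"

definition sigma_map :: "'a::inverse_semigroup \<Rightarrow> 'a set"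
  where "sigma_map s = sigma_rel `` {s}"

definition max_group_image :: "'a::inverse_semigroup set monoid"
  where "max_group_image =
    \<lparr>carrier = UNIV // sigma_rel,
     mult = (\<lambda>A B. \<Union>a\<in>A. \<Union>b\<in>B. sigma_map (a * b)),
     one = (\<Union>e\<in>Collect idem. sigma_map e)\<rparr>"

definition E_unitary :: "'a::inverse_semigroup itself \<Rightarrow> bool"
  where "E_unitary _ \<longleftrightarrow>
    (\<forall>s::'a. sigma_map s = \<one>\<^bsub>max_group_image\<^esub> \<longrightarrow> idem s)"

lemma inv_star_inverse:
  fixes s :: "'a::inverse_semigroup"
  shows "s * inv_star s * s = s" "inv_star s * s * inv_star s = inv_star s"
  using theI'[OF ex1_inverse[of s]] unfolding inv_star_def by auto

lemma inv_star_unique: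
  fixes s :: "'a::inverse_semigroup"
  assumes "s * t * s = s" "t * s * t = t"
  shows "inv_star s = t"
  using assms inv_star_inverse[of s] ex1_inverse[of s] by blast

lemma idem_inv_star: "idem e \<Longrightarrow> inv_star e = e"
  by (rule inv_star_unique) (simp_all add: idem_def)

lemma idem_mult:
  fixes e f :: "'a::inverse_semigroup"
  assumes "idem e" "idem f"
  shows "idem (e * f)"
proof -
  define x where "x = inv_star (e * f)"
  have e: "e * e = e" "f * f = f" using assms by (auto simp: idem_def)
  then have e': "\<And>y. e * (e * y) = e * y" "\<And>y. f * (f * y) = f * y"
    by (metis mult.assoc)+
  have x: "e * (f * (x * (e * f))) = e * f" "x * (e * (f * x)) = x"
    using inv_star_inverse[of "e * f"] by (simp_all add: x_def mult.assoc)
  then have x': "\<And>y. x * (e * (f * (x * y))) = x * y"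
    by (metis mult.assoc)
  have "inv_star (e * f) = f * x * e"
    by (rule inv_star_unique) (simp_all add: mult.assoc e e' x x')
  then have fx: "x = f * x * e" by (simp add: x_def)
  have "idem x"
    unfolding idem_def by (subst (1 2) fx, subst (3) fx) (simp add: mult.assoc x')
  then have "inv_star x = x" by (rule idem_inv_star)
  moreover have "inv_star x = e * f"
    by (rule inv_star_unique) (simp_all add: mult.assoc x)
  ultimately show ?thesis using \<open>idem x\<close> by simp
qed

lemma idem_commute:
  fixes e f :: "'a::inverse_semigroup"
  assumes "idem e" "idem f"
  shows "e * f = f * e"
proof -
  have e: "e * e = e" "f * f = f" using assms by (auto simp: idem_def)
  then have e': "\<And>y. e * (e * y) = e * y" "\<And>y. f * (f * y) = f * y"
    by (metis mult.assoc)+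
  have i: "e * (f * (e * f)) = e * f" "f * (e * (f * e)) = f * e"
    using idem_mult[of e f] idem_mult[of f e] assms by (simp_all add: idem_def mult.assoc)
  have "inv_star (e * f) = f * e"
    by (rule inv_star_unique) (simp_all add: mult.assoc e e' i)
  moreover have "inv_star (e * f) = e * f"
    using idem_inv_star idem_mult assms by blast
  ultimately show ?thesis by simp
qed

lemma idem_star_mult: "idem (inv_star s * s)" "idem (s * inv_star s)"
  unfolding idem_def by (metis inv_star_inverse mult.assoc)+

lemma idem_conj:
  fixes s :: "'a::inverse_semigroup"
  assumes "idem e"
  shows "idem (inv_star s * e * s)"
proof -
  have "inv_star s * e * s * (inv_star s * e * s) = inv_star s * (e * (s * inv_star s)) * e * s"
    by (simp add: mult.assoc)
  also have "\<dots> = inv_star s * ((s * inv_star s) * e) * e * s"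
    using idem_commute[OF assms idem_star_mult(2)[of s]] by simp
  also have "\<dots> = (inv_star s * s * inv_star s) * (e * e) * s"
    by (simp add: mult.assoc)
  also have "\<dots> = inv_star s * e * s"
    using assms by (simp add: inv_star_inverse idem_def)
  finally show ?thesis by (simp add: idem_def)
qed

lemma idem_shift:
  fixes s :: "'a::inverse_semigroup"
  assumes "idem e"
  shows "e * s = s * (inv_star s * e * s)"
proof -
  have "s * (inv_star s * e * s) = ((s * inv_star s) * e) * s" by (simp add: mult.assoc)
  also have "\<dots> = (e * (s * inv_star s)) * s"
    using idem_commute[OF assms idem_star_mult(2)[of s]] by simp
  also have "\<dots> = e * s" by (simp add: mult.assoc) (metis inv_star_inverse(1) mult.assoc)
  finally show ?thesis ..
qed

lemma equiv_sigma_rel: "equiv UNIV (sigma_rel :: ('a::inverse_semigroup \<times> 'a) set)"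
proof (rule equivI)
  show "refl_on UNIV (sigma_rel :: ('a \<times> 'a) set)"
    unfolding refl_on_def sigma_rel_def using idem_star_mult by auto
  show "sym (sigma_rel :: ('a \<times> 'a) set)"
    by (rule symI) (auto simp: sigma_rel_def dest: sym)
  show "trans (sigma_rel :: ('a \<times> 'a) set)"
  proof (rule transI)
    fix s t u :: 'a
    assume "(s, t) \<in> sigma_rel" "(t, u) \<in> sigma_rel"
    then obtain e f where ef: "idem e" "e * s = e * t" "idem f" "f * t = f * u"
      by (auto simp: sigma_rel_def)
    have "(f * e) * s = (f * e) * u"
      using ef idem_commute[of e f] by (metis mult.assoc)
    then show "(s, u) \<in> sigma_rel"
      using ef idem_mult by (auto simp: sigma_rel_def)
  qed
qed simp_all

lemma sigma_rel_mult:
  fixes s t :: "'a::inverse_semigroup"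
  assumes "(s, s') \<in> sigma_rel" "(t, t') \<in> sigma_rel"
  shows "(s * t, s' * t') \<in> sigma_rel"
proof -
  obtain e f where e: "idem e" "e * s = e * s'" and f: "idem f" "f * t = f * t'"
    using assms by (auto simp: sigma_rel_def)
  define g where "g = s * f * inv_star s"
  have s: "inv_star (inv_star s) = s" by (rule inv_star_unique) (simp_all add: inv_star_inverse)
  have g: "idem g" unfolding g_def using idem_conj[OF f(1), of "inv_star s"] s by simp
  have gs: "g * s = s * f"
  proof -
    have "g * s = s * (f * (inv_star s * s))" by (simp add: g_def mult.assoc)
    also have "\<dots> = s * ((inv_star s * s) * f)" using idem_commute[OF f(1) idem_star_mult(1)] by simp
    also have "\<dots> = s * f" by (metis inv_star_inverse(1) mult.assoc)
    finally show ?thesis .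
  qed
  have "(e * g) * (s * t) = (e * g) * (s * t')"
    using gs f by (metis mult.assoc)
  also have "\<dots> = g * (e * s) * t'" using idem_commute[OF e(1) g] by (simp add: mult.assoc)
  also have "\<dots> = (e * g) * (s' * t')" using idem_commute[OF e(1) g] e by (simp add: mult.assoc)
  finally show ?thesis using idem_mult[OF e(1) g] by (auto simp: sigma_rel_def)
qed

lemma sigma_map_eq_iff: "sigma_map s = sigma_map t \<longleftrightarrow> (s, t) \<in> sigma_rel"
  unfolding sigma_map_def using eq_equiv_class_iff[OF equiv_sigma_rel UNIV_I UNIV_I] .

lemma sigma_map_mult:
  fixes s t :: "'a::inverse_semigroup"
  shows "sigma_map s \<otimes>\<^bsub>max_group_image\<^esub> sigma_map t = sigma_map (s * t)"
proof -
  have "sigma_map (a * b) = sigma_map (s * t)" if "a \<in> sigma_map s" "b \<in> sigma_map t" for a b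
    using that sigma_rel_mult[of s a t b] by (metis ImageE sigma_map_def sigma_map_eq_iff singletonD)
  moreover have "s \<in> sigma_map s" "t \<in> sigma_map t"
    unfolding sigma_map_def using equiv_class_self[OF equiv_sigma_rel] by auto
  ultimately have "(\<Union>a\<in>sigma_map s. \<Union>b\<in>sigma_map t. sigma_map (a * b)) = sigma_map (s * t)"
    by blast
  then show ?thesis by (simp add: max_group_image_def)
qed

lemma sigma_map_idem:
  fixes e :: "'a::inverse_semigroup"
  assumes "idem e"
  shows "sigma_map e = \<one>\<^bsub>max_group_image\<^esub>"
proof -
  have "sigma_map f = sigma_map e" if "idem f" for f :: 'a
  proof -
    have "(e * f) * f = (e * f) * e"
      using assms that idem_commute[of e f] by (metis idem_def mult.assoc)
    then show ?thesis
      unfolding sigma_map_eq_iff using idem_mult[OF assms that] by (auto simp: sigma_rel_def)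
  qed
  then have "(\<Union>f\<in>Collect idem. sigma_map f) = sigma_map e"
    using assms by blast
  then show ?thesis by (simp add: max_group_image_def)
qed

lemma carrier_max_group_image:
  "carrier max_group_image = range (sigma_map :: 'a::inverse_semigroup \<Rightarrow> 'a set)"
  by (auto simp: max_group_image_def sigma_map_def quotient_def)

lemma group_max_group_image: "group (max_group_image :: 'a::inverse_semigroup set monoid)"
proof (rule groupI)
  have one: "\<one>\<^bsub>max_group_image\<^esub> = sigma_map (s * inv_star s)"
    "\<one>\<^bsub>max_group_image\<^esub> = sigma_map (inv_star s * s)" for s :: 'a
    using sigma_map_idem[OF idem_star_mult(2)] sigma_map_idem[OF idem_star_mult(1)] by metis+
  then show "\<one>\<^bsub>max_group_image\<^esub> \<in> carrier (max_group_image :: 'a set monoid)"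
    by (auto simp: carrier_max_group_image)
  fix x y z :: "'a set"
  assume "x \<in> carrier max_group_image"
  then obtain a where a: "x = sigma_map a" by (auto simp: carrier_max_group_image)
  show "\<one>\<^bsub>max_group_image\<^esub> \<otimes>\<^bsub>max_group_image\<^esub> x = x"
    by (simp add: a one(1)[of a] sigma_map_mult inv_star_inverse)
  show "\<exists>y\<in>carrier max_group_image. y \<otimes>\<^bsub>max_group_image\<^esub> x = \<one>\<^bsub>max_group_image\<^esub>"
    using one(2)[of a] by (auto simp: a carrier_max_group_image sigma_map_mult)
  assume "y \<in> carrier max_group_image"
  then obtain b where b: "y = sigma_map b" by (auto simp: carrier_max_group_image)
  show "x \<otimes>\<^bsub>max_group_image\<^esub> y \<in> carrier max_group_image"
    by (simp add: a b sigma_map_mult carrier_max_group_image)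
  assume "z \<in> carrier max_group_image"
  then obtain c where c: "z = sigma_map c" by (auto simp: carrier_max_group_image)
  show "x \<otimes>\<^bsub>max_group_image\<^esub> y \<otimes>\<^bsub>max_group_image\<^esub> z =
      x \<otimes>\<^bsub>max_group_image\<^esub> (y \<otimes>\<^bsub>max_group_image\<^esub> z)"
    by (simp add: a b c sigma_map_mult mult.assoc)
qed


section \<open>Amenability of discrete groups\<close>

text \<open>A mean is a functional on the bounded real functions on the group. Functions live on the
  whole type, but positivity only looks at the carrier, so by linearity the value of a mean
  depends only on the restriction of its argument to the carrier.\<close>

definition bdd_functions :: "('g, 'm) monoid_scheme \<Rightarrow> ('g \<Rightarrow> real) set"
  where "bdd_functions G = {f. bounded (f ` carrier G)}"

definition left_invariant_mean :: "('g, 'm) monoid_scheme \<Rightarrow> (('g \<Rightarrow> real) \<Rightarrow> real) \<Rightarrow> bool"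
  where "left_invariant_mean G m \<longleftrightarrow>
    (\<forall>f\<in>bdd_functions G. \<forall>h\<in>bdd_functions G. m (\<lambda>x. f x + h x) = m f + m h) \<and>
    (\<forall>c. \<forall>f\<in>bdd_functions G. m (\<lambda>x. c * f x) = c * m f) \<and>
    (\<forall>f\<in>bdd_functions G. (\<forall>x\<in>carrier G. 0 \<le> f x) \<longrightarrow> 0 \<le> m f) \<and>
    m (\<lambda>x. 1) = 1 \<and>
    (\<forall>g\<in>carrier G. \<forall>f\<in>bdd_functions G. m (\<lambda>x. f (g \<otimes>\<^bsub>G\<^esub> x)) = m f)"

definition amenable :: "('g, 'm) monoid_scheme \<Rightarrow> bool"
  where "amenable G \<longleftrightarrow> (\<exists>m. left_invariant_mean G m)"


section \<open>Complex Hilbert spaces and operators\<close>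

text \<open>A Hilbert space is a subspace of an ambient complex vector space (a type with a scalar
  multiplication), with an inner product, linear in the first argument, for which it is complete.
  Keeping the carrier a set makes it possible to quantify over Hilbert spaces.\<close>

record 'h hilbert = "'h partial_object" +
  cscale :: "complex \<Rightarrow> 'h \<Rightarrow> 'h"
  ip :: "'h \<Rightarrow> 'h \<Rightarrow> complex"

definition hnorm :: "('h, 'm) hilbert_scheme \<Rightarrow> 'h \<Rightarrow> real"
  where "hnorm H x = sqrt (Re (ip H x x))"

definition hilbert_space :: "('h::ab_group_add, 'm) hilbert_scheme \<Rightarrow> bool"
  where "hilbert_space H \<longleftrightarrow>
    vector_space (cscale H) \<and>
    module.subspace (cscale H) (carrier H) \<and>
    (\<forall>x\<in>carrier H. \<forall>y\<in>carrier H. \<forall>z\<in>carrier H. ip H (x + y) z = ip H x z + ip H y z) \<and>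
    (\<forall>c. \<forall>x\<in>carrier H. \<forall>y\<in>carrier H. ip H (cscale H c x) y = c * ip H x y) \<and>
    (\<forall>x\<in>carrier H. \<forall>y\<in>carrier H. ip H y x = cnj (ip H x y)) \<and>
    (\<forall>x\<in>carrier H. 0 \<le> Re (ip H x x)) \<and>
    (\<forall>x\<in>carrier H. ip H x x = 0 \<longrightarrow> x = 0) \<and>
    (\<forall>X. (\<forall>n::nat. X n \<in> carrier H) \<and>
         (\<forall>\<epsilon>>0. \<exists>N. \<forall>m\<ge>N. \<forall>n\<ge>N. hnorm H (X m - X n) < \<epsilon>) \<longrightarrow>
         (\<exists>x\<in>carrier H. (\<lambda>n. hnorm H (X n - x)) \<longlonglongrightarrow> 0))"

definition bounded_op :: "('h::ab_group_add, 'm) hilbert_scheme \<Rightarrow> ('h \<Rightarrow> 'h) \<Rightarrow> bool"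
  where "bounded_op H T \<longleftrightarrow>
    (\<forall>x\<in>carrier H. T x \<in> carrier H) \<and>
    (\<forall>x\<in>carrier H. \<forall>y\<in>carrier H. T (x + y) = T x + T y) \<and>
    (\<forall>c. \<forall>x\<in>carrier H. T (cscale H c x) = cscale H c (T x)) \<and>
    (\<exists>C. \<forall>x\<in>carrier H. hnorm H (T x) \<le> C * hnorm H x)"

definition op_norm :: "('h::ab_group_add, 'm) hilbert_scheme \<Rightarrow> ('h \<Rightarrow> 'h) \<Rightarrow> real"
  where "op_norm H T = Sup {hnorm H (T x) | x. x \<in> carrier H \<and> hnorm H x \<le> 1}"

definition partial_isometry :: "('h::ab_group_add, 'm) hilbert_scheme \<Rightarrow> ('h \<Rightarrow> 'h) \<Rightarrow> bool"
  where "partial_isometry H V \<longleftrightarrow> bounded_op H V \<and>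
    (\<forall>x\<in>carrier H. (\<forall>y\<in>carrier H. V y = 0 \<longrightarrow> ip H x y = 0) \<longrightarrow> hnorm H (V x) = hnorm H x)"


section \<open>*-algebras\<close>

record 'x star_algebra = "'x partial_object" +
  alg_add :: "'x \<Rightarrow> 'x \<Rightarrow> 'x"
  alg_scale :: "complex \<Rightarrow> 'x \<Rightarrow> 'x"
  alg_mult :: "'x \<Rightarrow> 'x \<Rightarrow> 'x"
  alg_star :: "'x \<Rightarrow> 'x"

definition star_hom :: "('x \<Rightarrow> 'y) \<Rightarrow> 'x star_algebra \<Rightarrow> 'y star_algebra \<Rightarrow> bool"
  where "star_hom \<phi> A B \<longleftrightarrow>
    (\<forall>a\<in>carrier A. \<phi> a \<in> carrier B) \<and>
    (\<forall>a\<in>carrier A. \<forall>b\<in>carrier A. \<phi> (alg_add A a b) = alg_add B (\<phi> a) (\<phi> b)) \<and>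
    (\<forall>c. \<forall>a\<in>carrier A. \<phi> (alg_scale A c a) = alg_scale B c (\<phi> a)) \<and>
    (\<forall>a\<in>carrier A. \<forall>b\<in>carrier A. \<phi> (alg_mult A a b) = alg_mult B (\<phi> a) (\<phi> b)) \<and>
    (\<forall>a\<in>carrier A. \<phi> (alg_star A a) = alg_star B (\<phi> a))"

definition star_iso :: "('x \<Rightarrow> 'y) \<Rightarrow> 'x star_algebra \<Rightarrow> 'y star_algebra \<Rightarrow> bool"
  where "star_iso \<phi> A B \<longleftrightarrow> star_hom \<phi> A B \<and> bij_betw \<phi> (carrier A) (carrier B)"

text \<open>Operators are extensional functions, so that they are equal iff they agree on the carrier.\<close>

definition bounded_ops :: "('h::ab_group_add, 'm) hilbert_scheme \<Rightarrow> ('h \<Rightarrow> 'h) star_algebra"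
  where "bounded_ops H =
    \<lparr>carrier = {T \<in> extensional (carrier H). bounded_op H T},
     alg_add = (\<lambda>T U. \<lambda>x\<in>carrier H. T x + U x),
     alg_scale = (\<lambda>c T. \<lambda>x\<in>carrier H. cscale H c (T x)),
     alg_mult = (\<lambda>T U. \<lambda>x\<in>carrier H. T (U x)),
     alg_star = (\<lambda>T. THE U. U \<in> extensional (carrier H) \<and> bounded_op H U \<and>
        (\<forall>x\<in>carrier H. \<forall>y\<in>carrier H. ip H (T x) y = ip H x (U y)))\<rparr>"


section \<open>The semigroup algebra and representations\<close>

text \<open>Finite formal sums over \<open>S\<close> are finitely supported maps. (The type's own multiplication is
  convolution for additively written exponents, which is not the one needed here.)\<close>

type_synonym 'a semigroup_algebra = "'a \<Rightarrow>\<^sub>0 complex"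

definition sa_scale :: "complex \<Rightarrow> 'a semigroup_algebra \<Rightarrow> 'a semigroup_algebra"
  where "sa_scale c f =
    (\<Sum>s\<in>Poly_Mapping.keys f. Poly_Mapping.single s (c * Poly_Mapping.lookup f s))"

definition sa_mult :: "'a::inverse_semigroup semigroup_algebra \<Rightarrow> 'a semigroup_algebra \<Rightarrow> 'a semigroup_algebra"
  where "sa_mult f g = (\<Sum>s\<in>Poly_Mapping.keys f. \<Sum>t\<in>Poly_Mapping.keys g.
    Poly_Mapping.single (s * t) (Poly_Mapping.lookup f s * Poly_Mapping.lookup g t))"

definition sa_star :: "'a::inverse_semigroup semigroup_algebra \<Rightarrow> 'a semigroup_algebra"
  where "sa_star f =
    (\<Sum>s\<in>Poly_Mapping.keys f. Poly_Mapping.single (inv_star s) (cnj (Poly_Mapping.lookup f s)))"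

definition is_representation ::
    "('h::ab_group_add, 'm) hilbert_scheme \<Rightarrow> ('a::inverse_semigroup \<Rightarrow> 'h \<Rightarrow> 'h) \<Rightarrow> bool"
  where "is_representation H \<pi> \<longleftrightarrow>
    (\<forall>s. partial_isometry H (\<pi> s)) \<and>
    (\<forall>s t. \<forall>x\<in>carrier H. \<pi> (s * t) x = \<pi> s (\<pi> t x)) \<and>
    (\<forall>s. \<forall>x\<in>carrier H. \<forall>y\<in>carrier H. ip H (\<pi> s x) y = ip H x (\<pi> (inv_star s) y))"

definition rep_ext ::
    "('h::ab_group_add, 'm) hilbert_scheme \<Rightarrow> ('a \<Rightarrow> 'h \<Rightarrow> 'h) \<Rightarrow> 'a semigroup_algebra \<Rightarrow> 'h \<Rightarrow> 'h"
  where "rep_ext H \<pi> f =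
    (\<lambda>x\<in>carrier H. \<Sum>s\<in>Poly_Mapping.keys f. cscale H (Poly_Mapping.lookup f s) (\<pi> s x))"


section \<open>The full C*-algebra\<close>

text \<open>The supremum defining the full norm ranges over Hilbert spaces inside the vector space type
  \<open>'a option \<Rightarrow> complex\<close>, because a HOL formula cannot quantify over all types. Nothing is lost:
  the closed subspace spanned by a vector \<open>x\<close> and all \<open>\<pi> s x\<close> embeds linearly into this type, by
  taking inner products with these vectors. Lemma \<open>full_norm_universal\<close> below shows that
  \<open>full_norm f\<close> bounds the norm of \<open>\<pi>(f)\<close> for representations on Hilbert spaces in any type.\<close>

definition full_norm :: "'a::inverse_semigroup semigroup_algebra \<Rightarrow> real"
  where "full_norm f = Sup {op_norm H (rep_ext H \<pi> f) |
    (H :: ('a option \<Rightarrow> complex) hilbert) \<pi>. hilbert_space H \<and> is_representation H \<pi>}"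

subsection \<open>Independence of the ambient type\<close>

locale hilb =
  fixes H :: "('h::ab_group_add, 'm) hilbert_scheme"
  assumes hilbert: "hilbert_space H"
begin

sublocale vector_space "cscale H"
  using hilbert by (simp add: hilbert_space_def)

lemma subspace_carrier: "subspace (carrier H)"
  using hilbert by (simp add: hilbert_space_def)

lemmas carrier_closed [simp, intro] =
  subspace_0[OF subspace_carrier] subspace_add[OF subspace_carrier]
  subspace_scale[OF subspace_carrier] subspace_diff[OF subspace_carrier]
  subspace_sum[OF subspace_carrier]

lemma ip_add_left:
  "x \<in> carrier H \<Longrightarrow> y \<in> carrier H \<Longrightarrow> z \<in> carrier H \<Longrightarrow> ip H (x + y) z = ip H x z + ip H y z"
  using hilbert[unfolded hilbert_space_def, THEN conjunct2, THEN conjunct2, THEN conjunct1] by blast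

lemma ip_scale_left:
  "x \<in> carrier H \<Longrightarrow> y \<in> carrier H \<Longrightarrow> ip H (cscale H c x) y = c * ip H x y"
  using hilbert[unfolded hilbert_space_def, THEN conjunct2, THEN conjunct2, THEN conjunct2, THEN conjunct1] by blast

lemma ip_cnj: "x \<in> carrier H \<Longrightarrow> y \<in> carrier H \<Longrightarrow> ip H y x = cnj (ip H x y)"
  using hilbert[unfolded hilbert_space_def, THEN conjunct2, THEN conjunct2, THEN conjunct2, THEN conjunct2, THEN conjunct1] by blast

lemma ip_nonneg: "x \<in> carrier H \<Longrightarrow> 0 \<le> Re (ip H x x)"
  using hilbert[unfolded hilbert_space_def, THEN conjunct2, THEN conjunct2, THEN conjunct2, THEN conjunct2, THEN conjunct2, THEN conjunct1] by blast

lemma ip_definite: "x \<in> carrier H \<Longrightarrow> ip H x x = 0 \<Longrightarrow> x = 0"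
  using hilbert[unfolded hilbert_space_def, THEN conjunct2, THEN conjunct2, THEN conjunct2, THEN conjunct2, THEN conjunct2, THEN conjunct2, THEN conjunct1] by blast

lemma complete:
  assumes "\<And>n::nat. X n \<in> carrier H"
    and "\<And>\<epsilon>. \<epsilon> > 0 \<Longrightarrow> \<exists>N. \<forall>m\<ge>N. \<forall>n\<ge>N. hnorm H (X m - X n) < \<epsilon>"
  shows "\<exists>x\<in>carrier H. (\<lambda>n. hnorm H (X n - x)) \<longlonglongrightarrow> 0"
proof -
  have "(\<forall>n. X n \<in> carrier H) \<and>
      (\<forall>\<epsilon>>0. \<exists>N. \<forall>m\<ge>N. \<forall>n\<ge>N. hnorm H (X m - X n) < \<epsilon>)"
    using assms by simp
  then show ?thesis
    using hilbert[unfolded hilbert_space_def, THEN conjunct2, THEN conjunct2, THEN conjunct2,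
        THEN conjunct2, THEN conjunct2, THEN conjunct2, THEN conjunct2]
    by (elim allE[of _ X] mp)
qed

lemma ip_zero_left [simp]: "y \<in> carrier H \<Longrightarrow> ip H 0 y = 0"
  using ip_scale_left[of 0 y 0] by simp

lemma ip_diff_left:
  assumes "x \<in> carrier H" "y \<in> carrier H" "z \<in> carrier H"
  shows "ip H (x - y) z = ip H x z - ip H y z"
  using ip_add_left[of "x - y" y z] assms by simp

lemma ip_zero_right [simp]: "y \<in> carrier H \<Longrightarrow> ip H y 0 = 0"
  using ip_cnj[of 0 y] by simp

lemma ip_diff_right:
  assumes "x \<in> carrier H" "y \<in> carrier H" "z \<in> carrier H"
  shows "ip H z (x - y) = ip H z x - ip H z y"
  using assms ip_cnj[of "x - y" z] ip_cnj[of x z] ip_cnj[of y z] by (simp add: ip_diff_left)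

lemma ip_add_right:
  assumes "x \<in> carrier H" "y \<in> carrier H" "z \<in> carrier H"
  shows "ip H z (x + y) = ip H z x + ip H z y"
  using assms ip_cnj[of "x + y" z] ip_cnj[of x z] ip_cnj[of y z] by (simp add: ip_add_left)

lemma ip_scale_right:
  assumes "x \<in> carrier H" "y \<in> carrier H"
  shows "ip H y (cscale H c x) = cnj c * ip H y x"
  using assms ip_cnj[of "cscale H c x" y] ip_cnj[of x y] by (simp add: ip_scale_left)

lemma ip_sum_left:
  assumes "\<And>i. i \<in> I \<Longrightarrow> x i \<in> carrier H" "z \<in> carrier H"
  shows "ip H (\<Sum>i\<in>I. x i) z = (\<Sum>i\<in>I. ip H (x i) z)"
  using assms by (induction I rule: infinite_finite_induct) (simp_all add: ip_add_left carrier_closed)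

lemma ip_self: "x \<in> carrier H \<Longrightarrow> ip H x x = complex_of_real ((hnorm H x)\<^sup>2)"
proof -
  assume x: "x \<in> carrier H"
  have "Im (ip H x x) = - Im (ip H x x)"
    by (subst ip_cnj[OF x x]) simp
  then show ?thesis using ip_nonneg[OF x] by (simp add: hnorm_def complex_eq_iff)
qed

lemma hnorm_nonneg [simp]: "x \<in> carrier H \<Longrightarrow> 0 \<le> hnorm H x"
  using ip_nonneg by (simp add: hnorm_def)

lemma hnorm_zero [simp]: "hnorm H 0 = 0"
  by (simp add: hnorm_def)

lemma Cauchy_Schwarz:
  assumes x: "x \<in> carrier H" and y: "y \<in> carrier H"
  shows "cmod (ip H x y) \<le> hnorm H x * hnorm H y"
proof (cases "hnorm H y = 0")
  case True
  then have "y = 0" using ip_self[OF y] ip_definite[OF y] by simp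
  then show ?thesis using x by simp
next
  case False
  define b where "b = (hnorm H y)\<^sup>2"
  have b: "b > 0" using False by (simp add: b_def)
  define c where "c = ip H x y / complex_of_real b"
  have "ip H (x - cscale H c y) (x - cscale H c y) =
      ip H x x - cnj c * ip H x y - c * (ip H y x - cnj c * ip H y y)"
    using x y
    by (simp add: ip_diff_left ip_diff_right ip_scale_left ip_scale_right algebra_simps)
  also have "ip H y x - cnj c * ip H y y = 0"
    using b ip_cnj[OF x y] ip_self[OF y] by (simp add: c_def b_def)
  also have "cnj c * ip H x y = complex_of_real ((cmod (ip H x y))\<^sup>2 / b)"
    using complex_norm_square[of "ip H x y"] by (simp add: c_def mult.commute del: of_real_power)
  finally have "0 \<le> (hnorm H x)\<^sup>2 - (cmod (ip H x y))\<^sup>2 / b"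
    using ip_nonneg[of "x - cscale H c y"] x y ip_self[OF x] by (simp del: of_real_divide of_real_power)
  then have "(cmod (ip H x y))\<^sup>2 \<le> (hnorm H x * hnorm H y)\<^sup>2"
    using b by (simp add: field_simps b_def power_mult_distrib)
  then show ?thesis by (rule power2_le_imp_le) (simp add: x y)
qed

lemma hnorm_triangle:
  assumes x: "x \<in> carrier H" and y: "y \<in> carrier H"
  shows "hnorm H (x + y) \<le> hnorm H x + hnorm H y"
proof -
  have "complex_of_real ((hnorm H (x + y))\<^sup>2) = ip H x x + ip H x y + cnj (ip H x y) + ip H y y"
    unfolding ip_self[of "x + y", OF carrier_closed(2)[OF x y], symmetric]
    using x y ip_cnj[OF x y] by (simp add: ip_add_left ip_add_right)
  then have "Re (complex_of_real ((hnorm H (x + y))\<^sup>2)) =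
      Re (ip H x x + ip H x y + cnj (ip H x y) + ip H y y)" by (rule arg_cong)
  then have "(hnorm H (x + y))\<^sup>2 = (hnorm H x)\<^sup>2 + 2 * Re (ip H x y) + (hnorm H y)\<^sup>2"
    using ip_self[OF x] ip_self[OF y] by (simp del: of_real_power)
  also have "\<dots> \<le> (hnorm H x)\<^sup>2 + 2 * (hnorm H x * hnorm H y) + (hnorm H y)\<^sup>2"
    using Cauchy_Schwarz[OF x y] complex_Re_le_cmod[of "ip H x y"] by linarith
  also have "\<dots> = (hnorm H x + hnorm H y)\<^sup>2" by (simp add: power2_sum)
  finally show ?thesis by (rule power2_le_imp_le) (simp add: x y)
qed

lemma hnorm_scale: "x \<in> carrier H \<Longrightarrow> hnorm H (cscale H c x) = cmod c * hnorm H x"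
proof -
  assume x: "x \<in> carrier H"
  have "complex_of_real ((hnorm H (cscale H c x))\<^sup>2) = ip H (cscale H c x) (cscale H c x)"
    using x by (simp only: ip_self carrier_closed)
  also have "\<dots> = (c * cnj c) * ip H x x"
    using x by (simp add: ip_scale_left ip_scale_right)
  also have "\<dots> = complex_of_real ((cmod c)\<^sup>2) * complex_of_real ((hnorm H x)\<^sup>2)"
    by (simp only: complex_norm_square[of c] ip_self[OF x])
  also have "\<dots> = complex_of_real ((cmod c * hnorm H x)\<^sup>2)"
    by (simp only: of_real_mult power_mult_distrib)
  finally have "complex_of_real ((hnorm H (cscale H c x))\<^sup>2) = complex_of_real ((cmod c * hnorm H x)\<^sup>2)" .
  then have "(hnorm H (cscale H c x))\<^sup>2 = (cmod c * hnorm H x)\<^sup>2"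
    by (simp only: of_real_eq_iff)
  then show ?thesis by (rule power2_eq_imp_eq) (simp_all add: x carrier_closed)
qed

lemma hnorm_sum:
  assumes "\<And>i. i \<in> I \<Longrightarrow> x i \<in> carrier H"
  shows "hnorm H (\<Sum>i\<in>I. x i) \<le> (\<Sum>i\<in>I. hnorm H (x i))"
  using assms
proof (induction I rule: infinite_finite_induct)
  case (insert i I)
  then have "hnorm H (x i + (\<Sum>i\<in>I. x i)) \<le> hnorm H (x i) + hnorm H (\<Sum>i\<in>I. x i)"
    by (intro hnorm_triangle) auto
  also have "\<dots> \<le> hnorm H (x i) + (\<Sum>i\<in>I. hnorm H (x i))" using insert by auto
  finally show ?case using insert by simp
qed auto

lemma partial_isometryI:
  fixes \<pi> :: "'a::inverse_semigroup \<Rightarrow> 'h \<Rightarrow> 'h"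
  assumes bdd: "\<And>s. bounded_op H (\<pi> s)"
    and mult: "\<And>s t x. x \<in> carrier H \<Longrightarrow> \<pi> (s * t) x = \<pi> s (\<pi> t x)"
    and adj: "\<And>s x y. x \<in> carrier H \<Longrightarrow> y \<in> carrier H \<Longrightarrow>
      ip H (\<pi> s x) y = ip H x (\<pi> (inv_star s) y)"
  shows "partial_isometry H (\<pi> s)"
  unfolding partial_isometry_def
proof (intro conjI ballI impI bdd)
  fix x assume x: "x \<in> carrier H"
    and orth: "\<forall>y\<in>carrier H. \<pi> s y = 0 \<longrightarrow> ip H x y = 0"
  define z where "z = \<pi> (inv_star s * s) x"
  have cl: "\<pi> t y \<in> carrier H" if "y \<in> carrier H" for t y
    using bdd that by (auto simp: bounded_op_def)
  have z: "z \<in> carrier H" unfolding z_def using cl x by blast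
  have "\<pi> s x = \<pi> s ((x - z) + z)" by simp
  also have "\<dots> = \<pi> s (x - z) + \<pi> s z"
    using bdd x z unfolding bounded_op_def by blast
  finally have "\<pi> s (x - z) = 0"
    using x mult[of x s "inv_star s * s"] by (simp add: z_def inv_star_inverse flip: mult.assoc)
  then have "ip H x (x - z) = 0" using orth x z by auto
  then have "ip H x x = ip H x z" using x z by (simp add: ip_diff_right)
  also have "\<dots> = ip H (\<pi> s x) (\<pi> s x)"
    using x cl adj[of x "\<pi> s x" s] by (simp add: z_def mult)
  finally show "hnorm H (\<pi> s x) = hnorm H x" by (simp add: hnorm_def)
qed

end

locale hilb_rep = hilb H for H :: "('h::ab_group_add, 'm) hilbert_scheme" +
  fixes \<pi> :: "'a::inverse_semigroup \<Rightarrow> 'h \<Rightarrow> 'h"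
  assumes rep: "is_representation H \<pi>"
begin

lemma rep_bounded: "bounded_op H (\<pi> s)"
  using rep[unfolded is_representation_def partial_isometry_def, THEN conjunct1] by blast

lemma rep_closed [simp, intro]: "x \<in> carrier H \<Longrightarrow> \<pi> s x \<in> carrier H"
  using rep_bounded[unfolded bounded_op_def, THEN conjunct1] by blast

lemma rep_add: "x \<in> carrier H \<Longrightarrow> y \<in> carrier H \<Longrightarrow> \<pi> s (x + y) = \<pi> s x + \<pi> s y"
  using rep_bounded[unfolded bounded_op_def, THEN conjunct2, THEN conjunct1] by blast

lemma rep_scale: "x \<in> carrier H \<Longrightarrow> \<pi> s (cscale H c x) = cscale H c (\<pi> s x)"
  using rep_bounded[unfolded bounded_op_def, THEN conjunct2, THEN conjunct2, THEN conjunct1]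
  by blast

lemma rep_mult: "x \<in> carrier H \<Longrightarrow> \<pi> (s * t) x = \<pi> s (\<pi> t x)"
  using rep[unfolded is_representation_def, THEN conjunct2, THEN conjunct1] by blast

lemma rep_adj:
  "x \<in> carrier H \<Longrightarrow> y \<in> carrier H \<Longrightarrow> ip H (\<pi> s x) y = ip H x (\<pi> (inv_star s) y)"
  using rep[unfolded is_representation_def, THEN conjunct2, THEN conjunct2] by blast

lemma rep_contraction:
  assumes x: "x \<in> carrier H"
  shows "hnorm H (\<pi> s x) \<le> hnorm H x"
proof -
  have le: "hnorm H (\<pi> t x) \<le> hnorm H x"
    if eq: "complex_of_real ((hnorm H (\<pi> t x))\<^sup>2) = ip H x z" and z: "z \<in> carrier H"
      and M: "hnorm H z \<le> max (hnorm H x) (hnorm H (\<pi> t x))" for t z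
  proof (rule ccontr)
    assume "\<not> ?thesis"
    then have lt: "hnorm H x < hnorm H (\<pi> t x)" by simp
    have nn: "0 \<le> hnorm H x" using x by simp
    have "(hnorm H (\<pi> t x))\<^sup>2 = cmod (ip H x z)"
      unfolding eq[symmetric] by (simp del: of_real_power)
    also have "\<dots> \<le> hnorm H x * hnorm H z" by (rule Cauchy_Schwarz[OF x z])
    also have "\<dots> \<le> hnorm H x * hnorm H (\<pi> t x)"
      using M lt nn by (intro mult_left_mono) simp_all
    also have "\<dots> < hnorm H (\<pi> t x) * hnorm H (\<pi> t x)"
      using lt nn by (intro mult_strict_right_mono) simp_all
    finally show False by (simp add: power2_eq_square)
  qed
  define p where "p = inv_star s * s"
  have "idem p" unfolding p_def by (rule idem_star_mult)
  then have p: "p * p = p" "inv_star p = p" by (simp_all only: idem_def idem_inv_star)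
  have px: "\<pi> p x \<in> carrier H" "\<pi> s x \<in> carrier H" using x by auto
  have "complex_of_real ((hnorm H (\<pi> p x))\<^sup>2) = ip H x (\<pi> (inv_star p) (\<pi> p x))"
    unfolding ip_self[OF px(1), symmetric] by (rule rep_adj[OF x px(1)])
  also have "\<dots> = ip H x (\<pi> p x)"
    unfolding p(2) rep_mult[OF x, symmetric] p(1) ..
  finally have 1: "hnorm H (\<pi> p x) \<le> hnorm H x"
    by (rule le) (simp_all add: px)
  have "complex_of_real ((hnorm H (\<pi> s x))\<^sup>2) = ip H x (\<pi> (inv_star s) (\<pi> s x))"
    unfolding ip_self[OF px(2), symmetric] by (rule rep_adj[OF x px(2)])
  also have "\<dots> = ip H x (\<pi> p x)"
    unfolding p_def rep_mult[OF x, symmetric] ..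
  finally show ?thesis
    by (rule le) (simp_all add: px le_max_iff_disj 1)
qed

lemma rep_ext_bound:
  assumes x: "x \<in> carrier H"
  shows "hnorm H (rep_ext H \<pi> f x) \<le> (\<Sum>s\<in>Poly_Mapping.keys f. cmod (Poly_Mapping.lookup f s)) * hnorm H x"
proof -
  have "hnorm H (rep_ext H \<pi> f x) \<le>
      (\<Sum>s\<in>Poly_Mapping.keys f. hnorm H (cscale H (Poly_Mapping.lookup f s) (\<pi> s x)))"
    using x unfolding rep_ext_def by (simp add: hnorm_sum carrier_closed)
  also have "\<dots> \<le> (\<Sum>s\<in>Poly_Mapping.keys f. cmod (Poly_Mapping.lookup f s) * hnorm H x)"
    using x by (intro sum_mono) (simp add: hnorm_scale mult_left_mono rep_contraction)
  finally show ?thesis by (simp add: sum_distrib_right)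
qed

lemma rep_ext_unit_ball_bound:
  assumes "x \<in> carrier H" "hnorm H x \<le> 1"
  shows "hnorm H (rep_ext H \<pi> f x) \<le> (\<Sum>s\<in>Poly_Mapping.keys f. cmod (Poly_Mapping.lookup f s))"
proof -
  have "(\<Sum>s\<in>Poly_Mapping.keys f. cmod (Poly_Mapping.lookup f s)) * hnorm H x \<le>
      (\<Sum>s\<in>Poly_Mapping.keys f. cmod (Poly_Mapping.lookup f s)) * 1"
    using assms by (intro mult_left_mono sum_nonneg) auto
  then show ?thesis using rep_ext_bound[of x f] assms by simp
qed

lemma op_norm_rep_ext_le:
  "op_norm H (rep_ext H \<pi> f) \<le> (\<Sum>s\<in>Poly_Mapping.keys f. cmod (Poly_Mapping.lookup f s))"
  unfolding op_norm_def
proof (rule cSup_least)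
  have "hnorm H (rep_ext H \<pi> f 0) \<in> {hnorm H (rep_ext H \<pi> f x) |x. x \<in> carrier H \<and> hnorm H x \<le> 1}"
    by (intro CollectI exI[of _ 0]) simp
  then show "{hnorm H (rep_ext H \<pi> f x) |x. x \<in> carrier H \<and> hnorm H x \<le> 1} \<noteq> {}"
    by blast
qed (use rep_ext_unit_ball_bound in blast)

lemma op_norm_rep_ext_upper:
  assumes "x \<in> carrier H" "hnorm H x \<le> 1"
  shows "hnorm H (rep_ext H \<pi> f x) \<le> op_norm H (rep_ext H \<pi> f)"
  unfolding op_norm_def
proof (rule cSup_upper)
  show "hnorm H (rep_ext H \<pi> f x) \<in> {hnorm H (rep_ext H \<pi> f x) |x. x \<in> carrier H \<and> hnorm H x \<le> 1}"
    using assms by blast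
  show "bdd_above {hnorm H (rep_ext H \<pi> f x) |x. x \<in> carrier H \<and> hnorm H x \<le> 1}"
    by (rule bdd_aboveI[of _ "\<Sum>s\<in>Poly_Mapping.keys f. cmod (Poly_Mapping.lookup f s)"])
      (use rep_ext_unit_ball_bound in blast)
qed

end

lemma full_norm_upper:
  fixes H :: "('a::inverse_semigroup option \<Rightarrow> complex) hilbert" and f :: "'a semigroup_algebra"
  assumes "hilbert_space H" "is_representation H \<pi>"
  shows "op_norm H (rep_ext H \<pi> f) \<le> full_norm f"
  unfolding full_norm_def
proof (rule cSup_upper)
  show "op_norm H (rep_ext H \<pi> f) \<in> {op_norm H (rep_ext H \<pi> f) |
    (H :: ('a option \<Rightarrow> complex) hilbert) \<pi>. hilbert_space H \<and> is_representation H \<pi>}"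
    using assms by blast
  show "bdd_above {op_norm H (rep_ext H \<pi> f) |
    (H :: ('a option \<Rightarrow> complex) hilbert) \<pi>. hilbert_space H \<and> is_representation H \<pi>}"
  proof (rule bdd_aboveI[of _ "\<Sum>s\<in>Poly_Mapping.keys f. cmod (Poly_Mapping.lookup f s)"])
    fix c
    assume "c \<in> {op_norm H (rep_ext H \<pi> f) |
      (H :: ('a option \<Rightarrow> complex) hilbert) \<pi>. hilbert_space H \<and> is_representation H \<pi>}"
    then obtain H :: "('a option \<Rightarrow> complex) hilbert" and \<pi> where
      H: "hilbert_space H" "is_representation H \<pi>" and c: "c = op_norm H (rep_ext H \<pi> f)"
      by blast
    interpret hilb_rep H \<pi> by unfold_locales (rule H)+
    show "c \<le> (\<Sum>s\<in>Poly_Mapping.keys f. cmod (Poly_Mapping.lookup f s))"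
      unfolding c by (rule op_norm_rep_ext_le)
  qed
qed

lemma vector_space_pointwise: "vector_space (\<lambda>(c::complex) u (i::'i). c * u i)"
  by unfold_locales (auto simp: fun_eq_iff algebra_simps)

context hilb_rep
begin

context
  fixes x
  assumes x: "x \<in> carrier H"
begin

text \<open>The bi-orthogonal complement of \<open>x\<close> and all \<open>\<pi> s x\<close>.\<close>

definition cyc :: "'h set"
  where "cyc = {y \<in> carrier H. \<forall>z\<in>carrier H.
    ip H z x = 0 \<and> (\<forall>s. ip H z (\<pi> s x) = 0) \<longrightarrow> ip H y z = 0}"

definition emb :: "'h \<Rightarrow> 'a option \<Rightarrow> complex"
  where "emb y = (\<lambda>i. case i of None \<Rightarrow> ip H y x | Some s \<Rightarrow> ip H y (\<pi> s x))"

definition cyc_space :: "('a option \<Rightarrow> complex) hilbert"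
  where "cyc_space = \<lparr>carrier = emb ` cyc, cscale = (\<lambda>c u i. c * u i),
    ip = (\<lambda>u v. ip H (inv_into cyc emb u) (inv_into cyc emb v))\<rparr>"

definition cyc_rep :: "'a \<Rightarrow> ('a option \<Rightarrow> complex) \<Rightarrow> ('a option \<Rightarrow> complex)"
  where "cyc_rep s u = emb (\<pi> s (inv_into cyc emb u))"

lemma cyc_carrier: "y \<in> cyc \<Longrightarrow> y \<in> carrier H"
  by (simp add: cyc_def)

lemma x_cyc: "x \<in> cyc"
  using x ip_cnj[OF _ x] by (auto simp: cyc_def)

lemma subspace_cyc: "subspace cyc"
  by (rule subspaceI) (auto simp: cyc_def ip_add_left ip_scale_left carrier_closed)

lemmas cyc_closed = subspace_0[OF subspace_cyc] subspace_add[OF subspace_cyc]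
  subspace_scale[OF subspace_cyc] subspace_diff[OF subspace_cyc] subspace_sum[OF subspace_cyc]

lemma rep_cyc:
  assumes "y \<in> cyc"
  shows "\<pi> s y \<in> cyc"
proof -
  have y: "y \<in> carrier H" using assms by (rule cyc_carrier)
  have "ip H (\<pi> s y) z = 0"
    if z: "z \<in> carrier H" and 0: "ip H z x = 0" "\<And>s. ip H z (\<pi> s x) = 0" for z
  proof -
    have s: "inv_star (inv_star s) = s" by (rule inv_star_unique) (simp_all add: inv_star_inverse)
    have "ip H (\<pi> (inv_star s) z) x = 0" "\<And>t. ip H (\<pi> (inv_star s) z) (\<pi> t x) = 0"
      using z x 0 rep_adj[of z _ "inv_star s"] s by (simp_all flip: rep_mult)
    then show ?thesis using assms y z by (simp add: rep_adj cyc_def)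
  qed
  then show ?thesis using y by (simp add: cyc_def)
qed

lemma emb_add: "y \<in> cyc \<Longrightarrow> z \<in> cyc \<Longrightarrow> emb (y + z) = emb y + emb z"
  using x by (auto simp: emb_def fun_eq_iff ip_add_left cyc_carrier split: option.split)

lemma emb_diff: "y \<in> cyc \<Longrightarrow> z \<in> cyc \<Longrightarrow> emb (y - z) = emb y - emb z"
  using x by (auto simp: emb_def fun_eq_iff ip_diff_left cyc_carrier split: option.split)

lemma emb_scale: "y \<in> cyc \<Longrightarrow> emb (cscale H c y) = (\<lambda>i. c * emb y i)"
  using x by (auto simp: emb_def fun_eq_iff ip_scale_left cyc_carrier split: option.split)

lemma emb_zero: "emb 0 = 0"
  using x by (auto simp: emb_def fun_eq_iff split: option.split)

lemma emb_sum:
  "(\<And>i. i \<in> I \<Longrightarrow> g i \<in> cyc) \<Longrightarrow> emb (\<Sum>i\<in>I. g i) = (\<Sum>i\<in>I. emb (g i))"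
  by (induction I rule: infinite_finite_induct) (simp_all add: emb_zero emb_add cyc_closed)

lemma inj_emb: "inj_on emb cyc"
proof (rule inj_onI)
  fix y z assume y: "y \<in> cyc" and z: "z \<in> cyc" and "emb y = emb z"
  then have "emb (y - z) = 0" by (simp add: emb_diff)
  then have "ip H (y - z) x = 0" "\<And>s. ip H (y - z) (\<pi> s x) = 0"
    unfolding emb_def fun_eq_iff zero_fun_def by (metis option.case)+
  moreover have "y - z \<in> cyc" using y z by (rule cyc_closed)
  ultimately have "ip H (y - z) (y - z) = 0" by (simp add: cyc_def)
  then show "y = z" using ip_definite[of "y - z"] y z by (simp add: cyc_carrier carrier_closed)
qed

lemma inv_emb [simp]: "y \<in> cyc \<Longrightarrow> inv_into cyc emb (emb y) = y"
  using inj_emb by (rule inv_into_f_f)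

lemma ip_cyc: "y \<in> cyc \<Longrightarrow> z \<in> cyc \<Longrightarrow> ip cyc_space (emb y) (emb z) = ip H y z"
  by (simp add: cyc_space_def)

lemma hnorm_cyc: "y \<in> cyc \<Longrightarrow> hnorm cyc_space (emb y) = hnorm H y"
  by (simp add: hnorm_def ip_cyc)

lemma carrier_cyc: "carrier cyc_space = emb ` cyc"
  by (simp add: cyc_space_def)

lemma cscale_cyc: "cscale cyc_space = (\<lambda>c u i. c * u i)"
  by (simp add: cyc_space_def)

lemma cyc_complete:
  assumes X: "\<And>n::nat. X n \<in> cyc"
    and cauchy: "\<And>\<epsilon>. \<epsilon> > 0 \<Longrightarrow> \<exists>N. \<forall>m\<ge>N. \<forall>n\<ge>N. hnorm H (X m - X n) < \<epsilon>"
  shows "\<exists>y\<in>cyc. (\<lambda>n. hnorm H (X n - y)) \<longlonglongrightarrow> 0"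
proof -
  have Xc: "X n \<in> carrier H" for n using X cyc_carrier by blast
  obtain y where y: "y \<in> carrier H" and lim: "(\<lambda>n. hnorm H (X n - y)) \<longlonglongrightarrow> 0"
    using complete[OF Xc cauchy] by blast
  have "ip H y z = 0"
    if z: "z \<in> carrier H" and 0: "ip H z x = 0 \<and> (\<forall>s. ip H z (\<pi> s x) = 0)" for z
  proof -
    have "cmod (ip H y z) \<le> hnorm H (X n - y) * hnorm H z" for n
    proof -
      have "ip H (X n) z = 0" using X[of n] z 0 by (simp add: cyc_def)
      then have "ip H (X n - y) z = - ip H y z" using Xc y z by (simp add: ip_diff_left)
      then show ?thesis using Cauchy_Schwarz[of "X n - y" z] Xc y z by (simp add: carrier_closed)
    qed
    moreover have "(\<lambda>n. hnorm H (X n - y) * hnorm H z) \<longlonglongrightarrow> 0 * hnorm H z"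
      by (intro tendsto_mult lim tendsto_const)
    ultimately have "cmod (ip H y z) \<le> 0 * hnorm H z"
      by (intro LIMSEQ_le_const) auto
    then show ?thesis by simp
  qed
  then show ?thesis using y lim by (auto simp: cyc_def)
qed

lemma hilbert_space_cyc: "hilbert_space cyc_space"
proof -
  interpret V: vector_space "\<lambda>(c::complex) u (i::'a option). c * u i"
    by (rule vector_space_pointwise)
  have sub: "V.subspace (emb ` cyc)"
  proof (rule V.subspaceI)
    show "0 \<in> emb ` cyc" using cyc_closed(1) emb_zero by (metis imageI)
    show "\<And>u v. u \<in> emb ` cyc \<Longrightarrow> v \<in> emb ` cyc \<Longrightarrow> u + v \<in> emb ` cyc"
      using cyc_closed(2) by (auto simp flip: emb_add)
    show "\<And>c u. u \<in> emb ` cyc \<Longrightarrow> (\<lambda>i. c * u i) \<in> emb ` cyc"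
      using cyc_closed(3) by (auto simp flip: emb_scale)
  qed
  have complete': "\<exists>y\<in>emb ` cyc. (\<lambda>n. hnorm cyc_space (U n - y)) \<longlonglongrightarrow> 0"
    if U: "\<forall>n::nat. U n \<in> emb ` cyc"
      and c: "\<forall>\<epsilon>>0. \<exists>N. \<forall>m\<ge>N. \<forall>n\<ge>N. hnorm cyc_space (U m - U n) < \<epsilon>" for U
  proof -
    define X where "X n = inv_into cyc emb (U n)" for n
    have X: "X n \<in> cyc" "U n = emb (X n)" for n
      unfolding X_def using U[rule_format, of n] by (simp_all only: inv_into_into f_inv_into_f)
    have eq: "hnorm cyc_space (U n - emb y) = hnorm H (X n - y)" if "y \<in> cyc" for n y
      unfolding X(2)[of n] emb_diff[OF X(1) that, symmetric]
      by (rule hnorm_cyc) (rule cyc_closed(4)[OF X(1) that])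
    have "hnorm cyc_space (U m - U n) = hnorm H (X m - X n)" for m n
      unfolding X(2)[of n] using X(1) by (rule eq)
    with c have "\<exists>N. \<forall>m\<ge>N. \<forall>n\<ge>N. hnorm H (X m - X n) < \<epsilon>" if "\<epsilon> > 0" for \<epsilon>
      using that by simp
    from cyc_complete[OF X(1) this]
    obtain y where y: "y \<in> cyc" "(\<lambda>n. hnorm H (X n - y)) \<longlonglongrightarrow> 0" by blast
    then show ?thesis by (intro bexI[of _ "emb y"]) (simp_all only: eq imageI)
  qed
  show ?thesis
    unfolding hilbert_space_def carrier_cyc cscale_cyc
  proof (intro conjI)
    show "\<forall>X. (\<forall>n. X n \<in> emb ` cyc) \<and>
        (\<forall>\<epsilon>>0. \<exists>N. \<forall>m\<ge>N. \<forall>n\<ge>N. hnorm cyc_space (X m - X n) < \<epsilon>) \<longrightarrow>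
        (\<exists>x\<in>emb ` cyc. (\<lambda>n. hnorm cyc_space (X n - x)) \<longlonglongrightarrow> 0)"
      using complete' by blast
    show "\<forall>u\<in>emb ` cyc. \<forall>v\<in>emb ` cyc. \<forall>w\<in>emb ` cyc.
        ip cyc_space (u + v) w = ip cyc_space u w + ip cyc_space v w"
    proof safe
      fix y z w assume "y \<in> cyc" "z \<in> cyc" "w \<in> cyc"
      then show "ip cyc_space (emb y + emb z) (emb w) =
          ip cyc_space (emb y) (emb w) + ip cyc_space (emb z) (emb w)"
        unfolding emb_add[OF \<open>y \<in> cyc\<close> \<open>z \<in> cyc\<close>, symmetric]
        by (simp add: ip_cyc cyc_closed ip_add_left cyc_carrier)
    qed
    show "\<forall>c. \<forall>u\<in>emb ` cyc. \<forall>v\<in>emb ` cyc.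
        ip cyc_space (\<lambda>i. c * u i) v = c * ip cyc_space u v"
    proof safe
      fix c y w assume "y \<in> cyc" "w \<in> cyc"
      then show "ip cyc_space (\<lambda>i. c * emb y i) (emb w) = c * ip cyc_space (emb y) (emb w)"
        unfolding emb_scale[OF \<open>y \<in> cyc\<close>, symmetric]
        by (simp add: ip_cyc cyc_closed ip_scale_left cyc_carrier)
    qed
    show "\<forall>u\<in>emb ` cyc. \<forall>v\<in>emb ` cyc. ip cyc_space v u = cnj (ip cyc_space u v)"
    proof safe
      fix y w assume yw: "y \<in> cyc" "w \<in> cyc"
      show "ip cyc_space (emb w) (emb y) = cnj (ip cyc_space (emb y) (emb w))"
        unfolding ip_cyc[OF yw] ip_cyc[OF yw(2,1)]
        by (rule ip_cnj[OF cyc_carrier[OF yw(1)] cyc_carrier[OF yw(2)]])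
    qed
    show "\<forall>u\<in>emb ` cyc. 0 \<le> Re (ip cyc_space u u)"
      by (auto simp: ip_cyc intro: ip_nonneg cyc_carrier)
    show "\<forall>u\<in>emb ` cyc. ip cyc_space u u = 0 \<longrightarrow> u = 0"
    proof safe
      fix y assume y: "y \<in> cyc" "ip cyc_space (emb y) (emb y) = 0"
      then have "y = 0" using ip_definite[OF cyc_carrier[OF y(1)]] by (simp add: ip_cyc)
      then show "emb y = 0" by (simp add: emb_zero)
    qed
  qed (fact V.vector_space_axioms sub)+
qed

lemma cyc_rep_emb: "y \<in> cyc \<Longrightarrow> cyc_rep s (emb y) = emb (\<pi> s y)"
  by (simp add: cyc_rep_def)

lemma representation_cyc: "is_representation cyc_space cyc_rep"
proof -
  interpret C: hilb cyc_space by unfold_locales (rule hilbert_space_cyc)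
  have mult: "cyc_rep (s * t) u = cyc_rep s (cyc_rep t u)" if "u \<in> carrier cyc_space" for s t u
    using that by (auto simp: carrier_cyc cyc_rep_emb rep_cyc rep_mult cyc_carrier)
  have adj: "ip cyc_space (cyc_rep s u) v = ip cyc_space u (cyc_rep (inv_star s) v)"
    if "u \<in> carrier cyc_space" "v \<in> carrier cyc_space" for s u v
    using that by (auto simp: carrier_cyc cyc_rep_emb rep_cyc ip_cyc rep_adj cyc_carrier)
  have bdd: "bounded_op cyc_space (cyc_rep s)" for s
    unfolding bounded_op_def carrier_cyc cscale_cyc
  proof (intro conjI exI[of _ 1])
    show "\<forall>u\<in>emb ` cyc. cyc_rep s u \<in> emb ` cyc"
      by (auto simp: cyc_rep_emb rep_cyc)
    show "\<forall>u\<in>emb ` cyc. \<forall>v\<in>emb ` cyc. cyc_rep s (u + v) = cyc_rep s u + cyc_rep s v"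
    proof safe
      fix y z assume "y \<in> cyc" "z \<in> cyc"
      then show "cyc_rep s (emb y + emb z) = cyc_rep s (emb y) + cyc_rep s (emb z)"
        using emb_add[of y z] emb_add[of "\<pi> s y" "\<pi> s z"]
        by (simp add: cyc_rep_def cyc_closed rep_cyc rep_add cyc_carrier flip: emb_add)
    qed
    show "\<forall>c. \<forall>u\<in>emb ` cyc. cyc_rep s (\<lambda>i. c * u i) = (\<lambda>i. c * cyc_rep s u i)"
      by (auto simp: cyc_rep_def cyc_closed rep_cyc rep_scale cyc_carrier simp flip: emb_scale)
    show "\<forall>u\<in>emb ` cyc. hnorm cyc_space (cyc_rep s u) \<le> 1 * hnorm cyc_space u"
      by (auto simp: cyc_rep_emb hnorm_cyc rep_cyc rep_contraction cyc_carrier)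
  qed
  show ?thesis
    unfolding is_representation_def using C.partial_isometryI[of cyc_rep] bdd mult adj by blast
qed

lemma rep_ext_cyc: "rep_ext cyc_space cyc_rep f (emb x) = emb (rep_ext H \<pi> f x)"
  using x x_cyc
  by (simp add: rep_ext_def carrier_cyc cscale_cyc cyc_rep_emb emb_sum emb_scale cyc_closed rep_cyc)

lemma rep_ext_le_full_norm:
  assumes "hnorm H x \<le> 1"
  shows "hnorm H (rep_ext H \<pi> f x) \<le> full_norm f"
proof -
  interpret C: hilb_rep cyc_space cyc_rep
    by unfold_locales (fact hilbert_space_cyc representation_cyc)+
  have "rep_ext H \<pi> f x \<in> cyc"
    using x x_cyc by (simp add: rep_ext_def cyc_closed rep_cyc)
  then have "hnorm H (rep_ext H \<pi> f x) = hnorm cyc_space (rep_ext cyc_space cyc_rep f (emb x))"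
    by (simp add: rep_ext_cyc hnorm_cyc)
  also have "\<dots> \<le> op_norm cyc_space (rep_ext cyc_space cyc_rep f)"
    using assms x_cyc by (intro C.op_norm_rep_ext_upper) (auto simp: carrier_cyc hnorm_cyc)
  also have "\<dots> \<le> full_norm f"
    by (intro full_norm_upper hilbert_space_cyc representation_cyc)
  finally show ?thesis .
qed

end

end

lemma full_norm_universal:
  fixes H :: "('h::ab_group_add, 'm) hilbert_scheme"
    and \<pi> :: "'a::inverse_semigroup \<Rightarrow> 'h \<Rightarrow> 'h"
  assumes "hilbert_space H" "is_representation H \<pi>"
  shows "op_norm H (rep_ext H \<pi> f) \<le> full_norm f"
proof -
  interpret hilb_rep H \<pi> by unfold_locales (fact assms)+
  show ?thesis
    unfolding op_norm_def
  proof (rule cSup_least)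
    have "hnorm H (rep_ext H \<pi> f 0) \<in> {hnorm H (rep_ext H \<pi> f x) |x. x \<in> carrier H \<and> hnorm H x \<le> 1}"
      by (intro CollectI exI[of _ 0]) simp
    then show "{hnorm H (rep_ext H \<pi> f x) |x. x \<in> carrier H \<and> hnorm H x \<le> 1} \<noteq> {}"
      by blast
  qed (use rep_ext_le_full_norm in blast)
qed


subsection \<open>The completion\<close>

text \<open>The completion consists of Cauchy sequences modulo null sequences.\<close>

definition full_cauchy :: "(nat \<Rightarrow> 'a::inverse_semigroup semigroup_algebra) set"
  where "full_cauchy = {F. \<forall>\<epsilon>>0. \<exists>N. \<forall>m\<ge>N. \<forall>n\<ge>N. full_norm (F m - F n) < \<epsilon>}"

definition full_rel ::
    "((nat \<Rightarrow> 'a::inverse_semigroup semigroup_algebra) \<times> (nat \<Rightarrow> 'a semigroup_algebra)) set"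
  where "full_rel = {(F, F'). F \<in> full_cauchy \<and> F' \<in> full_cauchy \<and>
    (\<lambda>n. full_norm (F n - F' n)) \<longlonglongrightarrow> 0}"

definition cstar_full :: "(nat \<Rightarrow> 'a::inverse_semigroup semigroup_algebra) set star_algebra"
  where "cstar_full =
    \<lparr>carrier = full_cauchy // full_rel,
     alg_add = (\<lambda>A B. \<Union>F\<in>A. \<Union>F'\<in>B. full_rel `` {\<lambda>n. F n + F' n}),
     alg_scale = (\<lambda>c A. \<Union>F\<in>A. full_rel `` {\<lambda>n. sa_scale c (F n)}),
     alg_mult = (\<lambda>A B. \<Union>F\<in>A. \<Union>F'\<in>B. full_rel `` {\<lambda>n. sa_mult (F n) (F' n)}),
     alg_star = (\<lambda>A. \<Union>F\<in>A. full_rel `` {\<lambda>n. sa_star (F n)})\<rparr>"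


section \<open>The left regular representation and weak containment\<close>

definition ell2 :: "('i \<Rightarrow> complex) hilbert"
  where "ell2 =
    \<lparr>carrier = {x. (\<lambda>i. (cmod (x i))\<^sup>2) summable_on UNIV},
     cscale = (\<lambda>c x. \<lambda>i. c * x i),
     ip = (\<lambda>x y. \<Sum>\<^sub>\<infinity>i. x i * cnj (y i))\<rparr>"

text \<open>By cancellation with \<open>a\<^sup>*\<close>, the index set of the sum has at most one element; the formula is
  the bounded linear extension of the action on the basis, see lemma \<open>left_regular_basis\<close>.\<close>

definition left_regular :: "'a::inverse_semigroup \<Rightarrow> ('a \<Rightarrow> complex) \<Rightarrow> ('a \<Rightarrow> complex)"
  where "left_regular a x = (\<lambda>c. \<Sum>b | inv_star a * a * b = b \<and> a * b = c. x b)"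

definition basis_vec :: "'i \<Rightarrow> 'i \<Rightarrow> complex"
  where "basis_vec b = (\<lambda>c. if c = b then 1 else 0)"

text \<open>The extension of the left regular representation to the completion by continuity.\<close>

definition Lambda_hom ::
    "(nat \<Rightarrow> 'a::inverse_semigroup semigroup_algebra) set \<Rightarrow> ('a \<Rightarrow> complex) \<Rightarrow> ('a \<Rightarrow> complex)"
  where "Lambda_hom A = (THE T. T \<in> carrier (bounded_ops ell2) \<and>
    (\<forall>F\<in>A. (\<lambda>n. op_norm ell2 (\<lambda>x. rep_ext ell2 left_regular (F n) x - T x)) \<longlonglongrightarrow> 0))"

definition cstar_reduced :: "(('a::inverse_semigroup \<Rightarrow> complex) \<Rightarrow> ('a \<Rightarrow> complex)) star_algebra"
  where "cstar_reduced = (bounded_ops ell2)\<lparr>carrier := Lambda_hom ` carrier cstar_full\<rparr>"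

definition weak_containment :: "'a::inverse_semigroup itself \<Rightarrow> bool"
  where "weak_containment _ \<longleftrightarrow>
    star_iso (Lambda_hom :: (nat \<Rightarrow> 'a semigroup_algebra) set \<Rightarrow> _) cstar_full cstar_reduced"

lemma left_regular_index:
  fixes a b c :: "'a::inverse_semigroup"
  shows "{b. inv_star a * a * b = b \<and> a * b = c} =
    (if a * inv_star a * c = c then {inv_star a * c} else {})"
  by (auto simp: mult.assoc[symmetric] inv_star_inverse)

lemma left_regular_basis:
  fixes a b :: "'a::inverse_semigroup"
  shows "left_regular a (basis_vec b) =
    (if inv_star a * a * b = b then basis_vec (a * b) else (\<lambda>_. 0))"
proof
  fix c
  have "left_regular a (basis_vec b) c =
    (\<Sum>b' \<in> {b. inv_star a * a * b = b \<and> a * b = c}. if b' = b then 1 else 0)"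
    by (simp add: left_regular_def basis_vec_def)
  also have "\<dots> = (if inv_star a * a * b = b \<and> a * b = c then 1 else 0)"
  proof -
    have "finite {b. inv_star a * a * b = b \<and> a * b = c}"
      by (simp add: left_regular_index)
    then show ?thesis by simp
  qed
  finally show "left_regular a (basis_vec b) c =
    (if inv_star a * a * b = b then basis_vec (a * b) else (\<lambda>_. 0)) c"
    by (auto simp: basis_vec_def)
qed

end

theory Submission
  imports Defs
begin

text \<open>
  If \<open>S\<close> has weak containment, let \<open>b\<close> be the average of a finite set of elements. Its full norm is
  1, because of the trivial representation. If its norm under the left regular representation were
  smaller than 1, then for large \<open>n\<close> the element \<open>a = c\<^sup>* c\<close>, where \<open>c\<close> arises from \<open>b\<close> by iterating
  \<open>c \<mapsto> c\<^sup>* c\<close>, would have small norm there, and the positive part of \<open>2 a - 1\<close> would be a nonzero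
  element in the kernel. Hence there are almost fixed unit vectors in the space of square-summable
  functions on \<open>S\<close>; pushing their squared moduli forward to the group gives almost invariant means.

  Conversely, an invariant mean yields finitely supported unit vectors \<open>\<xi>\<close> on the group that are
  almost invariant, so a vector state \<open>s \<mapsto> \<langle>\<pi> s x, x\<rangle>\<close> is the limit of the
  functionals \<open>s \<mapsto> \<langle>\<sigma> s \<xi>, \<xi>\<rangle> \<langle>\<pi> s x, x\<rangle>\<close>. Since \<open>S\<close> is E-unitary, such a
  functional involves finitely many translates of the functional that is \<open>\<langle>\<pi> e x, x\<rangle>\<close> at
  idempotents \<open>e\<close> and 0 elsewhere, and the latter is a limit of convex combinations of the vector states of the
  left regular representation at basis vectors \<open>\<delta>\<^sub>e\<close>. This gives the norm estimate up to a constant,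
  which is removed by iterating \<open>c \<mapsto> c\<^sup>* c\<close>.
\<close>

text \<open>Injectivity of \<open>Lambda_hom\<close> directly says only that a Cauchy sequence null
  in the reduced norm is null in the full norm; it does not compare the two norms of a single
  element. A gap between the norms must therefore be turned into such a sequence. This is why the
  positive part of 2 a - 1 is built as a limit of polynomials in a that converge in the full norm,
  and why the trivial character is used: it is 1 on each of these polynomials and keeps their full
  norms at least 1.

  In the converse direction the mean first gives finitely supported functions of small variation.
  Instead of separating convex sets in a weak topology, a flow along the edges x \<rightarrow> g x
  serves as the certificate that there are none: an invariant mean annihilates its divergence, so
  the divergence cannot be at least \<epsilon> everywhere. Compactness of a product of intervals and
  the minimum of a continuous function suffice for this.

  The tensor product of \<pi> with the regular representation of the group is never formed; its
  norms are finite sums over group elements, because \<xi> has finite support.\<close>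

lemma compact_box:
  fixes I :: "'i \<Rightarrow> real set"
  assumes "\<And>i. compact (I i)"
  shows "compact {x. \<forall>i. x i \<in> I i}"
proof -
  have "compactin (product_topology (\<lambda>_. euclidean) UNIV) (PiE UNIV I)"
    using assms by (simp add: compactin_PiE compactin_euclidean_iff)
  moreover have "PiE UNIV I = {x. \<forall>i. x i \<in> I i}" by (auto simp: PiE_def Pi_def)
  ultimately show ?thesis by (simp add: euclidean_product_topology compactin_euclidean_iff)
qed

subsection \<open>Means\<close>

definition mean :: "('g, 'm) monoid_scheme \<Rightarrow> (('g \<Rightarrow> real) \<Rightarrow> real) \<Rightarrow> bool"
  where "mean G m \<longleftrightarrow>
    (\<forall>f\<in>bdd_functions G. \<forall>h\<in>bdd_functions G. m (\<lambda>x. f x + h x) = m f + m h) \<and>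
    (\<forall>c. \<forall>f\<in>bdd_functions G. m (\<lambda>x. c * f x) = c * m f) \<and>
    (\<forall>f\<in>bdd_functions G. (\<forall>x\<in>carrier G. 0 \<le> f x) \<longrightarrow> 0 \<le> m f) \<and>
    m (\<lambda>x. 1) = 1"

lemma left_invariant_mean_iff:
  "left_invariant_mean G m \<longleftrightarrow>
    mean G m \<and> (\<forall>g\<in>carrier G. \<forall>f\<in>bdd_functions G. m (\<lambda>x. f (g \<otimes>\<^bsub>G\<^esub> x)) = m f)"
  unfolding left_invariant_mean_def mean_def by blast

lemma bdd_functionsI: "(\<And>x. x \<in> carrier G \<Longrightarrow> \<bar>f x\<bar> \<le> B) \<Longrightarrow> f \<in> bdd_functions G"
  unfolding bdd_functions_def bounded_iff by auto

lemma bdd_functionsE: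
  assumes "f \<in> bdd_functions G"
  obtains B where "B \<ge> 0" "\<And>x. x \<in> carrier G \<Longrightarrow> \<bar>f x\<bar> \<le> B"
proof -
  obtain B where "\<forall>x\<in>carrier G. \<bar>f x\<bar> \<le> B"
    using assms unfolding bdd_functions_def bounded_iff by auto
  then show thesis by (intro that[of "max B 0"]) (auto simp: le_max_iff_disj)
qed

lemma bdd_functions_add:
  "f \<in> bdd_functions G \<Longrightarrow> h \<in> bdd_functions G \<Longrightarrow> (\<lambda>x. f x + h x) \<in> bdd_functions G"
  by (erule bdd_functionsE, erule bdd_functionsE)
    (rule bdd_functionsI, rule order_trans[OF abs_triangle_ineq add_mono])

lemma bdd_functions_mult: "f \<in> bdd_functions G \<Longrightarrow> (\<lambda>x. c * f x) \<in> bdd_functions G"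
proof (erule bdd_functionsE)
  fix B assume "\<And>x. x \<in> carrier G \<Longrightarrow> \<bar>f x\<bar> \<le> B"
  then show ?thesis by (intro bdd_functionsI[of _ _ "\<bar>c\<bar> * B"]) (simp add: abs_mult mult_left_mono)
qed

lemma bdd_functions_const: "(\<lambda>x. c) \<in> bdd_functions G"
  by (rule bdd_functionsI[of _ _ "\<bar>c\<bar>"]) simp

lemma mean_add:
  "mean G m \<Longrightarrow> f \<in> bdd_functions G \<Longrightarrow> h \<in> bdd_functions G \<Longrightarrow> m (\<lambda>x. f x + h x) = m f + m h"
  unfolding mean_def by blast

lemma mean_mult: "mean G m \<Longrightarrow> f \<in> bdd_functions G \<Longrightarrow> m (\<lambda>x. c * f x) = c * m f"
  unfolding mean_def by blast

lemma mean_nonneg: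
  "mean G m \<Longrightarrow> f \<in> bdd_functions G \<Longrightarrow> (\<And>x. x \<in> carrier G \<Longrightarrow> 0 \<le> f x) \<Longrightarrow> 0 \<le> m f"
  unfolding mean_def by blast

lemma mean_one: "mean G m \<Longrightarrow> m (\<lambda>x. 1) = 1"
  unfolding mean_def by blast

lemma mean_const: "mean G m \<Longrightarrow> m (\<lambda>x. c) = c"
  using mean_mult[of G m "\<lambda>x. 1" c] mean_one[of G m] bdd_functions_const[of 1 G] by simp

lemma mean_diff:
  assumes "mean G m" "f \<in> bdd_functions G" "h \<in> bdd_functions G"
  shows "m (\<lambda>x. f x - h x) = m f - m h"
  using mean_add[OF assms(1,2) bdd_functions_mult[OF assms(3), of "-1"]]
    mean_mult[OF assms(1,3), of "-1"] by simp

lemma bdd_functions_diff: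
  assumes "f \<in> bdd_functions G" "h \<in> bdd_functions G"
  shows "(\<lambda>x. f x - h x) \<in> bdd_functions G"
  using bdd_functions_add[OF assms(1) bdd_functions_mult[OF assms(2), of "-1"]] by simp

lemma mean_mono:
  assumes "mean G m" "f \<in> bdd_functions G" "h \<in> bdd_functions G"
    and "\<And>x. x \<in> carrier G \<Longrightarrow> f x \<le> h x"
  shows "m f \<le> m h"
  using mean_nonneg[OF assms(1) bdd_functions_diff[OF assms(3,2)]] assms(4)
    mean_diff[OF assms(1,3,2)] by simp

lemma mean_abs_le:
  assumes m: "mean G m" and B: "\<And>x. x \<in> carrier G \<Longrightarrow> \<bar>f x\<bar> \<le> B"
  shows "\<bar>m f\<bar> \<le> B"
proof -
  have f: "f \<in> bdd_functions G" using B by (rule bdd_functionsI)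
  have "m f \<le> B"
    using mean_mono[OF m f bdd_functions_const[of B]] B mean_const[OF m, of B] by fastforce
  moreover have "- B \<le> m f"
    using mean_mono[OF m bdd_functions_const[of "- B"] f] B mean_const[OF m, of "- B"] by fastforce
  ultimately show ?thesis by simp
qed

lemma mean_sum:
  assumes "mean G m" "\<And>i. i \<in> I \<Longrightarrow> f i \<in> bdd_functions G"
  shows "(\<lambda>x. \<Sum>i\<in>I. f i x) \<in> bdd_functions G \<and> m (\<lambda>x. \<Sum>i\<in>I. f i x) = (\<Sum>i\<in>I. m (f i))"
  using assms(2)
proof (induction I rule: infinite_finite_induct)
  case (insert i I)
  then show ?case using mean_add[OF assms(1), of "f i" "\<lambda>x. \<Sum>i\<in>I. f i x"]
    by (auto intro: bdd_functions_add)
qed (auto simp: bdd_functions_const mean_const[OF assms(1)])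

lemma (in group) bdd_functions_translate:
  assumes "f \<in> bdd_functions G" "g \<in> carrier G"
  shows "(\<lambda>x. f (g \<otimes> x)) \<in> bdd_functions G"
  using assms(1) by (rule bdd_functionsE) (rule bdd_functionsI, use assms(2) in auto)

text \<open>Compactness of a product of intervals turns approximately invariant means into an
  invariant one.\<close>

lemma (in group) amenable_if_approx_invariant:
  assumes approx: "\<And>K \<epsilon>. finite K \<Longrightarrow> K \<subseteq> carrier G \<Longrightarrow> \<epsilon> > 0 \<Longrightarrow>
    \<exists>m. mean G m \<and> (\<forall>g\<in>K. \<forall>f B. (\<forall>x\<in>carrier G. \<bar>f x\<bar> \<le> B) \<longrightarrow>
      \<bar>m (\<lambda>x. f (g \<otimes> x)) - m f\<bar> \<le> \<epsilon> * B)"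
  shows "amenable G"
proof -
  define b where "b f = (SUP x\<in>carrier G. \<bar>f x\<bar>)" for f :: "'a \<Rightarrow> real"
  have b: "\<bar>f x\<bar> \<le> b f" if "f \<in> bdd_functions G" "x \<in> carrier G" for f x
  proof -
    note fx = that
    have "\<exists>B. \<forall>x\<in>carrier G. \<bar>f x\<bar> \<le> B"
      using fx(1) by (rule bdd_functionsE) auto
    then obtain B where "\<And>x. x \<in> carrier G \<Longrightarrow> \<bar>f x\<bar> \<le> B" by blast
    then show ?thesis unfolding b_def using fx by (intro cSUP_upper bdd_aboveI2[of _ _ B])
  qed
  \<comment> \<open>The axioms of a mean say nothing about its values at unbounded functions.
    Pinning these values to 0 keeps the box compact; \<open>m'\<close> below adjusts a given mean
    accordingly.\<close>
  define box where "box = {m. \<forall>f. m f \<in> (if f \<in> bdd_functions G then {- b f..b f} else {0})}"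
  have cont: "continuous_on UNIV (\<lambda>m :: ('a \<Rightarrow> real) \<Rightarrow> real. m f)" for f
    by simp
  define M where "M = box \<inter> {m. mean G m}"
  have "closed {m. mean G m}"
    unfolding mean_def Ball_def
    by (intro closed_Collect_conj closed_Collect_all closed_Collect_imp open_Collect_const
        closed_Collect_eq closed_Collect_le continuous_intros cont)
  moreover have "compact box"
    unfolding box_def by (rule compact_box) simp
  ultimately have M: "compact M" unfolding M_def by (rule compact_Int_closed[rotated])
  \<comment> \<open>Invariance is split into one closed condition for each pair of a group element
    and a tolerance, so that a single approximately invariant mean meets any finitely many of
    them.\<close>
  define Inv where "Inv = (\<lambda>(g, \<epsilon>). {m. \<forall>f. f \<in> bdd_functions G \<longrightarrow>
    \<bar>m (\<lambda>x. f (g \<otimes> x)) - m f\<bar> \<le> \<epsilon> * b f})"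
  have Inv_closed: "closed (Inv p)" for p
    unfolding Inv_def case_prod_unfold
    by (intro closed_Collect_all closed_Collect_imp open_Collect_const closed_Collect_le
        continuous_intros cont)
  have "M \<inter> \<Inter>(Inv ` (carrier G \<times> {0<..})) \<noteq> {}"
  proof (rule compact_imp_fip_image[OF M Inv_closed])
    fix P assume P: "finite P" "P \<subseteq> carrier G \<times> {(0::real)<..}"
    \<comment> \<open>The entry 1 covers an empty \<open>P\<close>.\<close>
    define \<epsilon> where "\<epsilon> = Min (insert 1 (snd ` P))"
    have \<epsilon>: "\<epsilon> > 0" "\<And>g e. (g, e) \<in> P \<Longrightarrow> \<epsilon> \<le> e"
    proof -
      show "\<epsilon> > 0" unfolding \<epsilon>_def using P by (subst Min_gr_iff) auto
      show "\<epsilon> \<le> e" if "(g, e) \<in> P" for g e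
        unfolding \<epsilon>_def using P that by (intro Min_le) force+
    qed
    have "finite (fst ` P)" "fst ` P \<subseteq> carrier G" using P by auto
    from approx[OF this \<epsilon>(1)]
    obtain m where m: "mean G m" and ai: "\<And>g f B. g \<in> fst ` P \<Longrightarrow>
        (\<forall>x\<in>carrier G. \<bar>f x\<bar> \<le> B) \<Longrightarrow> \<bar>m (\<lambda>x. f (g \<otimes> x)) - m f\<bar> \<le> \<epsilon> * B"
      by blast
    define m' where "m' f = (if f \<in> bdd_functions G then m f else 0)" for f
    have "mean G m'"
      using m unfolding mean_def m'_def
      by (auto simp: bdd_functions_add bdd_functions_mult bdd_functions_const)
    moreover have "\<bar>m f\<bar> \<le> b f" if "f \<in> bdd_functions G" for f
      using mean_abs_le[OF m, of f "b f"] b[OF that] by simp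
    then have "m' \<in> box" unfolding box_def m'_def by (auto simp: abs_le_iff minus_le_iff)
    moreover have "m' \<in> Inv p" if p: "p \<in> P" for p
    proof -
      obtain g e where ge: "p = (g, e)" by force
      then have g: "g \<in> carrier G" "g \<in> fst ` P" using P p by force+
      have "\<bar>m' (\<lambda>x. f (g \<otimes> x)) - m' f\<bar> \<le> e * b f" if f: "f \<in> bdd_functions G" for f
      proof -
        have "0 \<le> b f" using b[OF f one_closed] by simp
        have "\<bar>m' (\<lambda>x. f (g \<otimes> x)) - m' f\<bar> \<le> \<epsilon> * b f"
          using ai[OF g(2), of f "b f"] b[OF f] f g bdd_functions_translate by (simp add: m'_def)
        also have "\<dots> \<le> e * b f"
          using \<epsilon>(2)[of g e] p ge \<open>0 \<le> b f\<close> by (simp add: mult_right_mono)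
        finally show ?thesis .
      qed
      then show ?thesis by (simp add: Inv_def ge)
    qed
    ultimately show "M \<inter> \<Inter>(Inv ` P) \<noteq> {}" unfolding M_def by blast
  qed
  then obtain m where m: "mean G m"
    and Inv: "\<And>g \<epsilon>. g \<in> carrier G \<Longrightarrow> \<epsilon> > 0 \<Longrightarrow> m \<in> Inv (g, \<epsilon>)"
    unfolding M_def by fastforce
  have "m (\<lambda>x. f (g \<otimes> x)) = m f" if g: "g \<in> carrier G" and f: "f \<in> bdd_functions G" for g f
  proof -
    have "\<bar>m (\<lambda>x. f (g \<otimes> x)) - m f\<bar> \<le> 0 + \<epsilon>" if \<epsilon>: "\<epsilon> > 0" for \<epsilon>
    proof -
      have "0 \<le> b f" using b[OF f one_closed] by simp
      have "\<bar>m (\<lambda>x. f (g \<otimes> x)) - m f\<bar> \<le> \<epsilon> / (b f + 1) * b f"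
        using Inv[OF g, of "\<epsilon> / (b f + 1)"] f \<epsilon> \<open>0 \<le> b f\<close> by (simp add: Inv_def)
      also have "\<dots> \<le> \<epsilon>" using \<epsilon> \<open>0 \<le> b f\<close> by (simp add: field_simps)
      finally show ?thesis by simp
    qed
    then have "\<bar>m (\<lambda>x. f (g \<otimes> x)) - m f\<bar> \<le> 0" by (rule field_le_epsilon)
    then show ?thesis by simp
  qed
  with m show ?thesis unfolding amenable_def left_invariant_mean_iff by blast
qed

subsection \<open>Reiter's condition\<close>

text \<open>The superset \<open>X\<close> leaves room to sum a function and its translate over the
  same finite set.\<close>

lemma (in group) sum_translate:
  fixes f h :: "'a \<Rightarrow> real"
  assumes X: "finite X" "X \<subseteq> carrier G" "(\<lambda>x. g \<otimes> x) ` Y \<subseteq> X"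
    and Y: "Y \<subseteq> carrier G" "\<And>x. x \<notin> Y \<Longrightarrow> f x = 0" and g: "g \<in> carrier G"
  shows "(\<Sum>y\<in>X. f (inv g \<otimes> y) * h y) = (\<Sum>x\<in>Y. f x * h (g \<otimes> x))"
proof -
  have "(\<Sum>y\<in>X. f (inv g \<otimes> y) * h y) = (\<Sum>y\<in>(\<lambda>x. g \<otimes> x) ` Y. f (inv g \<otimes> y) * h y)"
  proof (intro sum.mono_neutral_right ballI)
    fix y assume y: "y \<in> X - (\<lambda>x. g \<otimes> x) ` Y"
    then have "y = g \<otimes> (inv g \<otimes> y)" using X g by (auto simp flip: m_assoc)
    then have "inv g \<otimes> y \<notin> Y" using y by blast
    then show "f (inv g \<otimes> y) * h y = 0" by (simp add: Y)
  qed (use X in auto)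
  also have "\<dots> = (\<Sum>x\<in>Y. f (inv g \<otimes> (g \<otimes> x)) * h (g \<otimes> x))"
    using Y g by (subst sum.reindex) (auto simp: inj_on_def subset_iff)
  also have "\<dots> = (\<Sum>x\<in>Y. f x * h (g \<otimes> x))"
    using Y g by (intro sum.cong refl) (auto simp: subset_iff simp flip: m_assoc)
  finally show ?thesis .
qed

text \<open>The divergence at \<open>x\<close> of a flow along the edges \<open>x \<rightarrow> g x\<close>.\<close>

definition (in group) flow_div :: "'a set \<Rightarrow> ('a \<times> 'a \<Rightarrow> real) \<Rightarrow> 'a \<Rightarrow> real"
  where "flow_div K F x = (\<Sum>g\<in>K. F (g, g \<otimes> x) - F (g, x))"

lemma (in group) flow_div_diff:
  "flow_div K (\<lambda>p. F p + t * (F' p - F p)) x = flow_div K F x + t * (flow_div K F' x - flow_div K F x)"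
  by (simp add: flow_div_def algebra_simps sum.distrib sum_subtractf sum_distrib_left)

lemma (in group) continuous_flow_div: "continuous_on A (\<lambda>F. flow_div K F x)"
proof -
  have "continuous_on A (\<lambda>F :: 'a \<times> 'a \<Rightarrow> real. F p)" for p
    by (rule continuous_on_subset[OF continuous_on_product_coordinates]) simp
  then show ?thesis unfolding flow_div_def by (intro continuous_intros)
qed

text \<open>The duality between flows and variation, by optimality of the constrained minimum.\<close>

lemma (in group) flow_on_finite_set:
  assumes Y: "finite Y" "Y \<subseteq> carrier G" and K: "finite K" "K \<subseteq> carrier G" and \<epsilon>: "\<epsilon> > 0"
    and var: "\<And>\<eta> :: 'a \<Rightarrow> real. (\<And>x. 0 \<le> \<eta> x) \<Longrightarrow> (\<And>x. x \<notin> Y \<Longrightarrow> \<eta> x = 0) \<Longrightarrow>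
      \<epsilon> * (\<Sum>x\<in>Y. \<eta> x) \<le> (\<Sum>g\<in>K. \<Sum>y\<in>Y \<union> (\<lambda>x. g \<otimes> x) ` Y. \<bar>\<eta> (inv g \<otimes> y) - \<eta> y\<bar>)"
  shows "\<exists>F. (\<forall>p. F p \<in> {-1..1}) \<and> (\<forall>x\<in>Y. \<epsilon> \<le> flow_div K F x)"
proof -
  define \<Phi> where "\<Phi> F = (\<Sum>x\<in>Y. (max 0 (\<epsilon> - flow_div K F x))\<^sup>2)" for F
  define box where "box = {F :: 'a \<times> 'a \<Rightarrow> real. \<forall>p. F p \<in> {-1..1}}"
  have "compact box" unfolding box_def by (rule compact_box) simp
  moreover have "continuous_on box \<Phi>"
    unfolding \<Phi>_def by (intro continuous_intros continuous_flow_div)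
  moreover have "(\<lambda>_. 0) \<in> box" by (simp add: box_def)
  ultimately obtain F where F: "F \<in> box" and min: "\<And>F'. F' \<in> box \<Longrightarrow> \<Phi> F \<le> \<Phi> F'"
    using continuous_attains_inf[of box \<Phi>] by blast
  \<comment> \<open>Up to the factor -2 this is the gradient of \<open>\<Phi>\<close> with respect
    to the divergences at the minimum. It is the function to which the variation estimate
    \<open>var\<close> is applied.\<close>
  define \<eta> where "\<eta> x = (if x \<in> Y then max 0 (\<epsilon> - flow_div K F x) else 0)" for x
  have opt: "(\<Sum>x\<in>Y. \<eta> x * (flow_div K F' x - flow_div K F x)) \<le> 0" if F': "F' \<in> box" for F'
  proof (rule ccontr)
    define d where "d x = flow_div K F' x - flow_div K F x" for x
    define S where "S = (\<Sum>x\<in>Y. \<eta> x * d x)"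
    define Q where "Q = (\<Sum>x\<in>Y. (d x)\<^sup>2)"
    assume "\<not> ?thesis"
    then have S: "S > 0" by (simp add: S_def d_def)
    have Q: "Q \<ge> 0" unfolding Q_def by (intro sum_nonneg) simp
    \<comment> \<open>Small enough that along the segment from \<open>F\<close> to \<open>F'\<close>
      the linear gain \<open>2 * t * S\<close> beats the quadratic loss
      \<open>t\<^sup>2 * Q\<close>.\<close>
    define t where "t = min 1 (S / (Q + 1))"
    have t: "0 < t" "t \<le> 1" using S Q by (auto simp: t_def)
    have "t * (Q + 1) \<le> S / (Q + 1) * (Q + 1)"
      using Q by (intro mult_right_mono) (auto simp: t_def)
    then have t: "0 < t" "t \<le> 1" "t * (Q + 1) \<le> S" using Q t by simp_all
    have "(\<lambda>p. F p + t * (F' p - F p)) \<in> box"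
    proof -
      have "F p + t * (F' p - F p) = (1 - t) *\<^sub>R F p + t *\<^sub>R F' p" for p
        by (simp add: algebra_simps)
      moreover have "(1 - t) *\<^sub>R F p + t *\<^sub>R F' p \<in> {-1..1}" for p
        using F F' t by (intro convexD[OF convex_real_interval(5)]) (simp_all add: box_def del: split_paired_All)
      ultimately show ?thesis by (simp add: box_def)
    qed
    then have "\<Phi> F \<le> \<Phi> (\<lambda>p. F p + t * (F' p - F p))" by (rule min)
    also have "\<dots> \<le> (\<Sum>x\<in>Y. (\<eta> x - t * d x)\<^sup>2)"
    proof (unfold \<Phi>_def, rule sum_mono)
      fix x assume "x \<in> Y"
      have "max 0 (u - v) \<le> \<bar>max 0 u - v\<bar>" for u v :: real by auto
      then have "(max 0 ((\<epsilon> - flow_div K F x) - t * d x))\<^sup>2 \<le> (max 0 (\<epsilon> - flow_div K F x) - t * d x)\<^sup>2"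
        by (subst power2_abs[symmetric, of "max 0 (\<epsilon> - flow_div K F x) - t * d x"], intro power_mono) auto
      then show "(max 0 (\<epsilon> - flow_div K (\<lambda>p. F p + t * (F' p - F p)) x))\<^sup>2 \<le> (\<eta> x - t * d x)\<^sup>2"
        using \<open>x \<in> Y\<close> unfolding flow_div_diff \<eta>_def d_def by (simp add: diff_diff_eq)
    qed
    also have "\<dots> = \<Phi> F - 2 * t * S + t\<^sup>2 * Q"
      unfolding \<Phi>_def S_def Q_def
      by (simp add: \<eta>_def power2_diff sum.distrib sum_subtractf sum_distrib_left power_mult_distrib
          algebra_simps)
    finally have "2 * t * S \<le> t * (t * Q)" by (simp add: power2_eq_square)
    then have "2 * S \<le> t * Q" using t by simp
    moreover have "t * Q \<le> S" using t Q by (simp add: algebra_simps)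
    ultimately show False using S by simp
  qed
  have \<eta>0: "0 \<le> \<eta> x" for x by (simp add: \<eta>_def)
  \<comment> \<open>Among flows with values in [-1, 1] this one maximizes the pairing of
    \<open>\<eta>\<close> with the divergence, and the maximum is the total variation of
    \<open>\<eta>\<close>.\<close>
  define F' where "F' = (\<lambda>(g, y). sgn (\<eta> (inv g \<otimes> y) - \<eta> y))"
  have F': "F' \<in> box" by (auto simp: box_def F'_def sgn_if)
  have "\<epsilon> * (\<Sum>x\<in>Y. \<eta> x) \<le> (\<Sum>g\<in>K. \<Sum>y\<in>Y \<union> (\<lambda>x. g \<otimes> x) ` Y. \<bar>\<eta> (inv g \<otimes> y) - \<eta> y\<bar>)"
    by (rule var) (simp_all add: \<eta>_def)
  also have "\<dots> = (\<Sum>g\<in>K. \<Sum>x\<in>Y. \<eta> x * (F' (g, g \<otimes> x) - F' (g, x)))"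
  proof (rule sum.cong[OF refl])
    fix g assume "g \<in> K"
    then have g: "g \<in> carrier G" using K by blast
    define Z where "Z = Y \<union> (\<lambda>x. g \<otimes> x) ` Y"
    have Z: "finite Z" "Z \<subseteq> carrier G" using Y g by (auto simp: Z_def)
    have "(\<Sum>y\<in>Z. \<bar>\<eta> (inv g \<otimes> y) - \<eta> y\<bar>) =
        (\<Sum>y\<in>Z. \<eta> (inv g \<otimes> y) * F' (g, y)) - (\<Sum>y\<in>Z. \<eta> y * F' (g, y))"
      unfolding sum_subtractf[symmetric] F'_def
      by (intro sum.cong refl) (simp add: abs_sgn left_diff_distrib)
    also have "(\<Sum>y\<in>Z. \<eta> y * F' (g, y)) = (\<Sum>y\<in>Y. \<eta> y * F' (g, y))"
      using Z by (intro sum.mono_neutral_right) (auto simp: Z_def \<eta>_def)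
    also have "(\<Sum>y\<in>Z. \<eta> (inv g \<otimes> y) * F' (g, y)) = (\<Sum>x\<in>Y. \<eta> x * F' (g, g \<otimes> x))"
      using Z Y g by (intro sum_translate) (auto simp: Z_def \<eta>_def)
    finally show "(\<Sum>y\<in>Y \<union> (\<lambda>x. g \<otimes> x) ` Y. \<bar>\<eta> (inv g \<otimes> y) - \<eta> y\<bar>) =
        (\<Sum>x\<in>Y. \<eta> x * (F' (g, g \<otimes> x) - F' (g, x)))"
      by (simp add: Z_def right_diff_distrib sum_subtractf)
  qed
  also have "\<dots> = (\<Sum>x\<in>Y. \<eta> x * flow_div K F' x)"
    unfolding flow_div_def sum_distrib_left by (rule sum.swap)
  also have "\<dots> \<le> (\<Sum>x\<in>Y. \<eta> x * flow_div K F x)"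
    using opt[OF F'] by (simp add: right_diff_distrib sum_subtractf)
  \<comment> \<open>Where \<open>\<eta>\<close> is nonzero, the divergence of \<open>F\<close> is
    \<open>\<epsilon> - \<eta> x\<close>. Since the chain starts from \<open>\<epsilon>\<close>
    times the sum of \<open>\<eta>\<close>, the squares of \<open>\<eta>\<close> must sum to
    0.\<close>
  also have "\<dots> = (\<Sum>x\<in>Y. \<eta> x * (\<epsilon> - \<eta> x))"
    by (intro sum.cong refl) (auto simp: \<eta>_def max_def)
  finally have "(\<Sum>x\<in>Y. (\<eta> x)\<^sup>2) \<le> 0"
    by (simp add: right_diff_distrib sum_subtractf power2_eq_square sum_distrib_left mult.commute)
  then have "(\<Sum>x\<in>Y. (\<eta> x)\<^sup>2) = 0" by (intro antisym sum_nonneg) simp_all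
  then have "\<forall>x\<in>Y. \<eta> x = 0" using Y by (simp add: sum_nonneg_eq_0_iff)
  then have "\<forall>x\<in>Y. \<epsilon> \<le> flow_div K F x" by (auto simp: \<eta>_def max_def split: if_splits)
  then show ?thesis using F by (auto simp: box_def)
qed

text \<open>If the conclusion fails, \<open>flow_on_finite_set\<close> applies to every finite
  \<open>Y\<close>, and the finite intersection property joins the resulting flows into a single one
  for the whole group.\<close>

lemma (in group) amenable_imp_reiter:
  assumes am: "amenable G" and K: "finite K" "K \<subseteq> carrier G" and \<epsilon>: "\<epsilon> > 0"
  shows "\<exists>(\<eta> :: 'a \<Rightarrow> real) Y. finite Y \<and> Y \<subseteq> carrier G \<and> (\<forall>x. 0 \<le> \<eta> x) \<and> (\<forall>x. x \<notin> Y \<longrightarrow> \<eta> x = 0) \<and>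
    (\<Sum>g\<in>K. \<Sum>y\<in>Y \<union> (\<lambda>x. g \<otimes> x) ` Y. \<bar>\<eta> (inv g \<otimes> y) - \<eta> y\<bar>) < \<epsilon> * (\<Sum>x\<in>Y. \<eta> x)"
proof (rule ccontr)
  assume no: "\<nexists>(\<eta> :: 'a \<Rightarrow> real) Y. finite Y \<and> Y \<subseteq> carrier G \<and> (\<forall>x. 0 \<le> \<eta> x) \<and> (\<forall>x. x \<notin> Y \<longrightarrow> \<eta> x = 0) \<and>
    (\<Sum>g\<in>K. \<Sum>y\<in>Y \<union> (\<lambda>x. g \<otimes> x) ` Y. \<bar>\<eta> (inv g \<otimes> y) - \<eta> y\<bar>) < \<epsilon> * (\<Sum>x\<in>Y. \<eta> x)"
  have var: "\<epsilon> * (\<Sum>x\<in>Y. \<eta> x) \<le>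
      (\<Sum>g\<in>K. \<Sum>y\<in>Y \<union> (\<lambda>x. g \<otimes> x) ` Y. \<bar>\<eta> (inv g \<otimes> y) - \<eta> y\<bar>)"
    if "finite Y" "Y \<subseteq> carrier G" "\<And>x. 0 \<le> \<eta> x" "\<And>x. x \<notin> Y \<Longrightarrow> \<eta> x = 0" for Y and \<eta> :: "'a \<Rightarrow> real"
    using no that not_le_imp_less[of "\<epsilon> * (\<Sum>x\<in>Y. \<eta> x)"] by blast
  have "compact {F :: 'a \<times> 'a \<Rightarrow> real. \<forall>p. F p \<in> {-1..1}}" (is "compact ?box")
    by (rule compact_box) simp
  moreover have "closed {F. \<epsilon> \<le> flow_div K F x}" for x
    by (intro closed_Collect_le continuous_intros continuous_flow_div)
  ultimately have "?box \<inter> \<Inter>((\<lambda>x. {F. \<epsilon> \<le> flow_div K F x}) ` carrier G) \<noteq> {}"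
  proof (rule compact_imp_fip_image)
    fix Y assume Y: "finite Y" "Y \<subseteq> carrier G"
    have "\<exists>F. (\<forall>p. F p \<in> {-1..1}) \<and> (\<forall>x\<in>Y. \<epsilon> \<le> flow_div K F x)"
      by (rule flow_on_finite_set[OF Y K \<epsilon>]) (rule var[OF Y])
    then show "?box \<inter> \<Inter>((\<lambda>x. {F. \<epsilon> \<le> flow_div K F x}) ` Y) \<noteq> {}" by blast
  qed
  then obtain F where F: "\<And>p. \<bar>F p\<bar> \<le> 1" and div: "\<And>x. x \<in> carrier G \<Longrightarrow> \<epsilon> \<le> flow_div K F x"
    by (auto simp: abs_le_iff minus_le_iff)
  obtain m where m: "mean G m"
    and li: "\<And>g f. g \<in> carrier G \<Longrightarrow> f \<in> bdd_functions G \<Longrightarrow> m (\<lambda>x. f (g \<otimes> x)) = m f"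
    using am unfolding amenable_def left_invariant_mean_iff by blast
  have Fb: "(\<lambda>x. F (g, x)) \<in> bdd_functions G" for g
    by (rule bdd_functionsI[of _ _ 1]) (rule F)
  have tm: "(\<lambda>x. F (g, g \<otimes> x) - F (g, x)) \<in> bdd_functions G"
    "m (\<lambda>x. F (g, g \<otimes> x) - F (g, x)) = 0" if "g \<in> K" for g
  proof -
    have g: "g \<in> carrier G" using that K by blast
    note Fg = bdd_functions_translate[OF Fb g, of g]
    show "(\<lambda>x. F (g, g \<otimes> x) - F (g, x)) \<in> bdd_functions G"
      by (rule bdd_functions_diff[OF Fg Fb])
    show "m (\<lambda>x. F (g, g \<otimes> x) - F (g, x)) = 0"
      using mean_diff[OF m Fg Fb] li[OF g Fb, of g] by simp
  qed
  have sum: "flow_div K F \<in> bdd_functions G" "m (flow_div K F) = 0"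
    using mean_sum[OF m, of K "\<lambda>g x. F (g, g \<otimes> x) - F (g, x)"] tm
    by (simp_all add: flow_div_def[abs_def])
  have "\<epsilon> \<le> m (flow_div K F)"
    using mean_mono[OF m bdd_functions_const[of \<epsilon>] sum(1)] div mean_const[OF m, of \<epsilon>] by simp
  then show False using sum(2) \<epsilon> by simp
qed

subsection \<open>Inverse semigroups\<close>

lemma inv_star_inv_star [simp]: "inv_star (inv_star s) = s"
  for s :: "'a::inverse_semigroup"
  by (rule inv_star_unique) (simp_all add: inv_star_inverse)

lemma inv_star_mult: "inv_star (s * t) = inv_star t * inv_star s"
  for s t :: "'a::inverse_semigroup"
proof (rule inv_star_unique)
  have c: "(inv_star s * s) * (t * inv_star t) = (t * inv_star t) * (inv_star s * s)"
    by (intro idem_commute idem_star_mult)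
  have "s * t * (inv_star t * inv_star s) * (s * t) =
      s * ((t * inv_star t) * (inv_star s * s)) * t" by (simp add: mult.assoc)
  also have "\<dots> = (s * inv_star s * s) * (t * inv_star t * t)"
    unfolding c[symmetric] by (simp add: mult.assoc)
  finally show "s * t * (inv_star t * inv_star s) * (s * t) = s * t"
    by (simp add: inv_star_inverse)
  have "inv_star t * inv_star s * (s * t) * (inv_star t * inv_star s) =
      inv_star t * ((inv_star s * s) * (t * inv_star t)) * inv_star s" by (simp add: mult.assoc)
  also have "\<dots> = (inv_star t * t * inv_star t) * (inv_star s * s * inv_star s)"
    unfolding c by (simp add: mult.assoc)
  finally show "inv_star t * inv_star s * (s * t) * (inv_star t * inv_star s) = inv_star t * inv_star s"
    by (simp add: inv_star_inverse)
qed

lemma idem_left: "idem e \<Longrightarrow> e * (e * s) = e * s" for s :: "'a::inverse_semigroup"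
  by (simp add: idem_def flip: mult.assoc)

text \<open>For idempotent \<open>a\<close> the equation \<open>e * a = a\<close> means that
  \<open>a\<close> lies below \<open>e\<close> in the natural order, so this says that
  \<open>e * f\<close> is the meet of \<open>e\<close> and \<open>f\<close>.\<close>

lemma idem_mult_le_iff:
  fixes a e :: "'a::inverse_semigroup"
  assumes "idem e" "idem f"
  shows "(e * f) * a = a \<longleftrightarrow> e * a = a \<and> f * a = a"
proof
  assume a: "(e * f) * a = a"
  have "e * ((e * f) * a) = (e * f) * a" using idem_left[OF assms(1)] by (simp add: mult.assoc)
  moreover have "f * ((f * e) * a) = (f * e) * a" using idem_left[OF assms(2)] by (simp add: mult.assoc)
  ultimately show "e * a = a \<and> f * a = a" using a idem_commute[OF assms] by simp
qed (simp add: mult.assoc)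

lemma sigma_map_closed [simp, intro]: "sigma_map s \<in> carrier max_group_image"
  by (simp add: carrier_max_group_image)

lemma sigma_map_inv_star: "sigma_map (inv_star s) = inv\<^bsub>max_group_image\<^esub> (sigma_map s)"
proof -
  interpret group "max_group_image :: 'a set monoid" by (rule group_max_group_image)
  have "sigma_map (inv_star s) \<otimes>\<^bsub>max_group_image\<^esub> sigma_map s = \<one>\<^bsub>max_group_image\<^esub>"
    by (simp add: sigma_map_mult sigma_map_idem[OF idem_star_mult(1)])
  then show ?thesis using inv_equality[of "sigma_map (inv_star s)" "sigma_map s"] by simp
qed

lemma sigma_map_idem_mult:
  assumes "idem e"
  shows "sigma_map (e * s) = sigma_map s" "sigma_map (s * e) = sigma_map s"
proof -
  interpret group "max_group_image :: 'a set monoid" by (rule group_max_group_image)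
  show "sigma_map (e * s) = sigma_map s" "sigma_map (s * e) = sigma_map s"
    by (simp_all flip: sigma_map_mult add: sigma_map_idem[OF assms])
qed

text \<open>\<open>s\<close> and \<open>t\<close> have the same image in the group exactly when
  \<open>inv_star t * s\<close> is in the kernel of \<open>sigma_map\<close>, and E-unitarity
  identifies this kernel with the idempotents.\<close>

lemma sigma_map_eq_iff_idem:
  fixes s t :: "'a::inverse_semigroup"
  assumes "E_unitary TYPE('a)"
  shows "sigma_map s = sigma_map t \<longleftrightarrow> idem (inv_star t * s)"
proof -
  interpret group "max_group_image :: 'a set monoid" by (rule group_max_group_image)
  have "idem (inv_star t * s) \<longleftrightarrow> sigma_map (inv_star t * s) = \<one>\<^bsub>max_group_image\<^esub>"
    using assms sigma_map_idem unfolding E_unitary_def by blast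
  also have "\<dots> \<longleftrightarrow> sigma_map s = sigma_map t"
    by (simp flip: sigma_map_mult add: sigma_map_inv_star)
      (metis group.inv_equality group_max_group_image inv_closed inv_inv l_inv sigma_map_closed)
  finally show ?thesis by blast
qed

text \<open>The condition on the left says that the basis vector at \<open>a\<close> is not killed by \<open>s\<close> and \<open>t\<close>,
  and that both send it to the same basis vector.\<close>

lemma same_image_iff:
  fixes a s t :: "'a::inverse_semigroup"
  assumes E: "E_unitary TYPE('a)" and a: "idem a"
  shows "(inv_star s * s * a = a \<and> inv_star t * t * a = a \<and> s * a = t * a) \<longleftrightarrow>
    idem (inv_star t * s) \<and> inv_star t * s * a = a"
proof
  assume L: "inv_star s * s * a = a \<and> inv_star t * t * a = a \<and> s * a = t * a"
  have "sigma_map s = sigma_map t"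
    using L sigma_map_idem_mult(2)[OF a] by metis
  then have "idem (inv_star t * s)" using sigma_map_eq_iff_idem[OF E] by blast
  moreover have "inv_star t * s * a = a" using L by (metis mult.assoc)
  ultimately show "idem (inv_star t * s) \<and> inv_star t * s * a = a" by simp
next
  assume R: "idem (inv_star t * s) \<and> inv_star t * s * a = a"
  define e where "e = inv_star t * s"
  have e: "idem e" "e * a = a" using R by (auto simp: e_def)
  have e': "e = inv_star s * t"
    using idem_inv_star[OF e(1)] by (simp add: e_def inv_star_mult)
  have "e * (inv_star s * s) = e" "e * (inv_star t * t) = e"
    using inv_star_inverse[of s] inv_star_inverse[of t]
    by (simp add: e_def mult.assoc) (simp add: e' mult.assoc inv_star_inverse[unfolded mult.assoc])
  then have 1: "inv_star s * s * a = a" and 2: "inv_star t * t * a = a"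
    using e idem_commute[OF e(1) idem_star_mult(1)] by (metis mult.assoc)+
  \<comment> \<open>Each of \<open>s * a\<close> and \<open>t * a\<close> is an idempotent multiple
    of the other. The chain below is the antisymmetry of the natural order, written out.\<close>
  have sa: "s * a = (s * inv_star s) * (t * a)"
    using e by (metis e' mult.assoc)
  have ta: "t * a = (t * inv_star t) * (s * a)"
    using e by (metis e_def mult.assoc)
  have "s * a = (s * inv_star s) * (t * inv_star t) * (s * a)"
    using sa ta by (metis mult.assoc)
  also have "\<dots> = (t * inv_star t) * ((s * inv_star s) * (s * a))"
    using idem_commute[OF idem_star_mult(2) idem_star_mult(2)] by (metis mult.assoc)
  also have "\<dots> = (t * inv_star t) * (s * a)"
    using idem_left[OF idem_star_mult(2)] by (simp add: inv_star_inverse flip: mult.assoc)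
  also have "\<dots> = t * a" using ta by simp
  finally show "inv_star s * s * a = a \<and> inv_star t * t * a = a \<and> s * a = t * a" using 1 2 by simp
qed

subsection \<open>The semigroup algebra\<close>

text \<open>Extended representations, the operations of the semigroup algebra and its functionals
  all have this form, so additivity and the effect of products and stars are proved once, for a
  general target.\<close>

definition sa_sum :: "('a \<Rightarrow> complex \<Rightarrow> 'b::comm_monoid_add) \<Rightarrow> 'a semigroup_algebra \<Rightarrow> 'b"
  where "sa_sum F f = (\<Sum>s\<in>Poly_Mapping.keys f. F s (Poly_Mapping.lookup f s))"

lemma sa_sum_superset:
  assumes "finite A" "Poly_Mapping.keys f \<subseteq> A" "\<And>s. F s 0 = 0"
  shows "sa_sum F f = (\<Sum>s\<in>A. F s (Poly_Mapping.lookup f s))"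
  unfolding sa_sum_def using assms by (intro sum.mono_neutral_left) (auto simp: in_keys_iff)

lemma sa_sum_zero [simp]: "sa_sum F 0 = 0"
  by (simp add: sa_sum_def)

lemma sa_sum_add:
  assumes "\<And>s. F s 0 = 0" "\<And>s c d. F s (c + d) = F s c + F s d"
  shows "sa_sum F (f + g) = sa_sum F f + sa_sum F g"
proof -
  define A where "A = Poly_Mapping.keys f \<union> Poly_Mapping.keys g"
  have A: "finite A" "Poly_Mapping.keys f \<subseteq> A" "Poly_Mapping.keys g \<subseteq> A" "Poly_Mapping.keys (f + g) \<subseteq> A"
    using Poly_Mapping.keys_add[of f g] by (auto simp: A_def)
  show ?thesis
    using A by (simp add: sa_sum_superset[of A _ F] assms lookup_add sum.distrib)
qed

lemma sa_sum_single: "(\<And>s. F s 0 = 0) \<Longrightarrow> sa_sum F (Poly_Mapping.single s c) = F s c"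
  by (simp add: sa_sum_def)

lemma sa_sum_sum:
  assumes "\<And>s. F s 0 = 0" "\<And>s c d. F s (c + d) = F s c + F s d"
  shows "sa_sum F (\<Sum>i\<in>I. f i) = (\<Sum>i\<in>I. sa_sum F (f i))"
  by (induction I rule: infinite_finite_induct) (simp_all add: sa_sum_add[of F, OF assms])

lemma sa_sum_mult:
  assumes "\<And>s. F s 0 = 0" "\<And>s c d. F s (c + d) = F s c + F s d"
  shows "sa_sum F (sa_mult f g) = sa_sum (\<lambda>s c. sa_sum (\<lambda>t d. F (s * t) (c * d)) g) f"
  unfolding sa_mult_def sa_sum_sum[of F, OF assms] sa_sum_single[of F, OF assms(1)]
  by (simp add: sa_sum_def)

lemma sa_sum_star:
  assumes "\<And>s. F s 0 = 0" "\<And>s c d. F s (c + d) = F s c + F s d"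
  shows "sa_sum F (sa_star f) = sa_sum (\<lambda>s c. F (inv_star s) (cnj c)) f"
  unfolding sa_star_def sa_sum_sum[of F, OF assms] sa_sum_single[of F, OF assms(1)]
  by (simp add: sa_sum_def)

lemma sa_sum_scale:
  assumes "\<And>s. F s 0 = 0" "\<And>s c d. F s (c + d) = F s c + F s d"
  shows "sa_sum F (sa_scale k f) = sa_sum (\<lambda>s c. F s (k * c)) f"
  unfolding sa_scale_def sa_sum_sum[of F, OF assms] sa_sum_single[of F, OF assms(1)]
  by (simp add: sa_sum_def)

subsection \<open>Bounded operators\<close>

context hilb
begin

lemma hnorm_uminus: "x \<in> carrier H \<Longrightarrow> hnorm H (- x) = hnorm H x"
  using hnorm_scale[of x "-1"] by simp

lemma hnorm_diff_triangle:
  "x \<in> carrier H \<Longrightarrow> y \<in> carrier H \<Longrightarrow> hnorm H (x - y) \<le> hnorm H x + hnorm H y"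
  using hnorm_triangle[of x "- y"] hnorm_uminus[of y] carrier_closed(4)[of 0 y] by simp

lemma hnorm_minus_commute:
  "x \<in> carrier H \<Longrightarrow> y \<in> carrier H \<Longrightarrow> hnorm H (x - y) = hnorm H (y - x)"
  using hnorm_uminus[of "x - y"] by simp

lemma hnorm_eq_0_iff: "x \<in> carrier H \<Longrightarrow> hnorm H x = 0 \<longleftrightarrow> x = 0"
  using ip_self[of x] ip_definite[of x] by auto

context
  fixes T assumes T: "bounded_op H T"
begin

lemma bounded_op_closed [simp]: "x \<in> carrier H \<Longrightarrow> T x \<in> carrier H"
  using T by (simp add: bounded_op_def)

lemma bounded_op_add: "x \<in> carrier H \<Longrightarrow> y \<in> carrier H \<Longrightarrow> T (x + y) = T x + T y"
  using T by (simp add: bounded_op_def)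

lemma bounded_op_scale: "x \<in> carrier H \<Longrightarrow> T (cscale H c x) = cscale H c (T x)"
  using T by (simp add: bounded_op_def)

lemma bounded_op_zero: "T 0 = 0"
  using bounded_op_scale[of 0 0] by simp

lemma bounded_op_diff: "x \<in> carrier H \<Longrightarrow> y \<in> carrier H \<Longrightarrow> T (x - y) = T x - T y"
  using bounded_op_add[of "x - y" y] by simp

lemma op_norm_upper: "x \<in> carrier H \<Longrightarrow> hnorm H x \<le> 1 \<Longrightarrow> hnorm H (T x) \<le> op_norm H T"
  unfolding op_norm_def
proof (rule cSup_upper)
  obtain C where C: "\<And>x. x \<in> carrier H \<Longrightarrow> hnorm H (T x) \<le> C * hnorm H x"
    using T unfolding bounded_op_def by blast
  show "bdd_above {hnorm H (T x) | x. x \<in> carrier H \<and> hnorm H x \<le> 1}"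
  proof (rule bdd_aboveI[of _ "\<bar>C\<bar>"], safe)
    fix x assume x: "x \<in> carrier H" "hnorm H x \<le> 1"
    have "C * hnorm H x \<le> \<bar>C\<bar> * 1" using x by (intro mult_mono) auto
    then show "hnorm H (T x) \<le> \<bar>C\<bar>" using C[OF x(1)] by simp
  qed
qed blast

lemma op_norm_nonneg: "0 \<le> op_norm H T"
  using op_norm_upper[of 0] by (simp add: bounded_op_zero)

lemma op_norm_bound:
  assumes x: "x \<in> carrier H"
  shows "hnorm H (T x) \<le> op_norm H T * hnorm H x"
proof (cases "hnorm H x = 0")
  case True
  then show ?thesis using x by (simp add: hnorm_eq_0_iff bounded_op_zero)
next
  case False
  then have p: "hnorm H x > 0" using hnorm_nonneg[OF x] by linarith
  define y where "y = cscale H (complex_of_real (1 / hnorm H x)) x"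
  have y: "y \<in> carrier H" "hnorm H y = 1" using x p by (simp_all add: y_def hnorm_scale norm_divide)
  have "hnorm H (T x) / hnorm H x = hnorm H (T y)"
    using x p by (simp add: y_def bounded_op_scale hnorm_scale norm_divide)
  also have "\<dots> \<le> op_norm H T" using y by (intro op_norm_upper) auto
  finally show ?thesis using p by (simp add: field_simps)
qed

end

lemma op_norm_le:
  assumes "0 \<le> B" "\<And>x. x \<in> carrier H \<Longrightarrow> hnorm H (T x) \<le> B * hnorm H x"
  shows "op_norm H T \<le> B"
  unfolding op_norm_def
proof (rule cSup_least)
  have "hnorm H (T 0) \<in> {hnorm H (T x) | x. x \<in> carrier H \<and> hnorm H x \<le> 1}"
    by (intro CollectI exI[of _ 0]) simp
  then show "{hnorm H (T x) | x. x \<in> carrier H \<and> hnorm H x \<le> 1} \<noteq> {}" by blast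
next
  fix c assume "c \<in> {hnorm H (T x) | x. x \<in> carrier H \<and> hnorm H x \<le> 1}"
  then obtain x where x: "x \<in> carrier H" "hnorm H x \<le> 1" "c = hnorm H (T x)" by blast
  then have "B * hnorm H x \<le> B * 1" using assms(1) by (intro mult_left_mono) auto
  then show "c \<le> B" using assms(2)[OF x(1)] x by simp
qed

lemma bounded_op_minus:
  assumes T: "bounded_op H T" and U: "bounded_op H U"
  shows "bounded_op H (\<lambda>x. T x - U x)"
  unfolding bounded_op_def
proof (intro conjI ballI allI exI[of _ "op_norm H T + op_norm H U"])
  fix x y c assume x: "x \<in> carrier H"
  show "T x - U x \<in> carrier H" using T U x by simp
  show "T (cscale H c x) - U (cscale H c x) = cscale H c (T x - U x)"
    using T U x by (simp add: bounded_op_scale scale_right_diff_distrib)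
  have "hnorm H (T x - U x) \<le> hnorm H (T x) + hnorm H (U x)"
    using T U x by (simp add: hnorm_diff_triangle)
  also have "\<dots> \<le> op_norm H T * hnorm H x + op_norm H U * hnorm H x"
    using T U x by (intro add_mono op_norm_bound)
  finally show "hnorm H (T x - U x) \<le> (op_norm H T + op_norm H U) * hnorm H x"
    by (simp add: distrib_right)
  assume "y \<in> carrier H"
  then show "T (x + y) - U (x + y) = T x - U x + (T y - U y)"
    using T U x by (simp add: bounded_op_add)
qed

lemma limit_unique:
  assumes u: "u \<in> carrier H" "v \<in> carrier H" and X: "\<And>n::nat. X n \<in> carrier H"
    and lim: "(\<lambda>n. hnorm H (X n - u)) \<longlonglongrightarrow> 0" "(\<lambda>n. hnorm H (X n - v)) \<longlonglongrightarrow> 0"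
  shows "u = v"
proof -
  have "hnorm H (u - v) \<le> hnorm H (X n - u) + hnorm H (X n - v)" for n
    using hnorm_diff_triangle[of "X n - v" "X n - u"] u X[of n] by (simp add: add.commute)
  moreover have "(\<lambda>n. hnorm H (X n - u) + hnorm H (X n - v)) \<longlonglongrightarrow> 0 + 0"
    using lim by (intro tendsto_add)
  ultimately have "hnorm H (u - v) \<le> 0 + 0" by (intro LIMSEQ_le_const) auto
  then have "hnorm H (u - v) = 0" using u by (intro antisym) auto
  then show ?thesis using u by (simp add: hnorm_eq_0_iff)
qed

lemma hnorm_limit_add:
  assumes "\<And>n::nat. X n \<in> carrier H" "\<And>n. Y n \<in> carrier H" "x \<in> carrier H" "y \<in> carrier H"
    and "(\<lambda>n. hnorm H (X n - x)) \<longlonglongrightarrow> 0" "(\<lambda>n. hnorm H (Y n - y)) \<longlonglongrightarrow> 0"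
  shows "(\<lambda>n. hnorm H (X n + Y n - (x + y))) \<longlonglongrightarrow> 0"
proof (rule tendsto_sandwich[OF _ _ tendsto_const])
  show "(\<lambda>n. hnorm H (X n - x) + hnorm H (Y n - y)) \<longlonglongrightarrow> 0"
    using tendsto_add[OF assms(5,6)] by simp
  show "\<forall>\<^sub>F n in sequentially. hnorm H (X n + Y n - (x + y)) \<le> hnorm H (X n - x) + hnorm H (Y n - y)"
    using hnorm_triangle[of "X _ - x" "Y _ - y"] assms by (simp add: add_diff_add)
qed (use assms in simp)

lemma hnorm_limit_scale:
  assumes "\<And>n::nat. X n \<in> carrier H" "x \<in> carrier H" "(\<lambda>n. hnorm H (X n - x)) \<longlonglongrightarrow> 0"
  shows "(\<lambda>n. hnorm H (cscale H c (X n) - cscale H c x)) \<longlonglongrightarrow> 0"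
  using assms tendsto_mult[OF tendsto_const assms(3), of "cmod c"]
  by (simp add: hnorm_scale flip: scale_right_diff_distrib)

text \<open>Completeness of the bounded operators, which supplies the values of
  \<open>Lambda_hom\<close> on classes of Cauchy sequences. The pointwise limit is restricted to the
  carrier to make it extensional.\<close>

lemma op_norm_Cauchy_limit:
  assumes T: "\<And>n::nat. bounded_op H (T n)"
    and cauchy: "\<And>\<epsilon>. \<epsilon> > 0 \<Longrightarrow> \<exists>N. \<forall>m\<ge>N. \<forall>n\<ge>N. op_norm H (\<lambda>x. T m x - T n x) < \<epsilon>"
  shows "\<exists>U\<in>extensional (carrier H). bounded_op H U \<and> (\<lambda>n. op_norm H (\<lambda>x. T n x - U x)) \<longlonglongrightarrow> 0"
proof -
  note D = bounded_op_minus[OF T T]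
  have bound: "hnorm H (T m x - T n x) \<le> op_norm H (\<lambda>x. T m x - T n x) * hnorm H x"
    if "x \<in> carrier H" for m n x
    using op_norm_bound[OF D that] .
  have "\<exists>u. u \<in> carrier H \<and> (\<lambda>n. hnorm H (T n x - u)) \<longlonglongrightarrow> 0" if x: "x \<in> carrier H" for x
  proof -
    have "\<exists>N. \<forall>m\<ge>N. \<forall>n\<ge>N. hnorm H (T m x - T n x) < \<epsilon>" if \<epsilon>: "\<epsilon> > 0" for \<epsilon>
    proof -
      define d where "d = \<epsilon> / (hnorm H x + 1)"
      have d: "d > 0" "d * hnorm H x < \<epsilon>"
        using \<epsilon> hnorm_nonneg[OF x] by (auto simp: d_def field_simps)
      obtain N where N: "\<forall>m\<ge>N. \<forall>n\<ge>N. op_norm H (\<lambda>x. T m x - T n x) < d" using cauchy[OF d(1)] by blast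
      have "hnorm H (T m x - T n x) < \<epsilon>" if "m \<ge> N" "n \<ge> N" for m n
      proof -
        have "hnorm H (T m x - T n x) \<le> op_norm H (\<lambda>x. T m x - T n x) * hnorm H x" by (rule bound[OF x])
        also have "\<dots> \<le> d * hnorm H x" using N that x by (intro mult_right_mono) (auto intro: less_imp_le)
        finally show ?thesis using d(2) by simp
      qed
      then show ?thesis by blast
    qed
    then show ?thesis using complete[of "\<lambda>n. T n x"] T x by auto
  qed
  then obtain V where V: "\<And>x. x \<in> carrier H \<Longrightarrow> V x \<in> carrier H"
      "\<And>x. x \<in> carrier H \<Longrightarrow> (\<lambda>n. hnorm H (T n x - V x)) \<longlonglongrightarrow> 0" by metis
  have V_add: "V (x + y) = V x + V y" if xy: "x \<in> carrier H" "y \<in> carrier H" for x y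
  proof (rule limit_unique[where X = "\<lambda>n. T n (x + y)"])
    show "(\<lambda>n. hnorm H (T n (x + y) - (V x + V y))) \<longlonglongrightarrow> 0"
      using hnorm_limit_add[OF _ _ _ _ V(2)[OF xy(1)] V(2)[OF xy(2)]] T V xy by (simp add: bounded_op_add)
  qed (use T V xy in auto)
  have V_scale: "V (cscale H c x) = cscale H c (V x)" if x: "x \<in> carrier H" for x c
  proof (rule limit_unique[where X = "\<lambda>n. T n (cscale H c x)"])
    show "(\<lambda>n. hnorm H (T n (cscale H c x) - cscale H c (V x))) \<longlonglongrightarrow> 0"
      using hnorm_limit_scale[OF _ _ V(2)[OF x]] T V x by (simp add: bounded_op_scale)
  qed (use T V x in auto)
  have V_near: "\<exists>N. \<forall>n\<ge>N. \<forall>x\<in>carrier H. hnorm H (T n x - V x) \<le> \<epsilon> * hnorm H x" if \<epsilon>: "\<epsilon> > 0" for \<epsilon>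
  proof -
    obtain N where N: "\<forall>m\<ge>N. \<forall>n\<ge>N. op_norm H (\<lambda>x. T m x - T n x) < \<epsilon>" using cauchy[OF \<epsilon>] by blast
    have "hnorm H (T n x - V x) \<le> \<epsilon> * hnorm H x" if n: "n \<ge> N" and x: "x \<in> carrier H" for n x
    proof -
      have "\<forall>\<^sub>F m in sequentially. hnorm H (T n x - V x) \<le> \<epsilon> * hnorm H x + hnorm H (T m x - V x)"
      proof (rule eventually_sequentiallyI[of N])
        fix m assume m: "m \<ge> N"
        have "hnorm H (T n x - V x) \<le> hnorm H (T n x - T m x) + hnorm H (T m x - V x)"
          using hnorm_triangle[of "T n x - T m x" "T m x - V x"] T V x by simp
        moreover have "hnorm H (T n x - T m x) \<le> op_norm H (\<lambda>x. T n x - T m x) * hnorm H x"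
          by (rule bound[OF x])
        moreover have "\<dots> \<le> \<epsilon> * hnorm H x" using N n m x by (intro mult_right_mono) (auto intro: less_imp_le)
        ultimately show "hnorm H (T n x - V x) \<le> \<epsilon> * hnorm H x + hnorm H (T m x - V x)" by linarith
      qed
      moreover have "(\<lambda>m. \<epsilon> * hnorm H x + hnorm H (T m x - V x)) \<longlonglongrightarrow> \<epsilon> * hnorm H x + 0"
        using V(2)[OF x] by (intro tendsto_intros)
      ultimately show ?thesis
        using tendsto_le[OF sequentially_bot _ tendsto_const] by fastforce
    qed
    then show ?thesis by blast
  qed
  have V_bdd: "bounded_op H V"
  proof -
    obtain N where N: "\<forall>n\<ge>N. \<forall>x\<in>carrier H. hnorm H (T n x - V x) \<le> 1 * hnorm H x"
      using V_near[of 1] by auto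
    have "hnorm H (V x) \<le> (op_norm H (T N) + 1) * hnorm H x" if x: "x \<in> carrier H" for x
    proof -
      have "hnorm H (V x) \<le> hnorm H (T N x) + hnorm H (T N x - V x)"
        using hnorm_diff_triangle[of "T N x" "T N x - V x"] T V x by simp
      also have "\<dots> \<le> op_norm H (T N) * hnorm H x + 1 * hnorm H x"
        using N x T by (intro add_mono op_norm_bound) auto
      finally show ?thesis by (simp add: distrib_right)
    qed
    then have "\<exists>C. \<forall>x\<in>carrier H. hnorm H (V x) \<le> C * hnorm H x" by blast
    with V(1) V_add V_scale show ?thesis unfolding bounded_op_def by simp
  qed
  define U where "U = restrict V (carrier H)"
  have U: "U x = V x" if "x \<in> carrier H" for x using that by (simp add: U_def)
  have "bounded_op H U"
    using V_bdd unfolding bounded_op_def by (simp add: U carrier_closed)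
  moreover have "(\<lambda>n. op_norm H (\<lambda>x. T n x - U x)) \<longlonglongrightarrow> 0"
  proof (rule LIMSEQ_I)
    fix \<epsilon> :: real assume \<epsilon>: "\<epsilon> > 0"
    obtain N where N: "\<forall>n\<ge>N. \<forall>x\<in>carrier H. hnorm H (T n x - V x) \<le> \<epsilon> / 2 * hnorm H x"
      using V_near[of "\<epsilon> / 2"] \<epsilon> by auto
    have "norm (op_norm H (\<lambda>x. T n x - U x) - 0) < \<epsilon>" if "n \<ge> N" for n
    proof -
      have "op_norm H (\<lambda>x. T n x - U x) \<le> \<epsilon> / 2"
        using N that \<epsilon> by (intro op_norm_le) (auto simp: U)
      moreover have "0 \<le> op_norm H (\<lambda>x. T n x - U x)"
        by (rule op_norm_nonneg[OF bounded_op_minus[OF T \<open>bounded_op H U\<close>]])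
      ultimately show ?thesis using \<epsilon> by simp
    qed
    then show "\<exists>N. \<forall>n\<ge>N. norm (op_norm H (\<lambda>x. T n x - U x) - 0) < \<epsilon>" by blast
  qed
  moreover have "U \<in> extensional (carrier H)" by (simp add: U_def)
  ultimately show ?thesis by blast
qed

end

subsection \<open>The extension of a representation to the semigroup algebra\<close>

context hilb_rep
begin

abbreviation ext :: "'a semigroup_algebra \<Rightarrow> 'h \<Rightarrow> 'h"
  where "ext f \<equiv> rep_ext H \<pi> f"

lemma ext_eq: "x \<in> carrier H \<Longrightarrow> ext f x = sa_sum (\<lambda>s c. cscale H c (\<pi> s x)) f"
  by (simp add: rep_ext_def sa_sum_def)

lemma ext_closed [simp, intro]: "x \<in> carrier H \<Longrightarrow> ext f x \<in> carrier H"
  by (simp add: rep_ext_def)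

lemma rep_zero [simp]: "\<pi> s 0 = 0"
  using rep_scale[of 0 s 0] by simp

lemma rep_sum: "(\<And>i. i \<in> I \<Longrightarrow> x i \<in> carrier H) \<Longrightarrow> \<pi> s (\<Sum>i\<in>I. x i) = (\<Sum>i\<in>I. \<pi> s (x i))"
  by (induction I rule: infinite_finite_induct) (simp_all add: rep_add carrier_closed)

lemma bounded_op_ext: "bounded_op H (ext f)"
  unfolding bounded_op_def
proof (intro conjI ballI allI exI)
  fix x y c assume x: "x \<in> carrier H"
  show "ext f x \<in> carrier H" using x by simp
  show "ext f (cscale H c x) = cscale H c (ext f x)"
    using x by (simp add: rep_ext_def rep_scale scale_sum_right mult.commute)
  show "hnorm H (ext f x) \<le>
      (\<Sum>s\<in>Poly_Mapping.keys f. cmod (Poly_Mapping.lookup f s)) * hnorm H x"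
    by (rule rep_ext_bound[OF x])
  assume "y \<in> carrier H"
  then show "ext f (x + y) = ext f x + ext f y"
    using x by (simp add: rep_ext_def rep_add scale_right_distrib sum.distrib)
qed

lemma ext_zero: "x \<in> carrier H \<Longrightarrow> ext 0 x = 0"
  by (simp add: rep_ext_def)

lemma ext_add: "x \<in> carrier H \<Longrightarrow> ext (f + g) x = ext f x + ext g x"
  by (simp add: ext_eq sa_sum_add scale_left_distrib)

lemma ext_diff: "x \<in> carrier H \<Longrightarrow> ext (f - g) x = ext f x - ext g x"
  using ext_add[of x "f - g" g] by simp

lemma ext_sa_scale: "x \<in> carrier H \<Longrightarrow> ext (sa_scale c f) x = cscale H c (ext f x)"
  by (simp add: ext_eq sa_sum_scale scale_left_distrib distrib_left)
    (simp add: sa_sum_def scale_sum_right)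

lemma ext_mult:
  assumes x: "x \<in> carrier H"
  shows "ext (sa_mult f g) x = ext f (ext g x)"
proof -
  have "ext (sa_mult f g) x =
      sa_sum (\<lambda>s c. sa_sum (\<lambda>t d. cscale H (c * d) (\<pi> (s * t) x)) g) f"
    using x by (simp add: ext_eq sa_sum_mult scale_left_distrib)
  also have "\<dots> = sa_sum (\<lambda>s c. cscale H c (\<pi> s (ext g x))) f"
    using x by (simp add: sa_sum_def rep_ext_def rep_sum rep_scale rep_mult scale_sum_right)
  finally show ?thesis using x by (simp add: ext_eq[of "ext g x"])
qed

lemma ip_sum_right:
  assumes "\<And>i. i \<in> I \<Longrightarrow> x i \<in> carrier H" "z \<in> carrier H"
  shows "ip H z (\<Sum>i\<in>I. x i) = (\<Sum>i\<in>I. ip H z (x i))"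
  using assms by (induction I rule: infinite_finite_induct) (simp_all add: ip_add_right carrier_closed)

lemma ext_adj:
  assumes x: "x \<in> carrier H" and y: "y \<in> carrier H"
  shows "ip H (ext f x) y = ip H x (ext (sa_star f) y)"
proof -
  have "ext (sa_star f) y = sa_sum (\<lambda>s c. cscale H (cnj c) (\<pi> (inv_star s) y)) f"
    using y by (simp add: ext_eq sa_sum_star scale_left_distrib)
  then show ?thesis
    using x y by (simp add: sa_sum_def rep_ext_def ip_sum_left ip_sum_right ip_scale_left ip_scale_right rep_adj)
qed

definition ext_norm :: "'a semigroup_algebra \<Rightarrow> real"
  where "ext_norm f = op_norm H (ext f)"

lemma ext_norm_bound: "x \<in> carrier H \<Longrightarrow> hnorm H (ext f x) \<le> ext_norm f * hnorm H x"
  unfolding ext_norm_def by (rule op_norm_bound[OF bounded_op_ext])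

lemma ext_norm_le:
  "0 \<le> B \<Longrightarrow> (\<And>x. x \<in> carrier H \<Longrightarrow> hnorm H (ext f x) \<le> B * hnorm H x) \<Longrightarrow> ext_norm f \<le> B"
  unfolding ext_norm_def by (rule op_norm_le)

lemma ext_norm_nonneg: "0 \<le> ext_norm f"
  unfolding ext_norm_def by (rule op_norm_nonneg[OF bounded_op_ext])

lemma ext_norm_mult: "ext_norm (sa_mult f g) \<le> ext_norm f * ext_norm g"
proof (rule ext_norm_le)
  fix x assume x: "x \<in> carrier H"
  have "hnorm H (ext f (ext g x)) \<le> ext_norm f * hnorm H (ext g x)" using x by (intro ext_norm_bound) auto
  also have "\<dots> \<le> ext_norm f * (ext_norm g * hnorm H x)"
    using x by (intro mult_left_mono ext_norm_bound ext_norm_nonneg)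
  finally show "hnorm H (ext (sa_mult f g) x) \<le> ext_norm f * ext_norm g * hnorm H x"
    using x by (simp add: ext_mult mult.assoc)
qed (simp add: ext_norm_nonneg)

lemma ext_norm_add: "ext_norm (f + g) \<le> ext_norm f + ext_norm g"
proof (rule ext_norm_le)
  fix x assume x: "x \<in> carrier H"
  have "hnorm H (ext (f + g) x) \<le> hnorm H (ext f x) + hnorm H (ext g x)"
    using x by (simp add: ext_add hnorm_triangle)
  also have "\<dots> \<le> ext_norm f * hnorm H x + ext_norm g * hnorm H x"
    using x by (intro add_mono ext_norm_bound)
  finally show "hnorm H (ext (f + g) x) \<le> (ext_norm f + ext_norm g) * hnorm H x"
    by (simp add: distrib_right)
qed (simp add: ext_norm_nonneg)

lemma ext_norm_scale: "ext_norm (sa_scale c f) \<le> cmod c * ext_norm f"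
proof (rule ext_norm_le)
  fix x assume x: "x \<in> carrier H"
  then show "hnorm H (ext (sa_scale c f) x) \<le> cmod c * ext_norm f * hnorm H x"
    using ext_norm_bound[OF x, of f] by (simp add: ext_sa_scale hnorm_scale mult.assoc mult_left_mono)
qed (simp add: ext_norm_nonneg)

lemma ext_norm_star: "ext_norm (sa_star f) \<le> ext_norm f"
proof (rule ext_norm_le)
  fix x assume x: "x \<in> carrier H"
  let ?y = "ext (sa_star f) x"
  have y: "?y \<in> carrier H" using x by simp
  have "(hnorm H ?y)\<^sup>2 = cmod (ip H ?y ?y)"
    using ip_self[OF y] by (simp del: of_real_power)
  also have "\<dots> = cmod (ip H (ext f ?y) x)" using ext_adj[OF y x, of f] by simp
  also have "\<dots> \<le> hnorm H (ext f ?y) * hnorm H x" using x y by (intro Cauchy_Schwarz) auto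
  also have "\<dots> \<le> (ext_norm f * hnorm H ?y) * hnorm H x"
    using x y by (intro mult_right_mono ext_norm_bound) auto
  finally have "hnorm H ?y * hnorm H ?y \<le> (ext_norm f * hnorm H x) * hnorm H ?y"
    by (simp add: power2_eq_square mult_ac)
  then show "hnorm H ?y \<le> ext_norm f * hnorm H x"
    using y x hnorm_nonneg[OF y] ext_norm_nonneg[of f]
    by (cases "hnorm H ?y = 0") (simp_all add: mult_le_cancel_right)
qed (simp add: ext_norm_nonneg)

lemma ext_norm_le_full_norm: "ext_norm f \<le> full_norm f"
  unfolding ext_norm_def by (rule full_norm_universal[OF hilbert rep])

end

subsection \<open>The full norm\<close>

lemma full_norm_le:
  fixes f :: "'a::inverse_semigroup semigroup_algebra"
  assumes "0 \<le> B"
    and le: "\<And>(H :: ('a option \<Rightarrow> complex) hilbert) \<pi>. hilb_rep H \<pi> \<Longrightarrow> op_norm H (rep_ext H \<pi> f) \<le> B"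
  shows "full_norm f \<le> B"
  unfolding full_norm_def
proof (rule cSup_least)
  \<comment> \<open>The supremum of an empty set is unspecified, so at least one representation is
    needed; the zero space carries one.\<close>
  define H :: "('a option \<Rightarrow> complex) hilbert" where
    "H = \<lparr>carrier = {0}, cscale = (\<lambda>c u i. c * u i), ip = (\<lambda>_ _. 0)\<rparr>"
  interpret V: vector_space "\<lambda>(c::complex) u (i::'a option). c * u i" by (rule vector_space_pointwise)
  have H: "carrier H = {0}" "cscale H = (\<lambda>c u i. c * u i)" "\<And>u v. ip H u v = 0" "\<And>u. hnorm H u = 0"
    by (simp_all add: H_def hnorm_def)
  have "hilbert_space H"
    unfolding hilbert_space_def H(1,2)
    by (intro conjI V.vector_space_axioms V.subspace_single_0) (simp_all add: H(3,4))
  moreover have "is_representation H (\<lambda>_ :: 'a. \<lambda>x. x)"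
    unfolding is_representation_def partial_isometry_def bounded_op_def H(1,2)
    by (simp add: H(3,4) fun_eq_iff)
  ultimately have "op_norm H (rep_ext H (\<lambda>_ :: 'a. \<lambda>x. x) f) \<in> {op_norm H (rep_ext H \<pi> f) |
    (H :: ('a option \<Rightarrow> complex) hilbert) \<pi>. hilbert_space H \<and> is_representation H \<pi>}"
    by (intro CollectI exI[of _ H] exI[of _ "\<lambda>_ x. x"]) simp
  then show "{op_norm H (rep_ext H \<pi> f) |
    (H :: ('a option \<Rightarrow> complex) hilbert) \<pi>. hilbert_space H \<and> is_representation H \<pi>} \<noteq> {}"
    by (rule ex_in_conv[THEN iffD1, OF exI])
next
  fix c assume "c \<in> {op_norm H (rep_ext H \<pi> f) |
    (H :: ('a option \<Rightarrow> complex) hilbert) \<pi>. hilbert_space H \<and> is_representation H \<pi>}"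
  then obtain H :: "('a option \<Rightarrow> complex) hilbert" and \<pi> where
    "hilbert_space H" "is_representation H \<pi>" "c = op_norm H (rep_ext H \<pi> f)" by blast
  then show "c \<le> B" using le[of H \<pi>] by (simp add: hilb_rep_def hilb_def hilb_rep_axioms_def)
qed

text \<open>The space on which every element of the semigroup acts as the identity. Its ambient type
  is not the one in \<open>full_norm\<close>; \<open>full_norm_universal\<close> bridges the
  difference.\<close>

definition triv_space :: "complex hilbert"
  where "triv_space = \<lparr>carrier = UNIV, cscale = (*), ip = (\<lambda>x y. x * cnj y)\<rparr>"

lemma hnorm_triv: "hnorm triv_space x = cmod x"
  by (simp add: triv_space_def hnorm_def cmod_def power2_eq_square)

lemma hilb_rep_triv: "hilb_rep triv_space (\<lambda>s :: 'a::inverse_semigroup. \<lambda>x. x)"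
proof
  show "hilbert_space triv_space"
    unfolding hilbert_space_def
  proof (intro conjI allI impI)
    show V: "vector_space (cscale triv_space)"
      by unfold_locales (auto simp: triv_space_def algebra_simps)
    show "module.subspace (cscale triv_space) (carrier triv_space)"
      using module.subspace_UNIV[OF V[folded module_iff_vector_space]] by (simp add: triv_space_def)
    fix X :: "nat \<Rightarrow> complex"
    assume "(\<forall>n. X n \<in> carrier triv_space) \<and>
      (\<forall>\<epsilon>>0. \<exists>N. \<forall>m\<ge>N. \<forall>n\<ge>N. hnorm triv_space (X m - X n) < \<epsilon>)"
    then have "Cauchy X" by (simp add: Cauchy_def dist_norm hnorm_triv)
    then obtain x where "X \<longlonglongrightarrow> x" using Cauchy_convergent convergent_def by blast
    then have "(\<lambda>n. hnorm triv_space (X n - x)) \<longlonglongrightarrow> 0"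
      by (simp add: hnorm_triv LIM_zero_iff tendsto_norm_zero_iff)
    then show "\<exists>x\<in>carrier triv_space. (\<lambda>n. hnorm triv_space (X n - x)) \<longlonglongrightarrow> 0"
      by (intro bexI[of _ x]) (auto simp: triv_space_def)
  qed (auto simp: triv_space_def algebra_simps)
  show "is_representation triv_space (\<lambda>s :: 'a. \<lambda>x. x)"
    unfolding is_representation_def partial_isometry_def bounded_op_def
    by (auto simp: triv_space_def intro!: exI[of _ 1])
qed

lemma full_norm_nonneg: "0 \<le> full_norm f"
proof -
  interpret hilb_rep triv_space "\<lambda>s :: 'a. \<lambda>x. x" by (rule hilb_rep_triv)
  show ?thesis using ext_norm_nonneg[of f] ext_norm_le_full_norm[of f] by linarith
qed

lemma hilb_rep_ext_norm_le_full:
  fixes f :: "'a::inverse_semigroup semigroup_algebra"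
  assumes "0 \<le> B"
    and "\<And>(H :: ('a option \<Rightarrow> complex) hilbert) \<pi>. hilb_rep H \<pi> \<Longrightarrow> hilb_rep.ext_norm H \<pi> f \<le> B"
  shows "full_norm f \<le> B"
proof (rule full_norm_le[OF assms(1)])
  fix H :: "('a option \<Rightarrow> complex) hilbert" and \<pi> :: "'a \<Rightarrow> _" assume "hilb_rep H \<pi>"
  then show "op_norm H (rep_ext H \<pi> f) \<le> B"
    using assms(2)[of H \<pi>] by (simp add: hilb_rep.ext_norm_def)
qed

lemma full_norm_mult: "full_norm (sa_mult f g) \<le> full_norm f * full_norm g"
proof (rule hilb_rep_ext_norm_le_full)
  fix H :: "('a option \<Rightarrow> complex) hilbert" and \<pi> :: "'a \<Rightarrow> _" assume "hilb_rep H \<pi>"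
  then interpret hilb_rep H \<pi> .
  show "ext_norm (sa_mult f g) \<le> full_norm f * full_norm g"
    by (rule order_trans[OF ext_norm_mult mult_mono])
      (simp_all add: ext_norm_le_full_norm full_norm_nonneg ext_norm_nonneg)
qed (simp add: full_norm_nonneg)

lemma full_norm_add: "full_norm (f + g) \<le> full_norm f + full_norm g"
proof (rule hilb_rep_ext_norm_le_full)
  fix H :: "('a option \<Rightarrow> complex) hilbert" and \<pi> :: "'a \<Rightarrow> _" assume "hilb_rep H \<pi>"
  then interpret hilb_rep H \<pi> .
  show "ext_norm (f + g) \<le> full_norm f + full_norm g"
    by (rule order_trans[OF ext_norm_add add_mono]) (rule ext_norm_le_full_norm)+
qed (simp add: full_norm_nonneg)

lemma full_norm_scale: "full_norm (sa_scale c f) \<le> cmod c * full_norm f"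
proof (rule hilb_rep_ext_norm_le_full)
  fix H :: "('a option \<Rightarrow> complex) hilbert" and \<pi> :: "'a \<Rightarrow> _" assume "hilb_rep H \<pi>"
  then interpret hilb_rep H \<pi> .
  show "ext_norm (sa_scale c f) \<le> cmod c * full_norm f"
    by (rule order_trans[OF ext_norm_scale mult_left_mono]) (simp_all add: ext_norm_le_full_norm)
qed (simp add: full_norm_nonneg)

lemma full_norm_star: "full_norm (sa_star f) \<le> full_norm f"
proof (rule hilb_rep_ext_norm_le_full)
  fix H :: "('a option \<Rightarrow> complex) hilbert" and \<pi> :: "'a \<Rightarrow> _" assume "hilb_rep H \<pi>"
  then interpret hilb_rep H \<pi> .
  show "ext_norm (sa_star f) \<le> full_norm f"
    by (rule order_trans[OF ext_norm_star ext_norm_le_full_norm])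
qed (simp add: full_norm_nonneg)

lemma full_norm_zero [simp]: "full_norm 0 = 0"
proof (rule antisym[OF hilb_rep_ext_norm_le_full full_norm_nonneg])
  fix H :: "('a option \<Rightarrow> complex) hilbert" and \<pi> :: "'a \<Rightarrow> _" assume "hilb_rep H \<pi>"
  then interpret hilb_rep H \<pi> .
  show "ext_norm 0 \<le> 0" by (rule ext_norm_le) (simp_all add: ext_zero)
qed simp

subsection \<open>The Hilbert space of square-summable functions\<close>

lemma ell2_simps:
  "carrier ell2 = {x. (\<lambda>i. (cmod (x i))\<^sup>2) summable_on UNIV}"
  "cscale ell2 = (\<lambda>c x i. c * x i)"
  "ip ell2 = (\<lambda>x y. \<Sum>\<^sub>\<infinity>i. x i * cnj (y i))"
  by (simp_all add: ell2_def)

lemma carrier_ell2I: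
  assumes "\<And>F. finite F \<Longrightarrow> (\<Sum>i\<in>F. (cmod (x i))\<^sup>2) \<le> B"
  shows "x \<in> carrier ell2"
  unfolding ell2_simps mem_Collect_eq
  by (rule nonneg_bdd_above_summable_on) (use assms in \<open>auto intro!: bdd_aboveI2[of _ _ B]\<close>)

lemma ell2_ip_summable:
  assumes "x \<in> carrier ell2" "y \<in> carrier ell2"
  shows "(\<lambda>i. x i * cnj (y i)) summable_on UNIV"
proof -
  have "(\<lambda>i. norm (x i * x i)) summable_on UNIV" "(\<lambda>i. norm (cnj (y i) * cnj (y i))) summable_on UNIV"
    using assms by (simp_all add: ell2_simps norm_mult power2_eq_square)
  then show ?thesis by (rule abs_summable_summable[OF abs_summable_product])
qed

lemma hnorm_ell2_power2:
  assumes "x \<in> carrier ell2"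
  shows "(hnorm ell2 x)\<^sup>2 = (\<Sum>\<^sub>\<infinity>i. (cmod (x i))\<^sup>2)" and "0 \<le> hnorm ell2 x"
proof -
  have "Re (ip ell2 x x) = (\<Sum>\<^sub>\<infinity>i. Re (x i * cnj (x i)))"
    unfolding ell2_simps(3) by (rule infsum_Re[symmetric, OF ell2_ip_summable[OF assms assms]])
  also have "\<dots> = (\<Sum>\<^sub>\<infinity>i. (cmod (x i))\<^sup>2)"
    by (intro infsum_cong) (simp add: cmod_power2, simp add: power2_eq_square)
  finally have *: "Re (ip ell2 x x) = (\<Sum>\<^sub>\<infinity>i. (cmod (x i))\<^sup>2)" .
  moreover have "0 \<le> (\<Sum>\<^sub>\<infinity>i. (cmod (x i))\<^sup>2)" by (rule infsum_nonneg) simp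
  ultimately show "(hnorm ell2 x)\<^sup>2 = (\<Sum>\<^sub>\<infinity>i. (cmod (x i))\<^sup>2)" "0 \<le> hnorm ell2 x"
    by (simp_all add: hnorm_def)
qed

lemma sum_le_hnorm_ell2:
  "x \<in> carrier ell2 \<Longrightarrow> finite F \<Longrightarrow> (\<Sum>i\<in>F. (cmod (x i))\<^sup>2) \<le> (hnorm ell2 x)\<^sup>2"
  unfolding hnorm_ell2_power2(1) by (intro finite_sum_le_infsum) (auto simp: ell2_simps)

lemma hnorm_ell2_leI:
  assumes "\<And>F. finite F \<Longrightarrow> (\<Sum>i\<in>F. (cmod (x i))\<^sup>2) \<le> B\<^sup>2" "0 \<le> B"
  shows "hnorm ell2 x \<le> B"
proof -
  have x: "x \<in> carrier ell2" by (rule carrier_ell2I) (rule assms(1))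
  then have "(hnorm ell2 x)\<^sup>2 \<le> B\<^sup>2"
    unfolding hnorm_ell2_power2(1)[OF x]
    by (intro infsum_le_finite_sums assms) (auto simp: ell2_simps)
  then show ?thesis using assms(2) by (rule power2_le_imp_le)
qed

lemma hnorm_ell2_finite:
  assumes "finite A" "\<And>i. i \<notin> A \<Longrightarrow> x i = 0"
  shows "x \<in> carrier ell2" "(hnorm ell2 x)\<^sup>2 = (\<Sum>i\<in>A. (cmod (x i))\<^sup>2)"
proof -
  have "(\<Sum>i\<in>F. (cmod (x i))\<^sup>2) \<le> (\<Sum>i\<in>A. (cmod (x i))\<^sup>2)" if "finite F" for F
  proof -
    have "(\<Sum>i\<in>F. (cmod (x i))\<^sup>2) = (\<Sum>i\<in>F \<inter> A. (cmod (x i))\<^sup>2)"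
      using that assms(2) by (intro sum.mono_neutral_right) auto
    also have "\<dots> \<le> (\<Sum>i\<in>A. (cmod (x i))\<^sup>2)" using assms(1) by (intro sum_mono2) auto
    finally show ?thesis .
  qed
  then show x: "x \<in> carrier ell2" by (rule carrier_ell2I)
  have "(\<Sum>\<^sub>\<infinity>i. (cmod (x i))\<^sup>2) = (\<Sum>\<^sub>\<infinity>i\<in>A. (cmod (x i))\<^sup>2)"
    using assms(2) by (intro infsum_cong_neutral) auto
  then show "(hnorm ell2 x)\<^sup>2 = (\<Sum>i\<in>A. (cmod (x i))\<^sup>2)"
    using assms(1) by (simp add: hnorm_ell2_power2[OF x])
qed

lemma carrier_ell2_add:
  assumes x: "x \<in> carrier ell2" and y: "y \<in> carrier ell2"
  shows "x + y \<in> carrier ell2"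
proof (rule carrier_ell2I)
  fix F :: "'a set" assume F: "finite F"
  have "(cmod (x i + y i))\<^sup>2 \<le> 2 * (cmod (x i))\<^sup>2 + 2 * (cmod (y i))\<^sup>2" for i
  proof -
    have "(cmod (x i + y i))\<^sup>2 \<le> (cmod (x i) + cmod (y i))\<^sup>2"
      by (intro power_mono norm_triangle_ineq) simp
    also have "\<dots> \<le> (cmod (x i) + cmod (y i))\<^sup>2 + (cmod (x i) - cmod (y i))\<^sup>2" by simp
    also have "\<dots> = 2 * (cmod (x i))\<^sup>2 + 2 * (cmod (y i))\<^sup>2"
      by (simp add: power2_eq_square algebra_simps)
    finally show ?thesis .
  qed
  then have "(\<Sum>i\<in>F. (cmod ((x + y) i))\<^sup>2) \<le> (\<Sum>i\<in>F. 2 * (cmod (x i))\<^sup>2 + 2 * (cmod (y i))\<^sup>2)"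
    by (intro sum_mono) simp
  also have "\<dots> \<le> 2 * (hnorm ell2 x)\<^sup>2 + 2 * (hnorm ell2 y)\<^sup>2"
    using sum_le_hnorm_ell2[OF x F] sum_le_hnorm_ell2[OF y F]
    by (simp add: sum.distrib flip: sum_distrib_left)
  finally show "(\<Sum>i\<in>F. (cmod ((x + y) i))\<^sup>2) \<le> 2 * (hnorm ell2 x)\<^sup>2 + 2 * (hnorm ell2 y)\<^sup>2" .
qed

lemma carrier_ell2_scale: "x \<in> carrier ell2 \<Longrightarrow> (\<lambda>i. c * x i) \<in> carrier ell2"
  by (simp add: ell2_simps norm_mult power_mult_distrib summable_on_cmult_right)

lemma subspace_ell2: "module.subspace (cscale ell2) (carrier ell2)"
proof -
  interpret V: vector_space "\<lambda>(c::complex) u (i::'i). c * u i" by (rule vector_space_pointwise)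
  show ?thesis
    unfolding ell2_simps(2)
    by (rule V.subspaceI carrier_ell2_add carrier_ell2_scale | assumption | simp add: ell2_simps)+
qed

lemma ell2_complete:
  fixes X :: "nat \<Rightarrow> 'i \<Rightarrow> complex"
  assumes X: "\<And>n. X n \<in> carrier ell2"
    and cauchy: "\<And>\<epsilon>. \<epsilon> > 0 \<Longrightarrow> \<exists>N. \<forall>m\<ge>N. \<forall>n\<ge>N. hnorm ell2 (X m - X n) < \<epsilon>"
  shows "\<exists>x\<in>carrier ell2. (\<lambda>n. hnorm ell2 (X n - x)) \<longlonglongrightarrow> 0"
proof -
  have diff: "u - v \<in> carrier ell2" if "u \<in> carrier ell2" "v \<in> carrier ell2" for u v :: "'i \<Rightarrow> complex"
    using carrier_ell2_add[OF that(1) carrier_ell2_scale[OF that(2), of "-1"]]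
    by (simp add: plus_fun_def fun_diff_def)
  have "Cauchy (\<lambda>n. X n i)" for i
    unfolding Cauchy_def
  proof (intro allI impI)
    fix \<epsilon> :: real assume "\<epsilon> > 0"
    then obtain N where N: "\<forall>m\<ge>N. \<forall>n\<ge>N. hnorm ell2 (X m - X n) < \<epsilon>" using cauchy by blast
    have "cmod (X m i - X n i) \<le> hnorm ell2 (X m - X n)" for m n
    proof (rule power2_le_imp_le)
      show "(cmod (X m i - X n i))\<^sup>2 \<le> (hnorm ell2 (X m - X n))\<^sup>2"
        using sum_le_hnorm_ell2[OF diff[OF X X], of "{i}" m n] by simp
    qed (rule hnorm_ell2_power2(2)[OF diff[OF X X]])
    then show "\<exists>M. \<forall>m\<ge>M. \<forall>n\<ge>M. dist (X m i) (X n i) < \<epsilon>"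
      using N unfolding dist_norm by (meson order_le_less_trans)
  qed
  then have "\<exists>l. (\<lambda>n. X n i) \<longlonglongrightarrow> l" for i
    using Cauchy_convergent convergent_def by blast
  then obtain x where x: "\<And>i. (\<lambda>n. X n i) \<longlonglongrightarrow> x i" by metis
  have near: "(\<Sum>i\<in>F. (cmod ((X n - x) i))\<^sup>2) \<le> \<epsilon>\<^sup>2"
    if N: "\<forall>m\<ge>N. \<forall>n\<ge>N. hnorm ell2 (X m - X n) < \<epsilon>" and n: "n \<ge> N" and F: "finite F" for n N \<epsilon> F
  proof (rule LIMSEQ_le_const2)
    show "(\<lambda>m. \<Sum>i\<in>F. (cmod (X n i - X m i))\<^sup>2) \<longlonglongrightarrow> (\<Sum>i\<in>F. (cmod ((X n - x) i))\<^sup>2)"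
      unfolding fun_diff_def using x by (intro tendsto_intros)
    have "(\<Sum>i\<in>F. (cmod (X n i - X m i))\<^sup>2) \<le> \<epsilon>\<^sup>2" if "m \<ge> N" for m
    proof -
      have "(\<Sum>i\<in>F. (cmod (X n i - X m i))\<^sup>2) \<le> (hnorm ell2 (X n - X m))\<^sup>2"
        using sum_le_hnorm_ell2[OF diff[OF X X] F, of n m] by simp
      also have "\<dots> \<le> \<epsilon>\<^sup>2"
        using N n that hnorm_ell2_power2(2)[OF diff[OF X X]] by (intro power_mono) (auto intro: less_imp_le)
      finally show ?thesis .
    qed
    then show "\<exists>N. \<forall>m\<ge>N. (\<Sum>i\<in>F. (cmod (X n i - X m i))\<^sup>2) \<le> \<epsilon>\<^sup>2" by blast
  qed
  obtain N1 where N1: "\<forall>m\<ge>N1. \<forall>n\<ge>N1. hnorm ell2 (X m - X n) < 1" using cauchy[of 1] by auto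
  have "X N1 - x \<in> carrier ell2"
    using near[OF N1 order_refl] by (rule carrier_ell2I)
  then have "X N1 - (X N1 - x) \<in> carrier ell2" by (rule diff[OF X])
  moreover have "X N1 - (X N1 - x) = x" by (simp add: fun_eq_iff)
  ultimately have "x \<in> carrier ell2" by simp
  moreover have "(\<lambda>n. hnorm ell2 (X n - x)) \<longlonglongrightarrow> 0"
  proof (rule LIMSEQ_I)
    fix \<epsilon> :: real assume \<epsilon>: "\<epsilon> > 0"
    then obtain N where N: "\<forall>m\<ge>N. \<forall>n\<ge>N. hnorm ell2 (X m - X n) < \<epsilon> / 2" using cauchy[of "\<epsilon> / 2"] by auto
    have "norm (hnorm ell2 (X n - x) - 0) < \<epsilon>" if "n \<ge> N" for n
    proof -
      have "hnorm ell2 (X n - x) \<le> \<epsilon> / 2"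
        by (rule hnorm_ell2_leI[OF near[OF N that]]) (use \<epsilon> in simp_all)
      moreover have "0 \<le> hnorm ell2 (X n - x)"
        by (rule hnorm_ell2_power2(2)[OF diff[OF X \<open>x \<in> carrier ell2\<close>]])
      ultimately show ?thesis using \<epsilon> by simp
    qed
    then show "\<exists>N. \<forall>n\<ge>N. norm (hnorm ell2 (X n - x) - 0) < \<epsilon>" by blast
  qed
  ultimately show ?thesis by blast
qed

lemma hilbert_space_ell2: "hilbert_space (ell2 :: ('i \<Rightarrow> complex) hilbert)"
  unfolding hilbert_space_def
proof (intro conjI ballI allI impI)
  show "vector_space (cscale (ell2 :: ('i \<Rightarrow> complex) hilbert))"
    unfolding ell2_simps by (rule vector_space_pointwise)
  show "module.subspace (cscale ell2) (carrier (ell2 :: ('i \<Rightarrow> complex) hilbert))"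
    by (rule subspace_ell2)
next
  fix x y z :: "'i \<Rightarrow> complex" and c
  assume x: "x \<in> carrier ell2" and y: "y \<in> carrier ell2"
  show "ip ell2 (cscale ell2 c x) y = c * ip ell2 x y"
    unfolding ell2_simps by (simp add: mult.assoc infsum_cmult_right')
  show "ip ell2 y x = cnj (ip ell2 x y)"
    unfolding ell2_simps by (simp add: mult.commute flip: infsum_cnj)
  assume z: "z \<in> carrier ell2"
  show "ip ell2 (x + y) z = ip ell2 x z + ip ell2 y z"
    unfolding ell2_simps
    using infsum_add[OF ell2_ip_summable[OF x z] ell2_ip_summable[OF y z]]
    by (simp add: distrib_right)
next
  fix x :: "'i \<Rightarrow> complex" assume x: "x \<in> carrier ell2"
  show "0 \<le> Re (ip ell2 x x)"
    using hnorm_ell2_power2(2)[OF x] by (simp add: hnorm_def)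
  assume "ip ell2 x x = 0"
  then have "hnorm ell2 x = 0" by (simp add: hnorm_def)
  then have "(cmod (x i))\<^sup>2 \<le> 0" for i using sum_le_hnorm_ell2[OF x, of "{i}"] by simp
  then show "x = 0" by (simp add: fun_eq_iff)
next
  fix X :: "nat \<Rightarrow> 'i \<Rightarrow> complex"
  assume "(\<forall>n. X n \<in> carrier ell2) \<and> (\<forall>\<epsilon>>0. \<exists>N. \<forall>m\<ge>N. \<forall>n\<ge>N. hnorm ell2 (X m - X n) < \<epsilon>)"
  then show "\<exists>x\<in>carrier ell2. (\<lambda>n. hnorm ell2 (X n - x)) \<longlonglongrightarrow> 0" by (intro ell2_complete) auto
qed

subsection \<open>The left regular representation\<close>

lemma left_regular_eq:
  "left_regular a x c = (if a * inv_star a * c = c then x (inv_star a * c) else 0)"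
  by (simp add: left_regular_def left_regular_index)

lemma inj_on_left_mult: "inj_on (\<lambda>c. inv_star a * c) {c. a * inv_star a * c = c}"
  by (rule inj_on_inverseI[of _ "\<lambda>c. a * c"]) (simp add: mult.assoc)

lemma left_regular_sum_le:
  assumes "x \<in> carrier ell2" "finite F"
  shows "(\<Sum>c\<in>F. (cmod (left_regular a x c))\<^sup>2) \<le> (hnorm ell2 x)\<^sup>2"
proof -
  let ?F = "F \<inter> {c. a * inv_star a * c = c}"
  have "(\<Sum>c\<in>F. (cmod (left_regular a x c))\<^sup>2) = (\<Sum>c\<in>?F. (cmod (x (inv_star a * c)))\<^sup>2)"
    using assms(2) by (intro sum.mono_neutral_cong_right) (auto simp: left_regular_eq)
  also have "\<dots> = (\<Sum>b\<in>(\<lambda>c. inv_star a * c) ` ?F. (cmod (x b))\<^sup>2)"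
    by (subst sum.reindex) (auto intro: inj_on_subset[OF inj_on_left_mult])
  also have "\<dots> \<le> (hnorm ell2 x)\<^sup>2" using assms by (intro sum_le_hnorm_ell2) auto
  finally show ?thesis .
qed

lemma bounded_op_left_regular: "bounded_op ell2 (left_regular a)"
  unfolding bounded_op_def
proof (intro conjI ballI allI exI[of _ 1])
  fix x y :: "'a \<Rightarrow> complex" and c assume x: "x \<in> carrier ell2"
  show "left_regular a x \<in> carrier ell2"
    using left_regular_sum_le[OF x] by (rule carrier_ell2I)
  show "hnorm ell2 (left_regular a x) \<le> 1 * hnorm ell2 x"
    using left_regular_sum_le[OF x] hnorm_ell2_power2(2)[OF x] by (simp add: hnorm_ell2_leI)
qed (auto simp: left_regular_eq ell2_simps fun_eq_iff)

text \<open>Both sides read the coordinate at \<open>inv_star (s * t) * c\<close>; what has to be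
  checked is that their support conditions on \<open>c\<close> agree, which uses that the
  idempotents \<open>inv_star s * s\<close> and \<open>t * inv_star t\<close> commute.\<close>

lemma left_regular_mult: "left_regular (s * t) x = left_regular s (left_regular t x)"
proof
  fix c
  have "s * t * inv_star (s * t) * c = c \<longleftrightarrow>
      s * inv_star s * c = c \<and> t * inv_star t * (inv_star s * c) = inv_star s * c"
  proof
    assume L: "s * t * inv_star (s * t) * c = c"
    then have c: "s * (t * (inv_star t * (inv_star s * c))) = c"
      by (simp add: inv_star_mult mult.assoc)
    have 1: "s * inv_star s * c = c"
    proof -
      have "s * inv_star s * (s * (t * (inv_star t * (inv_star s * c)))) =
          (s * inv_star s * s) * (t * (inv_star t * (inv_star s * c)))" by (simp add: mult.assoc)
      then show ?thesis using c by (simp add: inv_star_inverse)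
    qed
    have "inv_star s * c = inv_star s * (s * (t * (inv_star t * (inv_star s * c))))"
      using c by simp
    also have "\<dots> = (inv_star s * s) * (t * inv_star t) * (inv_star s * c)" by (simp add: mult.assoc)
    also have "\<dots> = (t * inv_star t) * (inv_star s * s) * (inv_star s * c)"
      using idem_commute[OF idem_star_mult(1) idem_star_mult(2)] by metis
    also have "\<dots> = t * inv_star t * ((inv_star s * s * inv_star s) * c)" by (simp add: mult.assoc)
    finally show "s * inv_star s * c = c \<and> t * inv_star t * (inv_star s * c) = inv_star s * c"
      using 1 by (simp add: inv_star_inverse)
  next
    assume "s * inv_star s * c = c \<and> t * inv_star t * (inv_star s * c) = inv_star s * c"
    then show "s * t * inv_star (s * t) * c = c" by (simp add: inv_star_mult mult.assoc)
  qed
  then show "left_regular (s * t) x c = left_regular s (left_regular t x) c"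
    by (simp add: left_regular_eq inv_star_mult mult.assoc)
qed

text \<open>Left multiplication by \<open>s\<close> is a bijection from the domain of
  \<open>s\<close> to its range with inverse \<open>inv_star s\<close>; reindexing along it turns
  one inner product into the other.\<close>

lemma left_regular_adj:
  "ip ell2 (left_regular s x) y = ip ell2 x (left_regular (inv_star s) y)"
proof -
  let ?A = "{c. s * inv_star s * c = c}" and ?B = "{b. inv_star s * s * b = b}"
  have bij: "bij_betw (\<lambda>b. s * b) ?B ?A"
    by (rule bij_betw_byWitness[of _ "\<lambda>c. inv_star s * c"])
      (auto simp: mult.assoc[symmetric] inv_star_inverse)
  have "ip ell2 (left_regular s x) y = (\<Sum>\<^sub>\<infinity>c\<in>?A. x (inv_star s * c) * cnj (y c))"
    unfolding ell2_simps by (rule infsum_cong_neutral) (auto simp: left_regular_eq)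
  also have "\<dots> = (\<Sum>\<^sub>\<infinity>b\<in>?B. x (inv_star s * (s * b)) * cnj (y (s * b)))"
    by (rule infsum_reindex_bij_betw[OF bij, symmetric])
  also have "\<dots> = ip ell2 x (left_regular (inv_star s) y)"
    unfolding ell2_simps by (rule infsum_cong_neutral) (auto simp: left_regular_eq mult.assoc)
  finally show ?thesis .
qed

lemma hilb_ell2: "hilb ell2"
  by unfold_locales (rule hilbert_space_ell2)

lemma hilb_rep_ell2: "hilb_rep ell2 (left_regular :: 'a::inverse_semigroup \<Rightarrow> _)"
proof (intro hilb_rep.intro hilb_rep_axioms.intro hilb_ell2)
  interpret hilb "ell2 :: ('a \<Rightarrow> complex) hilbert" by (rule hilb_ell2)
  show "is_representation ell2 (left_regular :: 'a \<Rightarrow> _)"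
    unfolding is_representation_def
    using partial_isometryI[of "left_regular :: 'a \<Rightarrow> _"] bounded_op_left_regular
      left_regular_mult left_regular_adj by blast
qed

subsection \<open>The completion and its image\<close>

lemma lookup_sa_scale: "Poly_Mapping.lookup (sa_scale c f) s = c * Poly_Mapping.lookup f s"
  by (simp add: sa_scale_def lookup_sum lookup_single when_def in_keys_iff)

lemma full_norm_minus_commute:
  fixes f g :: "'a::inverse_semigroup semigroup_algebra"
  shows "full_norm (f - g) = full_norm (g - f)"
proof -
  have *: "full_norm (- f) \<le> full_norm f" for f :: "'a semigroup_algebra"
  proof -
    have "- f = sa_scale (-1) f" by (rule poly_mapping_eqI) (simp add: lookup_sa_scale)
    then show ?thesis using full_norm_scale[of "-1" f] by simp
  qed
  show ?thesis using *[of "f - g"] *[of "g - f"] by simp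
qed

lemma full_norm_triangle: "full_norm (f - h) \<le> full_norm (f - g) + full_norm (g - h)"
  using full_norm_add[of "f - g" "g - h"] by simp

section \<open>Cauchy sequences for the full norm\<close>

lemma full_cauchyI:
  assumes "\<And>m n. full_norm (F m - F n) \<le> \<bar>a m - a n\<bar>" "convergent (a :: nat \<Rightarrow> real)"
  shows "F \<in> full_cauchy"
proof -
  have a: "Cauchy a" using assms(2) by (rule convergent_Cauchy)
  have "\<exists>N. \<forall>m\<ge>N. \<forall>n\<ge>N. full_norm (F m - F n) < \<epsilon>" if \<epsilon>: "\<epsilon> > 0" for \<epsilon>
  proof -
    obtain N where N: "\<forall>m\<ge>N. \<forall>n\<ge>N. \<bar>a m - a n\<bar> < \<epsilon>"
      using metric_CauchyD[OF a \<epsilon>] by (auto simp: dist_real_def)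
    have "full_norm (F m - F n) < \<epsilon>" if "m \<ge> N" "n \<ge> N" for m n
      using N that assms(1)[of m n] by (meson order_le_less_trans)
    then show ?thesis by blast
  qed
  then show ?thesis by (simp add: full_cauchy_def)
qed

lemma full_cauchy_zero: "(\<lambda>_. 0) \<in> full_cauchy"
  by (simp add: full_cauchy_def)

lemma full_cauchyD:
  "F \<in> full_cauchy \<Longrightarrow> \<epsilon> > 0 \<Longrightarrow> \<exists>N. \<forall>m\<ge>N. \<forall>n\<ge>N. full_norm (F m - F n) < \<epsilon>"
  by (simp add: full_cauchy_def)

lemma equiv_full_rel:
  "equiv full_cauchy (full_rel :: ((nat \<Rightarrow> 'a::inverse_semigroup semigroup_algebra) \<times> _) set)"
  (is "equiv _ ?R")
proof (rule equivI)
  show "?R \<subseteq> full_cauchy \<times> full_cauchy" by (auto simp: full_rel_def)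
  show "refl_on full_cauchy ?R" by (auto simp: refl_on_def full_rel_def)
  show "sym ?R" by (rule symI) (auto simp: full_rel_def full_norm_minus_commute)
  show "trans ?R"
  proof (rule transI)
    fix F G H :: "nat \<Rightarrow> 'a semigroup_algebra"
    assume FG: "(F, G) \<in> full_rel" and GH: "(G, H) \<in> full_rel"
    have "(\<lambda>n. full_norm (F n - H n)) \<longlonglongrightarrow> 0"
    proof (rule tendsto_sandwich[OF _ _ tendsto_const])
      show "(\<lambda>n. full_norm (F n - G n) + full_norm (G n - H n)) \<longlonglongrightarrow> 0"
        using FG GH tendsto_add[of "\<lambda>n. full_norm (F n - G n)" 0 sequentially] by (auto simp: full_rel_def)
    qed (simp_all add: full_norm_nonneg full_norm_triangle)
    then show "(F, H) \<in> full_rel" using FG GH by (simp add: full_rel_def)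
  qed
qed

lemma full_cauchy_bounded:
  assumes "F \<in> full_cauchy"
  shows "\<exists>B>0. \<forall>n. full_norm (F n) \<le> B"
proof -
  obtain N where N: "\<forall>m\<ge>N. \<forall>n\<ge>N. full_norm (F m - F n) < 1" using full_cauchyD[OF assms, of 1] by auto
  define B where "B = Max ((\<lambda>n. full_norm (F n)) ` {..N}) + 1"
  have M: "full_norm (F n) \<le> B - 1" if "n \<le> N" for n
    unfolding B_def using that by (simp add: Max_ge)
  have "full_norm (F n) \<le> B" for n
  proof (cases "n \<le> N")
    case False
    have "full_norm (F n) \<le> full_norm (F n - F N) + full_norm (F N)"
      using full_norm_add[of "F n - F N" "F N"] by simp
    moreover have "full_norm (F n - F N) < 1" using N False by simp
    ultimately show ?thesis using M[of N] by linarith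
  qed (use M in fastforce)
  moreover have "B > 0" using M[of 0] full_norm_nonneg[of "F 0"] by linarith
  ultimately show ?thesis by blast
qed

lemma full_cauchy_lipschitz:
  assumes F: "F \<in> full_cauchy" and C: "C \<ge> 0"
    and le: "\<And>m n. full_norm (F' m - F' n) \<le> C * full_norm (F m - F n)"
  shows "F' \<in> full_cauchy"
  unfolding full_cauchy_def
proof (intro CollectI allI impI)
  fix \<epsilon> :: real assume \<epsilon>: "\<epsilon> > 0"
  obtain N where N: "\<forall>m\<ge>N. \<forall>n\<ge>N. full_norm (F m - F n) < \<epsilon> / (C + 1)"
    using full_cauchyD[OF F, of "\<epsilon> / (C + 1)"] \<epsilon> C by auto
  have "full_norm (F' m - F' n) < \<epsilon>" if "m \<ge> N" "n \<ge> N" for m n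
  proof -
    have "C * full_norm (F m - F n) \<le> C * (\<epsilon> / (C + 1))"
      using N that C by (intro mult_left_mono) (auto intro: less_imp_le)
    also have "\<dots> < \<epsilon>" using C \<epsilon> by (simp add: field_simps)
    finally show ?thesis using le[of m n] by linarith
  qed
  then show "\<exists>N. \<forall>m\<ge>N. \<forall>n\<ge>N. full_norm (F' m - F' n) < \<epsilon>" by blast
qed

lemma full_cauchy_add:
  assumes "F \<in> full_cauchy" "G \<in> full_cauchy"
  shows "(\<lambda>n. F n + G n) \<in> full_cauchy"
  unfolding full_cauchy_def
proof (intro CollectI allI impI)
  fix \<epsilon> :: real assume \<epsilon>: "\<epsilon> > 0"
  obtain M N where M: "\<forall>m\<ge>M. \<forall>n\<ge>M. full_norm (F m - F n) < \<epsilon> / 2"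
    and N: "\<forall>m\<ge>N. \<forall>n\<ge>N. full_norm (G m - G n) < \<epsilon> / 2"
    using full_cauchyD[of _ "\<epsilon> / 2"] assms \<epsilon> by (meson half_gt_zero)
  have "full_norm (F m + G m - (F n + G n)) < \<epsilon>" if "m \<ge> max M N" "n \<ge> max M N" for m n
  proof -
    have "full_norm (F m + G m - (F n + G n)) \<le> full_norm (F m - F n) + full_norm (G m - G n)"
      using full_norm_add[of "F m - F n" "G m - G n"] by (simp add: algebra_simps)
    moreover have "full_norm (F m - F n) < \<epsilon> / 2" "full_norm (G m - G n) < \<epsilon> / 2"
      using M N that by auto
    ultimately show ?thesis by simp
  qed
  then show "\<exists>N. \<forall>m\<ge>N. \<forall>n\<ge>N. full_norm (F m + G m - (F n + G n)) < \<epsilon>" by blast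
qed

lemma sa_sum_diff:
  fixes F :: "'a \<Rightarrow> complex \<Rightarrow> 'b::ab_group_add"
  assumes "\<And>s. F s 0 = 0" "\<And>s c d. F s (c + d) = F s c + F s d"
  shows "sa_sum F (f - g) = sa_sum F f - sa_sum F g"
  using sa_sum_add[of F "f - g" g, OF assms] by simp

lemma sa_scale_eq: "sa_scale c f = sa_sum (\<lambda>s d. Poly_Mapping.single s (c * d)) f"
  by (simp add: sa_scale_def sa_sum_def)

lemma sa_star_eq: "sa_star f = sa_sum (\<lambda>s d. Poly_Mapping.single (inv_star s) (cnj d)) f"
  by (simp add: sa_star_def sa_sum_def)

lemma sa_mult_eq:
  "sa_mult f g = sa_sum (\<lambda>s c. sa_sum (\<lambda>t d. Poly_Mapping.single (s * t) (c * d)) g) f"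
  by (simp add: sa_mult_def sa_sum_def)

lemma sa_scale_diff: "sa_scale c (f - g) = sa_scale c f - sa_scale c g"
  unfolding sa_scale_eq by (rule sa_sum_diff) (simp_all add: single_add distrib_left)

lemma sa_star_diff: "sa_star (f - g) = sa_star f - sa_star g"
  unfolding sa_star_eq by (rule sa_sum_diff) (simp_all add: single_add)

lemma sa_mult_diff_left: "sa_mult (f - g) h = sa_mult f h - sa_mult g h"
  unfolding sa_mult_eq
  by (rule sa_sum_diff) (simp_all add: sa_sum_def single_add distrib_right sum.distrib)

lemma sa_mult_diff_right: "sa_mult h (f - g) = sa_mult h f - sa_mult h g"
proof -
  have "sa_sum (\<lambda>t d. Poly_Mapping.single (s * t) (c * d)) (f - g) =
      sa_sum (\<lambda>t d. Poly_Mapping.single (s * t) (c * d)) f -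
      sa_sum (\<lambda>t d. Poly_Mapping.single (s * t) (c * d)) g" for s c
    by (rule sa_sum_diff) (simp_all add: single_add distrib_left)
  then show ?thesis by (simp add: sa_mult_eq sa_sum_def[of _ h] sum_subtractf)
qed

lemma full_norm_mult_diff:
  "full_norm (sa_mult f g - sa_mult f' g') \<le> full_norm f * full_norm (g - g') + full_norm (f - f') * full_norm g'"
proof -
  have "sa_mult f g - sa_mult f' g' = sa_mult f (g - g') + sa_mult (f - f') g'"
    by (simp add: sa_mult_diff_left sa_mult_diff_right)
  then show ?thesis
    using full_norm_add[of "sa_mult f (g - g')" "sa_mult (f - f') g'"]
      full_norm_mult[of f "g - g'"] full_norm_mult[of "f - f'" g'] by simp
qed

lemma full_cauchy_mult:
  assumes F: "F \<in> full_cauchy" and G: "G \<in> full_cauchy"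
  shows "(\<lambda>n. sa_mult (F n) (G n)) \<in> full_cauchy"
  unfolding full_cauchy_def
proof (intro CollectI allI impI)
  fix \<epsilon> :: real assume \<epsilon>: "\<epsilon> > 0"
  obtain A B where A: "A > 0" "\<And>n. full_norm (F n) \<le> A" and B: "B > 0" "\<And>n. full_norm (G n) \<le> B"
    using full_cauchy_bounded[OF F] full_cauchy_bounded[OF G] by blast
  obtain M where M: "\<forall>m\<ge>M. \<forall>n\<ge>M. full_norm (G m - G n) < \<epsilon> / 2 / A"
    using full_cauchyD[OF G, of "\<epsilon> / 2 / A"] \<epsilon> A by auto
  obtain N where N: "\<forall>m\<ge>N. \<forall>n\<ge>N. full_norm (F m - F n) < \<epsilon> / 2 / B"
    using full_cauchyD[OF F, of "\<epsilon> / 2 / B"] \<epsilon> B by auto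
  have "full_norm (sa_mult (F m) (G m) - sa_mult (F n) (G n)) < \<epsilon>"
    if mn: "m \<ge> max M N" "n \<ge> max M N" for m n
  proof -
    have "full_norm (sa_mult (F m) (G m) - sa_mult (F n) (G n)) \<le>
        full_norm (F m) * full_norm (G m - G n) + full_norm (F m - F n) * full_norm (G n)"
      by (rule full_norm_mult_diff)
    also have "\<dots> \<le> A * full_norm (G m - G n) + full_norm (F m - F n) * B"
      using A B by (intro add_mono mult_mono) (auto simp: full_norm_nonneg intro: less_imp_le)
    also have "\<dots> < A * (\<epsilon> / 2 / A) + (\<epsilon> / 2 / B) * B"
      using M N mn A B by (intro add_strict_mono mult_strict_left_mono mult_strict_right_mono) auto
    also have "\<dots> = \<epsilon>" using A B by simp
    finally show ?thesis .
  qed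
  then show "\<exists>N. \<forall>m\<ge>N. \<forall>n\<ge>N. full_norm (sa_mult (F m) (G m) - sa_mult (F n) (G n)) < \<epsilon>" by blast
qed

lemma full_cauchy_scale: "F \<in> full_cauchy \<Longrightarrow> (\<lambda>n. sa_scale c (F n)) \<in> full_cauchy"
  by (rule full_cauchy_lipschitz[of F "cmod c"]) (simp_all add: full_norm_scale flip: sa_scale_diff)

lemma full_cauchy_star: "F \<in> full_cauchy \<Longrightarrow> (\<lambda>n. sa_star (F n)) \<in> full_cauchy"
  by (rule full_cauchy_lipschitz[of F 1]) (simp_all add: full_norm_star flip: sa_star_diff)

text \<open>The condition that defines \<open>Lambda_hom\<close>, for a single representative. By
  \<open>Lam_limit_cong\<close> and \<open>Lam_limit_unique\<close> it passes to equivalent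
  sequences and determines \<open>T\<close>, so the description operator in
  \<open>Lambda_hom\<close> is well defined.\<close>

definition Lam_limit :: "(nat \<Rightarrow> 'a::inverse_semigroup semigroup_algebra) \<Rightarrow> (('a \<Rightarrow> complex) \<Rightarrow> ('a \<Rightarrow> complex)) \<Rightarrow> bool"
  where "Lam_limit F T \<longleftrightarrow> T \<in> carrier (bounded_ops ell2) \<and>
    (\<lambda>n. op_norm ell2 (\<lambda>x. rep_ext ell2 left_regular (F n) x - T x)) \<longlonglongrightarrow> 0"

lemma carrier_bounded_ops: "T \<in> carrier (bounded_ops H) \<longleftrightarrow> T \<in> extensional (carrier H) \<and> bounded_op H T"
  by (simp add: bounded_ops_def)

context
begin

interpretation Lam: hilb_rep ell2 "left_regular :: 'a::inverse_semigroup \<Rightarrow> _"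
  by (rule hilb_rep_ell2)

lemma Lam_limit_exists:
  assumes F: "(F :: nat \<Rightarrow> 'a::inverse_semigroup semigroup_algebra) \<in> full_cauchy"
  shows "\<exists>T. Lam_limit F T"
proof -
  have le: "op_norm ell2 (\<lambda>x. Lam.ext (F m) x - Lam.ext (F n) x) \<le> full_norm (F m - F n)" for m n
  proof (rule Lam.op_norm_le[OF full_norm_nonneg])
    fix x :: "'a \<Rightarrow> complex" assume x: "x \<in> carrier ell2"
    have "hnorm ell2 (Lam.ext (F m) x - Lam.ext (F n) x) \<le> Lam.ext_norm (F m - F n) * hnorm ell2 x"
      using Lam.ext_norm_bound[OF x, of "F m - F n"] x by (simp add: Lam.ext_diff)
    also have "\<dots> \<le> full_norm (F m - F n) * hnorm ell2 x"
      using x by (intro mult_right_mono Lam.ext_norm_le_full_norm) simp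
    finally show "hnorm ell2 (Lam.ext (F m) x - Lam.ext (F n) x) \<le> full_norm (F m - F n) * hnorm ell2 x" .
  qed
  have "\<exists>N. \<forall>m\<ge>N. \<forall>n\<ge>N. op_norm ell2 (\<lambda>x. Lam.ext (F m) x - Lam.ext (F n) x) < \<epsilon>" if "\<epsilon> > 0" for \<epsilon>
    using full_cauchyD[OF F that] le by (meson order_le_less_trans)
  from Lam.op_norm_Cauchy_limit[OF Lam.bounded_op_ext this]
  show ?thesis unfolding Lam_limit_def carrier_bounded_ops by blast
qed

lemma Lam_limit_pointwise:
  assumes T: "Lam_limit (F :: nat \<Rightarrow> 'a::inverse_semigroup semigroup_algebra) T" and x: "x \<in> carrier ell2"
  shows "(\<lambda>n. hnorm ell2 (Lam.ext (F n) x - T x)) \<longlonglongrightarrow> 0"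
proof (rule tendsto_sandwich[OF _ _ tendsto_const])
  have bT: "bounded_op ell2 T" using T by (simp add: Lam_limit_def carrier_bounded_ops)
  show "(\<lambda>n. op_norm ell2 (\<lambda>x. Lam.ext (F n) x - T x) * hnorm ell2 x) \<longlonglongrightarrow> 0"
    using tendsto_mult_right[of _ 0 sequentially "hnorm ell2 x"] T by (simp add: Lam_limit_def)
  show "\<forall>\<^sub>F n in sequentially. hnorm ell2 (Lam.ext (F n) x - T x) \<le>
      op_norm ell2 (\<lambda>x. Lam.ext (F n) x - T x) * hnorm ell2 x"
    using Lam.op_norm_bound[OF Lam.bounded_op_minus[OF Lam.bounded_op_ext bT] x] by simp
  show "\<forall>\<^sub>F n in sequentially. 0 \<le> hnorm ell2 (Lam.ext (F n) x - T x)"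
    using x Lam.bounded_op_closed[OF bT] by simp
qed

lemma Lam_limitI:
  assumes T: "T \<in> carrier (bounded_ops ell2)" and c: "c \<longlonglongrightarrow> 0"
    and le: "\<And>n x. x \<in> carrier ell2 \<Longrightarrow> hnorm ell2 (Lam.ext (F n) x - T x) \<le> c n * hnorm ell2 x"
    and c0: "\<And>n. 0 \<le> c n"
  shows "Lam_limit (F :: nat \<Rightarrow> 'a::inverse_semigroup semigroup_algebra) T"
  unfolding Lam_limit_def
proof (intro conjI T tendsto_sandwich[OF _ _ tendsto_const c] always_eventually allI)
  have bT: "bounded_op ell2 T" using T by (simp add: carrier_bounded_ops)
  show "0 \<le> op_norm ell2 (\<lambda>x. Lam.ext (F n) x - T x)" for n
    by (rule Lam.op_norm_nonneg[OF Lam.bounded_op_minus[OF Lam.bounded_op_ext bT]])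
  show "op_norm ell2 (\<lambda>x. Lam.ext (F n) x - T x) \<le> c n" for n
    using c0 le by (rule Lam.op_norm_le)
qed

lemma Lam_limit_unique:
  assumes "Lam_limit (F :: nat \<Rightarrow> 'a::inverse_semigroup semigroup_algebra) T" "Lam_limit F U"
  shows "T = U"
proof (rule extensionalityI)
  show "T \<in> extensional (carrier ell2)" "U \<in> extensional (carrier ell2)"
    using assms by (simp_all add: Lam_limit_def carrier_bounded_ops)
  fix x :: "'a \<Rightarrow> complex" assume x: "x \<in> carrier ell2"
  show "T x = U x"
  proof (rule Lam.limit_unique[of _ _ "\<lambda>n. Lam.ext (F n) x"])
    show "T x \<in> carrier ell2" "U x \<in> carrier ell2"
      using assms x Lam.bounded_op_closed by (simp_all add: Lam_limit_def carrier_bounded_ops)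
  qed (use x Lam_limit_pointwise assms in auto)
qed

lemma Lam_limit_cong:
  assumes FG: "(F, G) \<in> full_rel" and T: "Lam_limit (F :: nat \<Rightarrow> 'a::inverse_semigroup semigroup_algebra) T"
  shows "Lam_limit G T"
proof (rule Lam_limitI)
  show "T \<in> carrier (bounded_ops ell2)" using T by (simp add: Lam_limit_def)
  then have bT: "bounded_op ell2 T" by (simp add: carrier_bounded_ops)
  let ?c = "\<lambda>n. full_norm (F n - G n) + op_norm ell2 (\<lambda>x. Lam.ext (F n) x - T x)"
  show "?c \<longlonglongrightarrow> 0"
    using tendsto_add[of "\<lambda>n. full_norm (F n - G n)" 0 sequentially] FG T
    by (auto simp: full_rel_def Lam_limit_def)
  show "0 \<le> ?c n" for n
    by (intro add_nonneg_nonneg full_norm_nonneg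
        Lam.op_norm_nonneg[OF Lam.bounded_op_minus[OF Lam.bounded_op_ext bT]])
  fix n and x :: "'a \<Rightarrow> complex" assume x: "x \<in> carrier ell2"
  have c: "T x \<in> carrier ell2" "Lam.ext (F n) x \<in> carrier ell2" "Lam.ext (G n) x \<in> carrier ell2"
    using x Lam.bounded_op_closed[OF bT] by auto
  have "hnorm ell2 (Lam.ext (G n) x - T x) \<le>
      hnorm ell2 (Lam.ext (F n) x - Lam.ext (G n) x) + hnorm ell2 (Lam.ext (F n) x - T x)"
    using Lam.hnorm_triangle[of "Lam.ext (G n) x - Lam.ext (F n) x" "Lam.ext (F n) x - T x"] c
    by (simp add: Lam.hnorm_minus_commute)
  also have "Lam.ext (F n) x - Lam.ext (G n) x = Lam.ext (F n - G n) x" using x by (simp add: Lam.ext_diff)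
  also have "hnorm ell2 \<dots> \<le> full_norm (F n - G n) * hnorm ell2 x"
    by (rule order_trans[OF Lam.ext_norm_bound[OF x]])
      (use x in \<open>intro mult_right_mono Lam.ext_norm_le_full_norm; simp\<close>)
  also have "hnorm ell2 (Lam.ext (F n) x - T x) \<le> op_norm ell2 (\<lambda>x. Lam.ext (F n) x - T x) * hnorm ell2 x"
    by (rule Lam.op_norm_bound[OF Lam.bounded_op_minus[OF Lam.bounded_op_ext bT] x])
  finally show "hnorm ell2 (Lam.ext (G n) x - T x) \<le> ?c n * hnorm ell2 x"
    by (simp only: distrib_right)
qed

lemma Lambda_hom_class:
  assumes F: "(F :: nat \<Rightarrow> 'a::inverse_semigroup semigroup_algebra) \<in> full_cauchy"
  shows "Lam_limit F T \<longleftrightarrow> Lambda_hom (full_rel `` {F}) = T"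
proof -
  obtain U where U: "Lam_limit F U" using Lam_limit_exists[OF F] by blast
  have FF: "(F, F) \<in> full_rel" using F by (simp add: full_rel_def)
  have "Lambda_hom (full_rel `` {F}) = U"
    unfolding Lambda_hom_def
  proof (rule the_equality)
    show "U \<in> carrier (bounded_ops ell2) \<and> (\<forall>G\<in>full_rel `` {F}.
        (\<lambda>n. op_norm ell2 (\<lambda>x. Lam.ext (G n) x - U x)) \<longlonglongrightarrow> 0)"
      using U Lam_limit_cong[OF _ U] unfolding Lam_limit_def by blast
    fix V assume "V \<in> carrier (bounded_ops ell2) \<and> (\<forall>G\<in>full_rel `` {F}.
        (\<lambda>n. op_norm ell2 (\<lambda>x. Lam.ext (G n) x - V x)) \<longlonglongrightarrow> 0)"
    then have "Lam_limit F V" using FF unfolding Lam_limit_def by blast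
    then show "V = U" by (rule Lam_limit_unique[OF _ U])
  qed
  then show ?thesis using U Lam_limit_unique by blast
qed

end

subsection \<open>Weak containment as an equality of norms\<close>

abbreviation red_norm :: "'a::inverse_semigroup semigroup_algebra \<Rightarrow> real"
  where "red_norm \<equiv> hilb_rep.ext_norm ell2 left_regular"

context hilb
begin

lemma ip_tendsto:
  assumes "x \<in> carrier H" "y \<in> carrier H" "\<And>n::nat. X n \<in> carrier H"
    and "(\<lambda>n. hnorm H (X n - x)) \<longlonglongrightarrow> 0"
  shows "(\<lambda>n. ip H (X n) y) \<longlonglongrightarrow> ip H x y"
proof -
  have "(\<lambda>n. ip H (X n) y - ip H x y) \<longlonglongrightarrow> 0"
  proof (rule Lim_null_comparison)
    show "(\<lambda>n. hnorm H (X n - x) * hnorm H y) \<longlonglongrightarrow> 0"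
      using tendsto_mult_right[OF assms(4), of "hnorm H y"] by simp
    show "\<forall>\<^sub>F n in sequentially. norm (ip H (X n) y - ip H x y) \<le> hnorm H (X n - x) * hnorm H y"
      using Cauchy_Schwarz[of "X _ - x" y] assms by (simp add: ip_diff_left)
  qed
  then show ?thesis by (simp add: LIM_zero_iff)
qed

lemma alg_star_eqI:
  assumes V: "V \<in> extensional (carrier H)" "bounded_op H V" and T: "bounded_op H T"
    and adj: "\<And>x y. x \<in> carrier H \<Longrightarrow> y \<in> carrier H \<Longrightarrow> ip H (T x) y = ip H x (V y)"
  shows "alg_star (bounded_ops H) T = V"
proof -
  have "(THE U. U \<in> extensional (carrier H) \<and> bounded_op H U \<and>
      (\<forall>x\<in>carrier H. \<forall>y\<in>carrier H. ip H (T x) y = ip H x (U y))) = V"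
  proof (rule the_equality)
    fix U assume U: "U \<in> extensional (carrier H) \<and> bounded_op H U \<and>
      (\<forall>x\<in>carrier H. \<forall>y\<in>carrier H. ip H (T x) y = ip H x (U y))"
    show "U = V"
    proof (rule extensionalityI)
      fix y assume y: "y \<in> carrier H"
      have c: "U y \<in> carrier H" "V y \<in> carrier H" using U V y by auto
      then have "ip H (U y - V y) (U y) = ip H (U y - V y) (V y)"
        using U adj[of "U y - V y" y] y by (metis carrier_closed(4))
      then have "ip H (U y - V y) (U y - V y) = 0" using c by (simp add: ip_diff_right)
      then show "U y = V y" using ip_definite[of "U y - V y"] c by simp
    qed (use U V in auto)
  qed (use V adj in auto)
  then show ?thesis by (simp add: bounded_ops_def)
qed

end

section \<open>Algebraic operations on classes of Cauchy sequences\<close>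

lemma full_relI:
  assumes "F \<in> full_cauchy" "G \<in> full_cauchy"
    and "c \<longlonglongrightarrow> 0" "\<And>n. full_norm (F n - G n) \<le> c n"
  shows "(F, G) \<in> full_rel"
proof -
  have "(\<lambda>n. full_norm (F n - G n)) \<longlonglongrightarrow> 0"
    by (rule tendsto_sandwich[OF _ _ tendsto_const assms(3)]) (simp_all add: full_norm_nonneg assms(4))
  then show ?thesis using assms by (simp add: full_rel_def)
qed

lemma full_relD:
  assumes "(F, G) \<in> full_rel"
  shows "F \<in> full_cauchy" "G \<in> full_cauchy" "(\<lambda>n. full_norm (F n - G n)) \<longlonglongrightarrow> 0"
  using assms by (simp_all add: full_rel_def)

lemma cstar_full_add:
  fixes F G :: "nat \<Rightarrow> 'a::inverse_semigroup semigroup_algebra"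
  assumes "F \<in> full_cauchy" "G \<in> full_cauchy"
  shows "alg_add cstar_full (full_rel `` {F}) (full_rel `` {G}) = full_rel `` {\<lambda>n. F n + G n}"
proof -
  have "congruent2 full_rel full_rel (\<lambda>F G :: nat \<Rightarrow> 'a semigroup_algebra. full_rel `` {\<lambda>n. F n + G n})"
  proof (rule congruent2I')
    fix F F' G G' :: "nat \<Rightarrow> 'a semigroup_algebra"
    assume F: "(F, F') \<in> full_rel" and G: "(G, G') \<in> full_rel"
    have "((\<lambda>n. F n + G n), (\<lambda>n. F' n + G' n)) \<in> full_rel"
    proof (rule full_relI)
      show "(\<lambda>n. full_norm (F n - F' n) + full_norm (G n - G' n)) \<longlonglongrightarrow> 0"
        using tendsto_add[OF full_relD(3)[OF F] full_relD(3)[OF G]] by simp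
      show "full_norm (F n + G n - (F' n + G' n)) \<le> full_norm (F n - F' n) + full_norm (G n - G' n)" for n
        using full_norm_add[of "F n - F' n" "G n - G' n"] by (simp add: add_diff_add)
    qed (use full_relD[OF F] full_relD[OF G] in \<open>simp_all add: full_cauchy_add\<close>)
    then show "full_rel `` {\<lambda>n. F n + G n} = full_rel `` {\<lambda>n. F' n + G' n}"
      by (rule equiv_class_eq[OF equiv_full_rel])
  qed
  from UN_equiv_class2[OF equiv_full_rel equiv_full_rel this assms]
  show ?thesis by (simp add: cstar_full_def)
qed

lemma cstar_full_mult:
  fixes F G :: "nat \<Rightarrow> 'a::inverse_semigroup semigroup_algebra"
  assumes "F \<in> full_cauchy" "G \<in> full_cauchy"
  shows "alg_mult cstar_full (full_rel `` {F}) (full_rel `` {G}) = full_rel `` {\<lambda>n. sa_mult (F n) (G n)}"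
proof -
  have "congruent2 full_rel full_rel (\<lambda>F G :: nat \<Rightarrow> 'a semigroup_algebra. full_rel `` {\<lambda>n. sa_mult (F n) (G n)})"
  proof (rule congruent2I')
    fix F F' G G' :: "nat \<Rightarrow> 'a semigroup_algebra"
    assume F: "(F, F') \<in> full_rel" and G: "(G, G') \<in> full_rel"
    obtain A B where A: "\<And>n. full_norm (F n) \<le> A" and B: "\<And>n. full_norm (G' n) \<le> B"
      using full_cauchy_bounded full_relD(1)[OF F] full_relD(2)[OF G] by meson
    have "((\<lambda>n. sa_mult (F n) (G n)), (\<lambda>n. sa_mult (F' n) (G' n))) \<in> full_rel"
    proof (rule full_relI)
      show "(\<lambda>n. A * full_norm (G n - G' n) + full_norm (F n - F' n) * B) \<longlonglongrightarrow> 0"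
        using tendsto_add[OF tendsto_mult_left[OF full_relD(3)[OF G], of A]
            tendsto_mult_right[OF full_relD(3)[OF F], of B]] by simp
      show "full_norm (sa_mult (F n) (G n) - sa_mult (F' n) (G' n)) \<le>
          A * full_norm (G n - G' n) + full_norm (F n - F' n) * B" for n
        by (rule order_trans[OF full_norm_mult_diff])
          (intro add_mono mult_right_mono mult_left_mono A B full_norm_nonneg)
    qed (use full_relD[OF F] full_relD[OF G] in \<open>simp_all add: full_cauchy_mult\<close>)
    then show "full_rel `` {\<lambda>n. sa_mult (F n) (G n)} = full_rel `` {\<lambda>n. sa_mult (F' n) (G' n)}"
      by (rule equiv_class_eq[OF equiv_full_rel])
  qed
  from UN_equiv_class2[OF equiv_full_rel equiv_full_rel this assms]
  show ?thesis by (simp add: cstar_full_def)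
qed

lemma cstar_full_scale:
  fixes F :: "nat \<Rightarrow> 'a::inverse_semigroup semigroup_algebra"
  assumes "F \<in> full_cauchy"
  shows "alg_scale cstar_full c (full_rel `` {F}) = full_rel `` {\<lambda>n. sa_scale c (F n)}"
proof -
  have "congruent full_rel (\<lambda>F :: nat \<Rightarrow> 'a semigroup_algebra. full_rel `` {\<lambda>n. sa_scale c (F n)})"
  proof (rule congruentI)
    fix F F' :: "nat \<Rightarrow> 'a semigroup_algebra" assume F: "(F, F') \<in> full_rel"
    have "((\<lambda>n. sa_scale c (F n)), (\<lambda>n. sa_scale c (F' n))) \<in> full_rel"
    proof (rule full_relI)
      show "(\<lambda>n. cmod c * full_norm (F n - F' n)) \<longlonglongrightarrow> 0"
        using tendsto_mult_left[OF full_relD(3)[OF F], of "cmod c"] by simp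
    qed (use full_relD[OF F] in \<open>simp_all add: full_cauchy_scale full_norm_scale flip: sa_scale_diff\<close>)
    then show "full_rel `` {\<lambda>n. sa_scale c (F n)} = full_rel `` {\<lambda>n. sa_scale c (F' n)}"
      by (rule equiv_class_eq[OF equiv_full_rel])
  qed
  from UN_equiv_class[OF equiv_full_rel this assms]
  show ?thesis by (simp add: cstar_full_def)
qed

lemma cstar_full_star:
  fixes F :: "nat \<Rightarrow> 'a::inverse_semigroup semigroup_algebra"
  assumes "F \<in> full_cauchy"
  shows "alg_star cstar_full (full_rel `` {F}) = full_rel `` {\<lambda>n. sa_star (F n)}"
proof -
  have "congruent full_rel (\<lambda>F :: nat \<Rightarrow> 'a semigroup_algebra. full_rel `` {\<lambda>n. sa_star (F n)})"
  proof (rule congruentI)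
    fix F F' :: "nat \<Rightarrow> 'a semigroup_algebra" assume F: "(F, F') \<in> full_rel"
    have "((\<lambda>n. sa_star (F n)), (\<lambda>n. sa_star (F' n))) \<in> full_rel"
      by (rule full_relI[OF _ _ full_relD(3)[OF F]])
        (use full_relD[OF F] in \<open>simp_all add: full_cauchy_star full_norm_star flip: sa_star_diff\<close>)
    then show "full_rel `` {\<lambda>n. sa_star (F n)} = full_rel `` {\<lambda>n. sa_star (F' n)}"
      by (rule equiv_class_eq[OF equiv_full_rel])
  qed
  from UN_equiv_class[OF equiv_full_rel this assms]
  show ?thesis by (simp add: cstar_full_def)
qed

lemma cstar_reduced_ops:
  "alg_add cstar_reduced = alg_add (bounded_ops ell2)"
  "alg_scale cstar_reduced = alg_scale (bounded_ops ell2)"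
  "alg_mult cstar_reduced = alg_mult (bounded_ops ell2)"
  "alg_star cstar_reduced = alg_star (bounded_ops ell2)"
  by (simp_all add: cstar_reduced_def)

lemma carrier_cstar_full: "carrier cstar_full = full_cauchy // full_rel"
  by (simp add: cstar_full_def)

section \<open>Limits in operator norm and the kernel of \<open>Lambda_hom\<close>\<close>

context
begin

interpretation Lam: hilb_rep ell2 "left_regular :: 'a::inverse_semigroup \<Rightarrow> _"
  by (rule hilb_rep_ell2)

lemma Lam_limit_bounded_op: "Lam_limit F T \<Longrightarrow> bounded_op ell2 T"
  by (simp add: Lam_limit_def carrier_bounded_ops)

lemma Lam_limit_dist:
  assumes "Lam_limit (F :: nat \<Rightarrow> 'a::inverse_semigroup semigroup_algebra) T" "x \<in> carrier ell2"
  shows "hnorm ell2 (Lam.ext (F n) x - T x) \<le> op_norm ell2 (\<lambda>x. Lam.ext (F n) x - T x) * hnorm ell2 x"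
    and "0 \<le> op_norm ell2 (\<lambda>x. Lam.ext (F n) x - T x)"
proof -
  note b = Lam.bounded_op_minus[OF Lam.bounded_op_ext Lam_limit_bounded_op[OF assms(1)]]
  show "hnorm ell2 (Lam.ext (F n) x - T x) \<le> op_norm ell2 (\<lambda>x. Lam.ext (F n) x - T x) * hnorm ell2 x"
    by (rule Lam.op_norm_bound[OF b assms(2)])
  show "0 \<le> op_norm ell2 (\<lambda>x. Lam.ext (F n) x - T x)" by (rule Lam.op_norm_nonneg[OF b])
qed

lemma Lam_limit_dist_tendsto:
  assumes "Lam_limit (F :: nat \<Rightarrow> 'a::inverse_semigroup semigroup_algebra) T"
  shows "(\<lambda>n. op_norm ell2 (\<lambda>x. Lam.ext (F n) x - T x)) \<longlonglongrightarrow> 0"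
  using assms by (simp add: Lam_limit_def)

lemma Lam_limit_carrier:
  assumes "Lam_limit (F :: nat \<Rightarrow> 'a::inverse_semigroup semigroup_algebra) T" "x \<in> carrier ell2"
  shows "T x \<in> carrier ell2"
  by (rule Lam.bounded_op_closed[OF Lam_limit_bounded_op[OF assms(1)] assms(2)])

lemma Lam_limit_eqI:
  assumes F: "Lam_limit (F :: nat \<Rightarrow> 'a::inverse_semigroup semigroup_algebra) V"
    and T: "T \<in> extensional (carrier ell2)" "\<And>x. x \<in> carrier ell2 \<Longrightarrow> T x \<in> carrier ell2"
    and lim: "\<And>x. x \<in> carrier ell2 \<Longrightarrow> (\<lambda>n. hnorm ell2 (Lam.ext (F n) x - T x)) \<longlonglongrightarrow> 0"
  shows "V = T"
proof (rule extensionalityI)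
  show "V \<in> extensional (carrier ell2)" using F by (simp add: Lam_limit_def carrier_bounded_ops)
  fix x :: "'a \<Rightarrow> complex" assume x: "x \<in> carrier ell2"
  show "V x = T x"
    by (rule Lam.limit_unique[OF Lam_limit_carrier[OF F x] T(2)[OF x] Lam.ext_closed[OF x]
      Lam_limit_pointwise[OF F x] lim[OF x]])
qed (rule T(1))

lemma Lam_limit_add:
  assumes T: "Lam_limit (F :: nat \<Rightarrow> 'a::inverse_semigroup semigroup_algebra) T" and U: "Lam_limit G U"
    and V: "Lam_limit (\<lambda>n. F n + G n) V"
  shows "V = alg_add (bounded_ops ell2) T U"
proof (rule Lam_limit_eqI[OF V])
  fix x :: "'a \<Rightarrow> complex" assume x: "x \<in> carrier ell2"
  note c = Lam_limit_carrier[OF T x] Lam_limit_carrier[OF U x]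
  have eq: "alg_add (bounded_ops ell2) T U x = T x + U x" using x by (simp add: bounded_ops_def)
  show "alg_add (bounded_ops ell2) T U x \<in> carrier ell2"
    unfolding eq by (rule Lam.carrier_closed(2)[OF c])
  show "(\<lambda>n. hnorm ell2 (Lam.ext (F n + G n) x - alg_add (bounded_ops ell2) T U x)) \<longlonglongrightarrow> 0"
    unfolding eq Lam.ext_add[OF x]
    by (rule Lam.hnorm_limit_add[OF Lam.ext_closed[OF x] Lam.ext_closed[OF x] c
      Lam_limit_pointwise[OF T x] Lam_limit_pointwise[OF U x]])
qed (simp add: bounded_ops_def)

lemma Lam_limit_scale:
  assumes T: "Lam_limit (F :: nat \<Rightarrow> 'a::inverse_semigroup semigroup_algebra) T"
    and V: "Lam_limit (\<lambda>n. sa_scale c (F n)) V"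
  shows "V = alg_scale (bounded_ops ell2) c T"
proof (rule Lam_limit_eqI[OF V])
  fix x :: "'a \<Rightarrow> complex" assume x: "x \<in> carrier ell2"
  note Tx = Lam_limit_carrier[OF T x]
  have eq: "alg_scale (bounded_ops ell2) c T x = cscale ell2 c (T x)" using x by (simp add: bounded_ops_def)
  show "alg_scale (bounded_ops ell2) c T x \<in> carrier ell2"
    unfolding eq by (rule Lam.carrier_closed(3)[OF Tx])
  show "(\<lambda>n. hnorm ell2 (Lam.ext (sa_scale c (F n)) x - alg_scale (bounded_ops ell2) c T x)) \<longlonglongrightarrow> 0"
    unfolding eq Lam.ext_sa_scale[OF x]
    by (rule Lam.hnorm_limit_scale[OF Lam.ext_closed[OF x] Tx Lam_limit_pointwise[OF T x]])
qed (simp add: bounded_ops_def)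

lemma Lam_limit_mult:
  assumes F: "F \<in> full_cauchy"
    and T: "Lam_limit (F :: nat \<Rightarrow> 'a::inverse_semigroup semigroup_algebra) T" and U: "Lam_limit G U"
    and V: "Lam_limit (\<lambda>n. sa_mult (F n) (G n)) V"
  shows "V = alg_mult (bounded_ops ell2) T U"
proof (rule Lam_limit_eqI[OF V])
  obtain B where B: "B > 0" "\<And>n. full_norm (F n) \<le> B" using full_cauchy_bounded[OF F] by blast
  fix x :: "'a \<Rightarrow> complex" assume x: "x \<in> carrier ell2"
  note Ux = Lam_limit_carrier[OF U x]
  note TUx = Lam_limit_carrier[OF T Ux]
  have d: "Lam.ext (G n) x - U x \<in> carrier ell2" for n
    by (rule Lam.carrier_closed(4)[OF Lam.ext_closed[OF x] Ux])
  \<comment> \<open>The product is split as \<open>F n (G n x - U x) + F n (U x)\<close>. The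
    summand 0 is the limit of the first part, in the shape that \<open>hnorm_limit_add\<close>
    expects; the first part is controlled by the bound \<open>B\<close> on the norms of
    \<open>F n\<close>.\<close>
  have eq: "alg_mult (bounded_ops ell2) T U x = 0 + T (U x)" using x by (simp add: bounded_ops_def)
  show "alg_mult (bounded_ops ell2) T U x \<in> carrier ell2" unfolding eq by (simp only: TUx add_0)
  have "(\<lambda>n. hnorm ell2 (Lam.ext (F n) (Lam.ext (G n) x - U x) - 0)) \<longlonglongrightarrow> 0"
  proof (rule Lim_null_comparison[OF always_eventually], rule allI)
    show "(\<lambda>n. B * hnorm ell2 (Lam.ext (G n) x - U x)) \<longlonglongrightarrow> 0"
      using tendsto_mult_left[OF Lam_limit_pointwise[OF U x], of B] by simp
    fix n
    have "hnorm ell2 (Lam.ext (F n) (Lam.ext (G n) x - U x)) \<le>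
        Lam.ext_norm (F n) * hnorm ell2 (Lam.ext (G n) x - U x)"
      by (rule Lam.ext_norm_bound[OF d])
    also have "\<dots> \<le> B * hnorm ell2 (Lam.ext (G n) x - U x)"
      by (intro mult_right_mono order_trans[OF Lam.ext_norm_le_full_norm B(2)] Lam.hnorm_nonneg d)
    finally show "norm (hnorm ell2 (Lam.ext (F n) (Lam.ext (G n) x - U x) - 0)) \<le>
        B * hnorm ell2 (Lam.ext (G n) x - U x)"
      using Lam.hnorm_nonneg[OF Lam.ext_closed[OF d]] by (simp only: diff_zero real_norm_def abs_of_nonneg)
  qed
  from Lam.hnorm_limit_add[OF Lam.ext_closed[OF d] Lam.ext_closed[OF Ux] Lam.carrier_closed(1) TUx
      this Lam_limit_pointwise[OF T Ux]]
  show "(\<lambda>n. hnorm ell2 (Lam.ext (sa_mult (F n) (G n)) x - alg_mult (bounded_ops ell2) T U x)) \<longlonglongrightarrow> 0"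
    unfolding eq Lam.ext_mult[OF x] Lam.bounded_op_diff[OF Lam.bounded_op_ext Lam.ext_closed[OF x] Ux]
    by (simp only: diff_add_cancel)
qed (simp add: bounded_ops_def)

lemma Lam_limit_star:
  assumes T: "Lam_limit (F :: nat \<Rightarrow> 'a::inverse_semigroup semigroup_algebra) T"
    and V: "Lam_limit (\<lambda>n. sa_star (F n)) V"
  shows "alg_star (bounded_ops ell2) T = V"
proof (rule Lam.alg_star_eqI)
  note b = Lam_limit_bounded_op[OF T] Lam_limit_bounded_op[OF V]
  show "V \<in> extensional (carrier ell2)" "bounded_op ell2 V" "bounded_op ell2 T"
    using T V by (simp_all add: Lam_limit_def carrier_bounded_ops)
  fix x y :: "'a \<Rightarrow> complex" assume x: "x \<in> carrier ell2" and y: "y \<in> carrier ell2"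
  have "(\<lambda>n. ip ell2 (Lam.ext (F n) x) y) \<longlonglongrightarrow> ip ell2 (T x) y"
    using x y Lam.bounded_op_closed[OF b(1) x] Lam_limit_pointwise[OF T x]
    by (intro Lam.ip_tendsto) auto
  moreover have "(\<lambda>n. cnj (ip ell2 (Lam.ext (sa_star (F n)) y) x)) \<longlonglongrightarrow> cnj (ip ell2 (V y) x)"
    using x y Lam.bounded_op_closed[OF b(2) y] Lam_limit_pointwise[OF V y]
    by (intro tendsto_cnj Lam.ip_tendsto) auto
  moreover have "cnj (ip ell2 (Lam.ext (sa_star (F n)) y) x) = ip ell2 (Lam.ext (F n) x) y" for n
    unfolding Lam.ext_adj[OF x y] by (rule Lam.ip_cnj[symmetric]) (use x y in auto)
  moreover have "cnj (ip ell2 (V y) x) = ip ell2 x (V y)"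
    by (rule Lam.ip_cnj[symmetric]) (use x Lam.bounded_op_closed[OF b(2) y] in auto)
  ultimately show "ip ell2 (T x) y = ip ell2 x (V y)" by (simp add: LIMSEQ_unique)
qed

lemma Lam_limit_zero:
  assumes null: "(\<lambda>n. red_norm (F n :: 'a::inverse_semigroup semigroup_algebra)) \<longlonglongrightarrow> 0"
    and V: "Lam_limit F V"
  shows "V = (\<lambda>x\<in>carrier ell2. 0)"
proof (rule Lam_limit_eqI[OF V])
  fix x :: "'a \<Rightarrow> complex" assume x: "x \<in> carrier ell2"
  have eq: "(\<lambda>x\<in>carrier ell2. 0) x = (0 :: 'a \<Rightarrow> complex)" using x by simp
  show "(\<lambda>x\<in>carrier ell2. 0) x \<in> carrier (ell2 :: ('a \<Rightarrow> complex) hilbert)"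
    unfolding eq by (rule Lam.carrier_closed(1))
  show "(\<lambda>n. hnorm ell2 (Lam.ext (F n) x - (\<lambda>x\<in>carrier ell2. 0) x)) \<longlonglongrightarrow> 0"
  proof (rule Lim_null_comparison[OF always_eventually], rule allI)
    show "(\<lambda>n. red_norm (F n) * hnorm ell2 x) \<longlonglongrightarrow> 0"
      using tendsto_mult_right[OF null, of "hnorm ell2 x"] by simp
    show "norm (hnorm ell2 (Lam.ext (F n) x - (\<lambda>x\<in>carrier ell2. 0) x)) \<le> red_norm (F n) * hnorm ell2 x" for n
      unfolding eq using Lam.ext_norm_bound[OF x, of "F n"] Lam.hnorm_nonneg[OF Lam.ext_closed[OF x, of "F n"]]
      by (simp only: diff_zero real_norm_def abs_of_nonneg)
  qed
qed simp

text \<open>Injectivity of \<open>Lambda_hom\<close> in terms of representatives: the class of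
  \<open>F\<close> and the class of the zero sequence both go to the zero operator, so they are
  equal.\<close>

lemma weak_containment_imp_null:
  fixes F :: "nat \<Rightarrow> 'a::inverse_semigroup semigroup_algebra"
  assumes wc: "weak_containment TYPE('a)" and F: "F \<in> full_cauchy"
    and null: "(\<lambda>n. red_norm (F n)) \<longlonglongrightarrow> 0"
  shows "(\<lambda>n. full_norm (F n)) \<longlonglongrightarrow> 0"
proof -
  have "red_norm (0 :: 'a semigroup_algebra) = 0"
    by (rule antisym[OF Lam.ext_norm_le Lam.ext_norm_nonneg]) (simp_all add: Lam.ext_zero)
  then have "Lambda_hom (full_rel `` {\<lambda>_. 0 :: 'a semigroup_algebra}) = (\<lambda>x\<in>carrier ell2. 0)"
    by (intro Lam_limit_zero[OF _ Lambda_hom_class[THEN iffD2, OF full_cauchy_zero refl]]) simp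
  moreover have "Lambda_hom (full_rel `` {F}) = (\<lambda>x\<in>carrier ell2. 0)"
    by (rule Lam_limit_zero[OF null Lambda_hom_class[THEN iffD2, OF F refl]])
  ultimately have eq: "Lambda_hom (full_rel `` {F}) = Lambda_hom (full_rel `` {\<lambda>_. 0})" by simp
  have cl: "full_rel `` {F} \<in> carrier cstar_full" "full_rel `` {\<lambda>_. 0 :: 'a semigroup_algebra} \<in> carrier cstar_full"
    unfolding carrier_cstar_full by (rule quotientI, rule F full_cauchy_zero)+
  have "inj_on (Lambda_hom :: (nat \<Rightarrow> 'a semigroup_algebra) set \<Rightarrow> _) (carrier cstar_full)"
    using wc by (simp add: weak_containment_def star_iso_def bij_betw_def)
  then have "full_rel `` {F} = full_rel `` {\<lambda>_. 0}"
    using inj_on_eq_iff[OF _ cl] eq by blast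
  then have "(F, \<lambda>_. 0) \<in> full_rel"
    using eq_equiv_class_iff[OF equiv_full_rel F full_cauchy_zero] by simp
  then show ?thesis using full_relD(3) by fastforce
qed

text \<open>If two sequences have the same limit operator \<open>T\<close>, the reduced norm of
  their difference is at most the sum of their distances from \<open>T\<close>; the hypothesis
  carries this over to the full norm, which gives injectivity. Surjectivity is built into
  \<open>cstar_reduced\<close>.\<close>

lemma weak_containmentI:
  assumes le: "\<And>f :: 'a::inverse_semigroup semigroup_algebra. full_norm f \<le> red_norm f"
  shows "weak_containment TYPE('a)"
proof -
  let ?\<Lambda> = "Lambda_hom :: (nat \<Rightarrow> 'a semigroup_algebra) set \<Rightarrow> _"
  have cl: "\<exists>F. F \<in> full_cauchy \<and> A = full_rel `` {F} \<and> Lam_limit F (?\<Lambda> A)"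
    if A: "A \<in> carrier cstar_full" for A
  proof -
    obtain F where F: "F \<in> full_cauchy" "A = full_rel `` {F}"
      using A unfolding carrier_cstar_full by (rule quotientE)
    have "Lam_limit F (?\<Lambda> A)"
      unfolding F(2) by (rule Lambda_hom_class[OF F(1), THEN iffD2]) (rule refl)
    then show ?thesis using F by (intro exI conjI)
  qed
  have "star_hom ?\<Lambda> cstar_full cstar_reduced"
    unfolding star_hom_def
  proof (intro conjI ballI allI)
    fix A :: "(nat \<Rightarrow> 'a semigroup_algebra) set" and c assume A: "A \<in> carrier cstar_full"
    then show "?\<Lambda> A \<in> carrier cstar_reduced" by (simp add: cstar_reduced_def)
    obtain F where F: "F \<in> full_cauchy" "A = full_rel `` {F}" "Lam_limit F (?\<Lambda> A)"
      using cl[OF A] by (elim exE conjE)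
    show "?\<Lambda> (alg_scale cstar_full c A) = alg_scale cstar_reduced c (?\<Lambda> A)"
      unfolding F(2) cstar_full_scale[OF F(1)] cstar_reduced_ops
      by (rule Lam_limit_scale[OF F(3)[unfolded F(2)] Lambda_hom_class[THEN iffD2, OF full_cauchy_scale[OF F(1)] refl]])
    obtain V where V: "Lam_limit (\<lambda>n. sa_star (F n)) V"
      using Lam_limit_exists[OF full_cauchy_star[OF F(1)]] by blast
    show "?\<Lambda> (alg_star cstar_full A) = alg_star cstar_reduced (?\<Lambda> A)"
      unfolding F(2) cstar_full_star[OF F(1)] cstar_reduced_ops Lam_limit_star[OF F(3)[unfolded F(2)] V]
      by (rule Lambda_hom_class[OF full_cauchy_star[OF F(1)], THEN iffD1]) (rule V)
    fix B :: "(nat \<Rightarrow> 'a semigroup_algebra) set" assume B: "B \<in> carrier cstar_full"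
    obtain G where G: "G \<in> full_cauchy" "B = full_rel `` {G}" "Lam_limit G (?\<Lambda> B)"
      using cl[OF B] by (elim exE conjE)
    note unf = F(2) G(2) cstar_reduced_ops
    show "?\<Lambda> (alg_add cstar_full A B) = alg_add cstar_reduced (?\<Lambda> A) (?\<Lambda> B)"
      unfolding unf cstar_full_add[OF F(1) G(1)]
      by (rule Lam_limit_add[OF F(3)[unfolded F(2)] G(3)[unfolded G(2)]
        Lambda_hom_class[THEN iffD2, OF full_cauchy_add[OF F(1) G(1)] refl]])
    show "?\<Lambda> (alg_mult cstar_full A B) = alg_mult cstar_reduced (?\<Lambda> A) (?\<Lambda> B)"
      unfolding unf cstar_full_mult[OF F(1) G(1)]
      by (rule Lam_limit_mult[OF F(1) F(3)[unfolded F(2)] G(3)[unfolded G(2)]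
        Lambda_hom_class[THEN iffD2, OF full_cauchy_mult[OF F(1) G(1)] refl]])
  qed
  moreover have "inj_on ?\<Lambda> (carrier cstar_full)"
  proof (rule inj_onI)
    fix A B :: "(nat \<Rightarrow> 'a semigroup_algebra) set"
    assume A: "A \<in> carrier cstar_full" and B: "B \<in> carrier cstar_full" and eq: "?\<Lambda> A = ?\<Lambda> B"
    obtain F where F: "F \<in> full_cauchy" "A = full_rel `` {F}" "Lam_limit F (?\<Lambda> A)"
      using cl[OF A] by (elim exE conjE)
    define T where "T = ?\<Lambda> A"
    note F = F(1,2) F(3)[folded T_def]
    obtain G where G: "G \<in> full_cauchy" "B = full_rel `` {G}" "Lam_limit G T"
      using cl[OF B] unfolding eq[symmetric] T_def by (elim exE conjE)
    let ?c = "\<lambda>n. op_norm ell2 (\<lambda>x. Lam.ext (F n) x - T x) + op_norm ell2 (\<lambda>x. Lam.ext (G n) x - T x)"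
    have "(F, G) \<in> full_rel"
    proof (rule full_relI[OF F(1) G(1)])
      show "?c \<longlonglongrightarrow> 0"
        using tendsto_add[OF Lam_limit_dist_tendsto[OF F(3)] Lam_limit_dist_tendsto[OF G(3)]] by simp
      fix n
      have "red_norm (F n - G n) \<le> ?c n"
      proof (rule Lam.ext_norm_le)
        show "0 \<le> ?c n"
          using Lam_limit_dist(2)[OF F(3) Lam.carrier_closed(1), of n]
            Lam_limit_dist(2)[OF G(3) Lam.carrier_closed(1), of n] by simp
        fix x :: "'a \<Rightarrow> complex" assume x: "x \<in> carrier ell2"
        have c: "T x \<in> carrier ell2" using Lam.bounded_op_closed[OF Lam_limit_bounded_op[OF F(3)] x] .
        have eq: "Lam.ext (F n - G n) x = (Lam.ext (F n) x - T x) - (Lam.ext (G n) x - T x)"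
          unfolding Lam.ext_diff[OF x] by (simp only: diff_diff_eq2 diff_add_cancel)
        have "hnorm ell2 (Lam.ext (F n - G n) x) \<le> hnorm ell2 (Lam.ext (F n) x - T x) + hnorm ell2 (Lam.ext (G n) x - T x)"
          unfolding eq using x c by (intro Lam.hnorm_diff_triangle Lam.carrier_closed(4) Lam.ext_closed)
        also have "\<dots> \<le> op_norm ell2 (\<lambda>x. Lam.ext (F n) x - T x) * hnorm ell2 x +
            op_norm ell2 (\<lambda>x. Lam.ext (G n) x - T x) * hnorm ell2 x"
          by (intro add_mono Lam_limit_dist(1)[OF F(3) x] Lam_limit_dist(1)[OF G(3) x])
        finally show "hnorm ell2 (Lam.ext (F n - G n) x) \<le> ?c n * hnorm ell2 x"
          by (simp only: distrib_right)
      qed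
      then show "full_norm (F n - G n) \<le> ?c n" using le order_trans by blast
    qed
    then show "A = B" unfolding F(2) G(2) by (rule equiv_class_eq[OF equiv_full_rel])
  qed
  ultimately show ?thesis
    by (simp add: weak_containment_def star_iso_def bij_betw_def cstar_reduced_def)
qed

end

subsection \<open>Weak containment forces norm one on averages\<close>

definition triv_char :: "'a semigroup_algebra \<Rightarrow> complex"
  where "triv_char = sa_sum (\<lambda>_ c. c)"

lemma triv_char_diff: "triv_char (f - g) = triv_char f - triv_char g"
  unfolding triv_char_def by (rule sa_sum_diff) simp_all

lemma triv_char_add: "triv_char (f + g) = triv_char f + triv_char g"
  unfolding triv_char_def by (rule sa_sum_add) simp_all

lemma triv_char_mult: "triv_char (sa_mult f g) = triv_char f * triv_char g"
proof -
  have "triv_char (sa_mult f g) = sa_sum (\<lambda>s c. sa_sum (\<lambda>t d. c * d) g) f"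
    unfolding triv_char_def by (rule sa_sum_mult) simp_all
  then show ?thesis by (simp add: triv_char_def sa_sum_def sum_product)
qed

lemma triv_char_star: "triv_char (sa_star f) = cnj (triv_char f)"
proof -
  have "triv_char (sa_star f) = sa_sum (\<lambda>s c. cnj c) f"
    unfolding triv_char_def by (rule sa_sum_star) simp_all
  then show ?thesis by (simp add: triv_char_def sa_sum_def)
qed

lemma triv_char_le_full_norm:
  fixes f :: "'a::inverse_semigroup semigroup_algebra"
  shows "cmod (triv_char f) \<le> full_norm f"
proof -
  interpret triv: hilb_rep triv_space "\<lambda>s :: 'a. \<lambda>x. x" by (rule hilb_rep_triv)
  have "hnorm triv_space (triv.ext f 1) \<le> triv.ext_norm f * hnorm triv_space 1"
    by (rule triv.ext_norm_bound) (simp add: triv_space_def)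
  moreover have "triv.ext f 1 = triv_char f"
    by (simp add: rep_ext_def triv_space_def triv_char_def sa_sum_def)
  ultimately show ?thesis
    using triv.ext_norm_le_full_norm[of f] by (simp add: hnorm_triv)
qed

section \<open>Functional calculus by iteration\<close>

context hilb_rep
begin

lemma hnorm_diff_power2:
  assumes x: "x \<in> carrier H" and y: "y \<in> carrier H"
  shows "(hnorm H (x - y))\<^sup>2 = (hnorm H x)\<^sup>2 - 2 * Re (ip H x y) + (hnorm H y)\<^sup>2"
proof -
  have "complex_of_real ((hnorm H (x - y))\<^sup>2) = ip H x x - ip H x y - (cnj (ip H x y) - ip H y y)"
    unfolding ip_self[of "x - y", OF carrier_closed(4)[OF x y], symmetric]
    using x y ip_cnj[OF x y] by (simp add: ip_diff_left ip_diff_right)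
  then have "Re (complex_of_real ((hnorm H (x - y))\<^sup>2)) =
      Re (ip H x x - ip H x y - (cnj (ip H x y) - ip H y y))" by (rule arg_cong)
  then show ?thesis using ip_self[OF x] ip_self[OF y] by (simp del: of_real_power)
qed

lemma ext_star_adj:
  assumes "x \<in> carrier H" "y \<in> carrier H"
  shows "ip H (ext (sa_star f) x) y = ip H x (ext f y)"
  using ext_adj[of y x f] ip_cnj[of "ext f y" x] ip_cnj[of y "ext (sa_star f) x"] assms by simp

text \<open>Spectrally: \<open>0 \<le> t - t\<^sup>2 \<le> 1/4\<close> for \<open>0 \<le> t \<le> 1\<close>, since \<open>4 (t - t\<^sup>2) = 1 - (2 t - 1)\<^sup>2\<close>.\<close>

lemma ext_norm_minus_square_le:
  assumes c: "ext_norm c \<le> 1" "ext_norm (sa_star c) \<le> 1"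
  defines "a \<equiv> sa_mult (sa_star c) c"
  shows "ext_norm (a - sa_mult a a) \<le> 1 / 4"
proof (rule ext_norm_le)
  fix x assume x: "x \<in> carrier H"
  \<comment> \<open>\<open>y\<close> is the self-adjoint operator 2 a - 1. It is a contraction: |y
    z|^2 = 4 |a z|^2 - 4 |c z|^2 + |z|^2, and |a z| \<le> |c z|.\<close>
  define y where "y z = cscale H 2 (ext a z) - z" for z
  have yc: "y z \<in> carrier H" if "z \<in> carrier H" for z using that by (simp add: y_def)
  have a_adj: "ip H (ext a z) w = ip H (ext c z) (ext c w)"
    "ip H w (ext a z) = ip H (ext c w) (ext c z)"
    if "z \<in> carrier H" "w \<in> carrier H" for z w
    using that by (simp_all add: a_def ext_mult ext_star_adj flip: ext_adj[of w "ext c z"])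
  have y_adj: "ip H (y z) w = ip H z (y w)" if "z \<in> carrier H" "w \<in> carrier H" for z w
    using that by (simp add: y_def ip_diff_left ip_diff_right ip_scale_left ip_scale_right a_adj)
  have y_le: "(hnorm H (y z))\<^sup>2 \<le> (hnorm H z)\<^sup>2" if z: "z \<in> carrier H" for z
  proof -
    have "hnorm H (ext a z) \<le> ext_norm (sa_star c) * hnorm H (ext c z)"
      unfolding a_def ext_mult[OF z] using z by (intro ext_norm_bound) simp
    also have "\<dots> \<le> 1 * hnorm H (ext c z)" using c z by (intro mult_right_mono) auto
    finally have le: "(hnorm H (ext a z))\<^sup>2 \<le> (hnorm H (ext c z))\<^sup>2" using z by (simp add: power_mono)
    have "ip H (cscale H 2 (ext a z)) z = 2 * complex_of_real ((hnorm H (ext c z))\<^sup>2)"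
      using z ip_self[of "ext c z"] by (simp add: ip_scale_left a_adj del: of_real_power)
    then have "Re (ip H (cscale H 2 (ext a z)) z) = 2 * (hnorm H (ext c z))\<^sup>2"
      by (simp del: of_real_power)
    then have "(hnorm H (y z))\<^sup>2 = 4 * (hnorm H (ext a z))\<^sup>2 - 4 * (hnorm H (ext c z))\<^sup>2 + (hnorm H z)\<^sup>2"
      using hnorm_diff_power2[of "cscale H 2 (ext a z)" z] z
      by (simp add: y_def hnorm_scale power_mult_distrib)
    then show ?thesis using le by simp
  qed
  have "cscale H 4 (ext (a - sa_mult a a) x) = x - y (y x)"
  proof -
    have "ext a (y x) = cscale H 2 (ext a (ext a x)) - ext a x"
      using x by (simp add: y_def bounded_op_diff[OF bounded_op_ext] bounded_op_scale[OF bounded_op_ext])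
    then have "y (y x) = cscale H 4 (ext a (ext a x)) - cscale H 2 (ext a x) - (cscale H 2 (ext a x) - x)"
      by (simp add: y_def[of "y x"] scale_right_diff_distrib) (simp add: y_def)
    moreover have "cscale H 2 (ext a x) + cscale H 2 (ext a x) = cscale H 4 (ext a x)"
      by (simp flip: scale_left_distrib)
    ultimately show ?thesis
      using x by (simp add: ext_diff ext_mult scale_right_diff_distrib algebra_simps)
  qed
  then have "4 * hnorm H (ext (a - sa_mult a a) x) = hnorm H (x - y (y x))"
    using hnorm_scale[of "ext (a - sa_mult a a) x" 4] x by simp
  moreover have "(hnorm H (x - y (y x)))\<^sup>2 \<le> (hnorm H x)\<^sup>2"
  proof -
    have "ip H x (y (y x)) = complex_of_real ((hnorm H (y x))\<^sup>2)"
      using y_adj[of x "y x"] ip_self[of "y x"] yc x by simp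
    then have "(hnorm H (x - y (y x)))\<^sup>2 = (hnorm H x)\<^sup>2 - 2 * (hnorm H (y x))\<^sup>2 + (hnorm H (y (y x)))\<^sup>2"
      using hnorm_diff_power2[of x "y (y x)"] x yc by (simp del: of_real_power)
    then show ?thesis using y_le[OF yc[OF x]] zero_le_power2[of "hnorm H (y x)"] by linarith
  qed
  then have "hnorm H (x - y (y x)) \<le> hnorm H x"
    by (rule power2_le_imp_le) (rule hnorm_nonneg[OF x])
  ultimately show "hnorm H (ext (a - sa_mult a a) x) \<le> 1 / 4 * hnorm H x" by simp
qed simp

end

lemma full_norm_minus_square_le:
  fixes c :: "'a::inverse_semigroup semigroup_algebra"
  assumes "full_norm c \<le> 1"
  shows "full_norm (sa_mult (sa_star c) c - sa_mult (sa_mult (sa_star c) c) (sa_mult (sa_star c) c)) \<le> 1 / 4"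
proof (rule hilb_rep_ext_norm_le_full)
  fix H :: "('a option \<Rightarrow> complex) hilbert" and \<pi> :: "'a \<Rightarrow> _" assume "hilb_rep H \<pi>"
  then interpret hilb_rep H \<pi> .
  have "ext_norm c \<le> 1" using ext_norm_le_full_norm[of c] assms by simp
  moreover have "ext_norm (sa_star c) \<le> 1"
    using ext_norm_le_full_norm[of "sa_star c"] full_norm_star[of c] assms by simp
  ultimately show "ext_norm (sa_mult (sa_star c) c - sa_mult (sa_mult (sa_star c) c) (sa_mult (sa_star c) c)) \<le> 1 / 4"
    by (rule ext_norm_minus_square_le)
qed simp

text \<open>The iterates converge to the smaller root \<open>(1 - sqrt (1 - 4 u)) / 2\<close> of \<open>w = u + w\<^sup>2\<close>. For
  \<open>u = a - a\<^sup>2\<close> the difference \<open>a - w\<close> is thus the positive part of \<open>2 a - 1\<close>, which vanishes where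
  \<open>a \<le> 1/2\<close> and equals 1 where \<open>a = 1\<close>. The scalar iteration is its majorant.\<close>

primrec root_iter :: "'a::inverse_semigroup semigroup_algebra \<Rightarrow> nat \<Rightarrow> 'a semigroup_algebra"
  where "root_iter u 0 = 0"
  | "root_iter u (Suc n) = u + sa_mult (root_iter u n) (root_iter u n)"

primrec root_majorant :: "nat \<Rightarrow> real"
  where "root_majorant 0 = 0"
  | "root_majorant (Suc n) = 1 / 4 + (root_majorant n)\<^sup>2"

text \<open>1/2 is the double root of w = 1/4 + w^2, and 1/4 is the largest constant for which this
  equation has a real root.\<close>

lemma root_majorant_bounds: "0 \<le> root_majorant n \<and> root_majorant n \<le> 1 / 2"
proof (induction n)
  case (Suc n)
  then have "(root_majorant n)\<^sup>2 \<le> (1 / 2)\<^sup>2" by (intro power_mono) auto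
  then show ?case by (simp add: power2_eq_square)
qed simp

lemma root_majorant_mono: "m \<le> n \<Longrightarrow> root_majorant m \<le> root_majorant n"
proof (rule lift_Suc_mono_le[of root_majorant])
  show "root_majorant n \<le> root_majorant (Suc n)" for n
    using sum_power2_ge_zero[of "root_majorant n - 1 / 2" 0] by (simp add: power2_eq_square algebra_simps)
qed

lemma convergent_root_majorant: "convergent root_majorant"
  by (rule Bseq_monoseq_convergent)
    (use root_majorant_bounds root_majorant_mono in \<open>auto simp: monoseq_def intro!: BseqI'[of _ "1/2"]\<close>)

context
  fixes u :: "'a::inverse_semigroup semigroup_algebra"
  assumes u: "full_norm u \<le> 1 / 4"
begin

lemma full_norm_root_iter: "full_norm (root_iter u n) \<le> root_majorant n"
proof (induction n)
  case (Suc n)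
  have "full_norm (root_iter u (Suc n)) \<le> full_norm u + full_norm (sa_mult (root_iter u n) (root_iter u n))"
    using full_norm_add by simp
  also have "\<dots> \<le> 1 / 4 + full_norm (root_iter u n) * full_norm (root_iter u n)"
    by (intro add_mono u full_norm_mult)
  also have "\<dots> \<le> 1 / 4 + root_majorant n * root_majorant n"
    using Suc by (intro add_mono mult_mono) (auto simp: full_norm_nonneg root_majorant_bounds)
  finally show ?case by (simp add: power2_eq_square)
qed simp

text \<open>At the critical constant 1/4 there is no geometric rate. The steps are instead dominated
  by those of the scalar iteration, through the same factorization of a difference of squares; the
  scalar steps telescope, and the scalar iteration converges by monotonicity.\<close>

lemma full_norm_root_iter_step:
  "full_norm (root_iter u (Suc n) - root_iter u n) \<le> root_majorant (Suc n) - root_majorant n"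
proof (induction n)
  case 0
  then show ?case using u by (simp add: sa_mult_eq)
next
  case (Suc n)
  let ?w = "root_iter u" and ?r = root_majorant
  have "full_norm (?w (Suc (Suc n)) - ?w (Suc n)) =
      full_norm (sa_mult (?w (Suc n)) (?w (Suc n)) - sa_mult (?w n) (?w n))" by simp
  also have "\<dots> \<le> full_norm (?w (Suc n)) * full_norm (?w (Suc n) - ?w n) +
      full_norm (?w (Suc n) - ?w n) * full_norm (?w n)" by (rule full_norm_mult_diff)
  also have "\<dots> \<le> ?r (Suc n) * (?r (Suc n) - ?r n) + (?r (Suc n) - ?r n) * ?r n"
    using Suc.IH root_majorant_bounds root_majorant_mono[of n "Suc n"]
    by (intro add_mono mult_mono full_norm_root_iter full_norm_nonneg) auto
  also have "\<dots> = ?r (Suc (Suc n)) - ?r (Suc n)" by (simp add: power2_eq_square algebra_simps)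
  finally show ?case .
qed

lemma full_norm_root_iter_diff:
  assumes "n \<le> m"
  shows "full_norm (root_iter u m - root_iter u n) \<le> root_majorant m - root_majorant n"
  using assms
proof (induction m rule: dec_induct)
  case (step m)
  have "full_norm (root_iter u (Suc m) - root_iter u n) \<le>
      full_norm (root_iter u (Suc m) - root_iter u m) + full_norm (root_iter u m - root_iter u n)"
    by (rule full_norm_triangle)
  then show ?case using full_norm_root_iter_step[of m] step.IH by linarith
qed simp

lemma full_cauchy_root_iter: "(\<lambda>n. a - root_iter u n) \<in> full_cauchy"
proof (rule full_cauchyI[OF _ convergent_root_majorant])
  fix m n
  have "a - root_iter u m - (a - root_iter u n) = root_iter u n - root_iter u m" by simp
  then have "full_norm (a - root_iter u m - (a - root_iter u n)) = full_norm (root_iter u n - root_iter u m)"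
    by simp
  moreover have "full_norm (root_iter u n - root_iter u m) \<le> \<bar>root_majorant m - root_majorant n\<bar>"
    using full_norm_root_iter_diff[of n m] full_norm_root_iter_diff[of m n]
      full_norm_minus_commute[of "root_iter u n" "root_iter u m"] by (cases "n \<le> m") auto
  ultimately show "full_norm (a - root_iter u m - (a - root_iter u n)) \<le> \<bar>root_majorant m - root_majorant n\<bar>"
    by simp
qed

end

text \<open>\<open>F\<close> represents the forbidden element of the kernel.
  \<open>triv_char\<close> kills \<open>u\<close>, hence every iterate, so it is 1 on every
  \<open>F n\<close>; in the reduced norm, \<open>F\<close> would decay geometrically with ratio
  \<open>red_norm a + 1 / 2\<close>.\<close>

lemma weak_containment_no_gap_square:
  fixes c :: "'a::inverse_semigroup semigroup_algebra"
  assumes wc: "weak_containment TYPE('a)" and c: "full_norm c \<le> 1" "triv_char c = 1"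
  shows "1 / 2 \<le> red_norm (sa_mult (sa_star c) c)"
proof (rule ccontr)
  interpret Lam: hilb_rep ell2 "left_regular :: 'a \<Rightarrow> _" by (rule hilb_rep_ell2)
  define a where "a = sa_mult (sa_star c) c"
  define u where "u = a - sa_mult a a"
  define F where "F n = a - root_iter u n" for n
  assume "\<not> ?thesis"
  then have a: "red_norm a < 1 / 2" by (simp add: a_def)
  have u: "full_norm u \<le> 1 / 4"
    unfolding u_def a_def by (rule full_norm_minus_square_le[OF c(1)])
  have "triv_char a = 1" by (simp add: a_def triv_char_mult triv_char_star c)
  then have "triv_char u = 0" by (simp add: u_def triv_char_diff triv_char_mult)
  then have "triv_char (root_iter u n) = 0" for n
    by (induction n) (simp_all add: triv_char_add triv_char_mult, simp add: triv_char_def)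
  then have "triv_char (F n) = 1" for n
    using \<open>triv_char a = 1\<close> by (simp add: F_def triv_char_diff)
  then have "1 \<le> full_norm (F n)" for n using triv_char_le_full_norm[of "F n"] by simp
  moreover have "(\<lambda>n. full_norm (F n)) \<longlonglongrightarrow> 0"
  proof (rule weak_containment_imp_null[OF wc])
    show "F \<in> full_cauchy" unfolding F_def[abs_def] by (rule full_cauchy_root_iter[OF u])
    define r where "r = red_norm a + 1 / 2"
    have r: "0 \<le> r" "r < 1" using a Lam.ext_norm_nonneg[of a] by (simp_all add: r_def)
    have "red_norm (F n) \<le> r ^ n * red_norm a" for n
    proof (induction n)
      case 0
      then show ?case by (simp add: F_def)
    next
      case (Suc n)
      \<comment> \<open>Since \<open>u\<close> is a - a^2, the left side is a^2 - w^2 for the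
        iterate w; it is factored as a (a - w) + (a - w) w, which does not require a and w to
        commute.\<close>
      have "F (Suc n) = sa_mult a (F n) + sa_mult (F n) (root_iter u n)"
        by (simp add: F_def u_def sa_mult_diff_left sa_mult_diff_right)
      then have "red_norm (F (Suc n)) \<le> red_norm a * red_norm (F n) + red_norm (F n) * red_norm (root_iter u n)"
        using Lam.ext_norm_add[of "sa_mult a (F n)" "sa_mult (F n) (root_iter u n)"]
          Lam.ext_norm_mult[of a "F n"] Lam.ext_norm_mult[of "F n" "root_iter u n"] by simp
      also have "red_norm (root_iter u n) \<le> 1 / 2"
        using Lam.ext_norm_le_full_norm[of "root_iter u n"] full_norm_root_iter[OF u, of n]
          root_majorant_bounds[of n] by linarith
      then have "red_norm (F n) * red_norm (root_iter u n) \<le> red_norm (F n) * (1 / 2)"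
        by (intro mult_left_mono Lam.ext_norm_nonneg)
      finally have "red_norm (F (Suc n)) \<le> r * red_norm (F n)" by (simp add: r_def algebra_simps)
      also have "\<dots> \<le> r * (r ^ n * red_norm a)" using r Suc by (intro mult_left_mono)
      finally show ?case by simp
    qed
    then have "\<forall>\<^sub>F n in sequentially. norm (red_norm (F n)) \<le> r ^ n * red_norm a"
      by (simp add: Lam.ext_norm_nonneg)
    moreover have "(\<lambda>n. r ^ n * red_norm a) \<longlonglongrightarrow> 0"
      using tendsto_mult_right[OF LIMSEQ_realpow_zero[OF r], of "red_norm a"] by simp
    ultimately show "(\<lambda>n. red_norm (F n)) \<longlonglongrightarrow> 0" by (rule Lim_null_comparison)
  qed
  ultimately have "1 \<le> (0::real)" by (intro LIMSEQ_le_const[of "\<lambda>n. full_norm (F n)"]) auto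
  then show False by simp
qed

primrec square_iter :: "'a::inverse_semigroup semigroup_algebra \<Rightarrow> nat \<Rightarrow> 'a semigroup_algebra"
  where "square_iter b 0 = b"
  | "square_iter b (Suc n) = sa_mult (sa_star (square_iter b n)) (square_iter b n)"

lemma red_norm_star_mult: "red_norm (sa_mult (sa_star f) f) \<le> (red_norm f)\<^sup>2"
  for f :: "'a::inverse_semigroup semigroup_algebra"
proof -
  interpret Lam: hilb_rep ell2 "left_regular :: 'a \<Rightarrow> _" by (rule hilb_rep_ell2)
  have "red_norm (sa_mult (sa_star f) f) \<le> red_norm (sa_star f) * red_norm f" by (rule Lam.ext_norm_mult)
  also have "\<dots> \<le> red_norm f * red_norm f"
    by (intro mult_right_mono Lam.ext_norm_star Lam.ext_norm_nonneg)
  finally show ?thesis by (simp add: power2_eq_square)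
qed

lemma red_norm_square_iter: "red_norm (square_iter b n) \<le> red_norm b ^ 2 ^ n"
  for b :: "'a::inverse_semigroup semigroup_algebra"
proof (induction n)
  case (Suc n)
  interpret Lam: hilb_rep ell2 "left_regular :: 'a \<Rightarrow> _" by (rule hilb_rep_ell2)
  have "red_norm (square_iter b (Suc n)) \<le> (red_norm (square_iter b n))\<^sup>2"
    by (simp add: red_norm_star_mult)
  also have "\<dots> \<le> (red_norm b ^ 2 ^ n)\<^sup>2" using Suc by (intro power_mono Lam.ext_norm_nonneg)
  finally show ?case by (simp add: mult.commute flip: power_mult)
qed simp

lemma weak_containment_no_gap:
  fixes b :: "'a::inverse_semigroup semigroup_algebra"
  assumes wc: "weak_containment TYPE('a)" and b: "full_norm b \<le> 1" "triv_char b = 1"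
  shows "1 \<le> red_norm b"
proof (rule ccontr)
  interpret Lam: hilb_rep ell2 "left_regular :: 'a \<Rightarrow> _" by (rule hilb_rep_ell2)
  assume "\<not> ?thesis"
  then have r: "0 \<le> red_norm b" "red_norm b < 1" using Lam.ext_norm_nonneg[of b] by auto
  obtain n where n: "red_norm b ^ n < 1 / 2"
    using real_arch_pow_inv[of "1 / 2" "red_norm b"] r by auto
  have it: "full_norm (square_iter b n) \<le> 1 \<and> triv_char (square_iter b n) = 1" for n
  proof (induction n)
    case (Suc n)
    have "full_norm (square_iter b (Suc n)) \<le> full_norm (sa_star (square_iter b n)) * full_norm (square_iter b n)"
      by (simp add: full_norm_mult)
    also have "\<dots> \<le> 1 * 1"
      using Suc full_norm_star[of "square_iter b n"] by (intro mult_mono full_norm_nonneg) auto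
    finally show ?case using Suc by (simp add: triv_char_mult triv_char_star)
  qed (simp add: b)
  have "1 / 2 \<le> red_norm (square_iter b (Suc n))"
    using weak_containment_no_gap_square[OF wc, of "square_iter b n"] it[of n] by simp
  also have "\<dots> \<le> red_norm b ^ 2 ^ Suc n" by (rule red_norm_square_iter)
  also have "\<dots> \<le> red_norm b ^ n"
    using r less_exp[of "Suc n"] by (intro power_decreasing) auto
  finally show False using n by simp
qed

subsection \<open>From almost invariant vectors to invariant means\<close>

lemma rep_ext_left_regular_apply:
  assumes "x \<in> carrier ell2"
  shows "rep_ext ell2 left_regular f x c =
    (\<Sum>s\<in>Poly_Mapping.keys f. Poly_Mapping.lookup f s * left_regular s x c)"
proof -
  have "(\<Sum>s\<in>A. F s) c = (\<Sum>s\<in>A. F s c)" for A and F :: "'a \<Rightarrow> 'a \<Rightarrow> complex"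
    by (induction A rule: infinite_finite_induct) simp_all
  then show ?thesis using assms by (simp add: rep_ext_def ell2_simps(2))
qed

text \<open>On a finite set \<open>C\<close> the values of
  \<open>rep_ext ell2 left_regular f x\<close> depend on finitely many coordinates of
  \<open>x\<close>, namely those in \<open>A\<close>, so truncated vectors suffice. Finite supports
  make the means constructed later finite sums.\<close>

lemma red_norm_le_finite_support:
  fixes f :: "'a::inverse_semigroup semigroup_algebra"
  assumes B: "0 \<le> B"
    and le: "\<And>A x. finite A \<Longrightarrow> (\<And>b. b \<notin> A \<Longrightarrow> x b = 0) \<Longrightarrow>
      hnorm ell2 (rep_ext ell2 left_regular f x) \<le> B * hnorm ell2 x"
  shows "red_norm f \<le> B"
proof -
  interpret Lam: hilb_rep ell2 "left_regular :: 'a \<Rightarrow> _" by (rule hilb_rep_ell2)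
  show ?thesis
  proof (rule Lam.ext_norm_le[OF B])
    fix x :: "'a \<Rightarrow> complex" assume x: "x \<in> carrier ell2"
    show "hnorm ell2 (Lam.ext f x) \<le> B * hnorm ell2 x"
    proof (rule hnorm_ell2_leI)
      fix C :: "'a set" assume C: "finite C"
      define A where "A = (\<Union>s\<in>Poly_Mapping.keys f. (\<lambda>c. inv_star s * c) ` C)"
      define y where "y b = (if b \<in> A then x b else 0)" for b
      have A: "finite A" using C by (simp add: A_def)
      have y0: "y b = 0" if "b \<notin> A" for b using that by (simp add: y_def)
      have y: "y \<in> carrier ell2" "(hnorm ell2 y)\<^sup>2 = (\<Sum>b\<in>A. (cmod (y b))\<^sup>2)"
        using hnorm_ell2_finite[of A y] A y0 by auto
      have "Lam.ext f x c = Lam.ext f y c" if "c \<in> C" for c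
      proof -
        have "left_regular s x c = left_regular s y c" if "s \<in> Poly_Mapping.keys f" for s
          using that \<open>c \<in> C\<close> by (auto simp: left_regular_eq y_def A_def)
        then show ?thesis using x y(1) by (simp add: rep_ext_left_regular_apply)
      qed
      then have "(\<Sum>c\<in>C. (cmod (Lam.ext f x c))\<^sup>2) = (\<Sum>c\<in>C. (cmod (Lam.ext f y c))\<^sup>2)" by simp
      also have "\<dots> \<le> (hnorm ell2 (Lam.ext f y))\<^sup>2"
        by (rule sum_le_hnorm_ell2[OF Lam.ext_closed[OF y(1)] C])
      also have "\<dots> \<le> (B * hnorm ell2 y)\<^sup>2"
        using le[OF A y0] hnorm_ell2_power2(2)[OF Lam.ext_closed[OF y(1)]] by (rule power_mono)
      also have "\<dots> = B\<^sup>2 * (\<Sum>b\<in>A. (cmod (x b))\<^sup>2)"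
        using y(2) by (simp add: power_mult_distrib y_def)
      also have "\<dots> \<le> B\<^sup>2 * (hnorm ell2 x)\<^sup>2"
        using sum_le_hnorm_ell2[OF x A] by (intro mult_left_mono) auto
      finally show "(\<Sum>c\<in>C. (cmod (Lam.ext f x c))\<^sup>2) \<le> (B * hnorm ell2 x)\<^sup>2"
        by (simp add: power_mult_distrib)
    qed (use B hnorm_ell2_power2(2)[OF x] in simp)
  qed
qed

definition average :: "'a set \<Rightarrow> 'a semigroup_algebra"
  where "average K = (\<Sum>s\<in>K. Poly_Mapping.single s (1 / of_nat (card K)))"

lemma triv_char_average:
  assumes "finite K" "K \<noteq> {}"
  shows "triv_char (average K) = 1"
proof -
  have "triv_char (average K) = (\<Sum>s\<in>K. 1 / of_nat (card K))"
    unfolding triv_char_def average_def by (subst sa_sum_sum) (simp_all add: sa_sum_single)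
  then show ?thesis using assms by simp
qed

lemma (in hilb_rep) ext_average:
  "x \<in> carrier H \<Longrightarrow> ext (average K) x = cscale H (1 / of_nat (card K)) (\<Sum>s\<in>K. \<pi> s x)"
  unfolding average_def by (simp add: ext_eq sa_sum_sum scale_left_distrib)
    (simp add: sa_sum_single scale_sum_right)

lemma full_norm_average:
  assumes K: "finite K" "K \<noteq> {}"
  shows "full_norm (average K :: 'a::inverse_semigroup semigroup_algebra) \<le> 1"
proof (rule hilb_rep_ext_norm_le_full)
  fix H :: "('a option \<Rightarrow> complex) hilbert" and \<pi> :: "'a \<Rightarrow> _" assume "hilb_rep H \<pi>"
  then interpret hilb_rep H \<pi> .
  show "ext_norm (average K) \<le> 1"
  proof (rule ext_norm_le)
    fix x assume x: "x \<in> carrier H"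
    have "hnorm H (\<Sum>s\<in>K. \<pi> s x) \<le> (\<Sum>s\<in>K. hnorm H (\<pi> s x))" using x by (intro hnorm_sum) simp
    also have "\<dots> \<le> of_nat (card K) * hnorm H x"
      using x by (intro sum_bounded_above rep_contraction)
    finally show "hnorm H (ext (average K) x) \<le> 1 * hnorm H x"
      using K x by (simp add: ext_average hnorm_scale norm_divide carrier_closed(5) field_simps card_gt_0_iff)
  qed simp
qed simp

text \<open>The squared norm of the sum is the sum of all \<open>(card K)\<^sup>2\<close> real parts
  of inner products. None of them exceeds 1 and the total defect is at most \<open>\<kappa>\<close>,
  so no single one can fall short by more.\<close>

lemma (in hilb_rep) inner_of_near_unit_average:
  assumes v: "\<And>s. s \<in> K \<Longrightarrow> v s \<in> carrier H" "\<And>s. s \<in> K \<Longrightarrow> hnorm H (v s) \<le> 1"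
    and K: "finite K" and avg: "(real (card K))\<^sup>2 - \<kappa> \<le> (hnorm H (\<Sum>s\<in>K. v s))\<^sup>2"
    and st: "s \<in> K" "t \<in> K"
  shows "1 - \<kappa> \<le> Re (ip H (v s) (v t))"
proof -
  let ?S = "\<Sum>s\<in>K. v s"
  have S: "?S \<in> carrier H" using v by (intro carrier_closed(5))
  have le1: "Re (ip H (v p) (v q)) \<le> 1" if "p \<in> K" "q \<in> K" for p q
  proof -
    have "Re (ip H (v p) (v q)) \<le> hnorm H (v p) * hnorm H (v q)"
      using Cauchy_Schwarz[of "v p" "v q"] complex_Re_le_cmod v that order_trans by blast
    also have "\<dots> \<le> 1 * 1" using v that by (intro mult_mono) auto
    finally show ?thesis by simp
  qed
  have "ip H ?S ?S = (\<Sum>p\<in>K. ip H (v p) ?S)" using v S by (intro ip_sum_left)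
  also have "\<dots> = (\<Sum>p\<in>K. \<Sum>q\<in>K. ip H (v p) (v q))"
    using v by (intro sum.cong refl ip_sum_right)
  finally have "ip H ?S ?S = (\<Sum>p\<in>K. \<Sum>q\<in>K. ip H (v p) (v q))" .
  then have "(hnorm H ?S)\<^sup>2 = (\<Sum>(p, q)\<in>K \<times> K. Re (ip H (v p) (v q)))"
    using ip_self[OF S] by (simp add: complex_eq_iff sum.cartesian_product case_prod_unfold)
  also have "\<dots> = Re (ip H (v s) (v t)) + (\<Sum>(p, q)\<in>K \<times> K - {(s, t)}. Re (ip H (v p) (v q)))"
    using K st by (subst sum.remove[of _ "(s, t)"]) auto
  also have "(\<Sum>(p, q)\<in>K \<times> K - {(s, t)}. Re (ip H (v p) (v q))) \<le> (\<Sum>(p, q)\<in>K \<times> K - {(s, t)}. 1)"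
    by (intro sum_mono) (use le1 in auto)
  also have "(\<Sum>(p, q)\<in>K \<times> K - {(s, t)}. 1) = real (card (K \<times> K) - 1)"
    using K st by (simp add: case_prod_unfold card_Diff_singleton)
  also have "\<dots> = (real (card K))\<^sup>2 - 1"
  proof -
    have "1 \<le> card (K \<times> K)" using K st by (simp add: Suc_le_eq card_gt_0_iff) blast
    then show ?thesis by (simp add: of_nat_diff card_cartesian_product power2_eq_square)
  qed
  finally show ?thesis using avg by simp
qed

section \<open>Means on the group from squared moduli of vectors on the semigroup\<close>

lemma vector_mean_is_mean:
  fixes \<xi> :: "'a::inverse_semigroup \<Rightarrow> complex"
  assumes "(\<Sum>b\<in>A. (cmod (\<xi> b))\<^sup>2) = 1"
  shows "mean max_group_image (\<lambda>f. \<Sum>b\<in>A. (cmod (\<xi> b))\<^sup>2 * f (sigma_map b))"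
  unfolding mean_def
  using assms by (auto simp: distrib_left sum.distrib sum_distrib_left mult.left_commute intro!: sum_nonneg)

context
  fixes \<xi> :: "'a::inverse_semigroup \<Rightarrow> complex" and A :: "'a set"
  assumes A: "finite A" and \<xi>0: "\<And>b. b \<notin> A \<Longrightarrow> \<xi> b = 0"
begin

text \<open>\<open>left_regular s\<close> carries the coordinate at \<open>b\<close> to
  \<open>s * b\<close> if \<open>b\<close> is in the domain of \<open>s\<close> and discards it
  otherwise.\<close>

lemma left_regular_sum_reindex:
  fixes g :: "'a \<Rightarrow> real"
  assumes C: "finite C" "(\<lambda>b. s * b) ` A \<subseteq> C"
  shows "(\<Sum>c\<in>C. (cmod (left_regular s \<xi> c))\<^sup>2 * g c) =
    (\<Sum>b\<in>{b \<in> A. inv_star s * s * b = b}. (cmod (\<xi> b))\<^sup>2 * g (s * b))"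
proof -
  let ?A = "{b \<in> A. inv_star s * s * b = b}"
  have inj: "inj_on (\<lambda>b. s * b) ?A"
    by (rule inj_on_inverseI[of _ "\<lambda>c. inv_star s * c"]) (simp add: mult.assoc)
  have "(\<Sum>c\<in>C. (cmod (left_regular s \<xi> c))\<^sup>2 * g c) =
      (\<Sum>c\<in>(\<lambda>b. s * b) ` ?A. (cmod (left_regular s \<xi> c))\<^sup>2 * g c)"
  proof (intro sum.mono_neutral_right ballI)
    fix c assume c: "c \<in> C - (\<lambda>b. s * b) ` ?A"
    show "(cmod (left_regular s \<xi> c))\<^sup>2 * g c = 0"
    proof (cases "s * inv_star s * c = c")
      case True
      then have "c = s * (inv_star s * c)" by (simp add: mult.assoc)
      moreover have "inv_star s * s * (inv_star s * c) = inv_star s * c"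
        by (simp add: inv_star_inverse flip: mult.assoc)
      ultimately have "inv_star s * c \<notin> A" using c by blast
      then show ?thesis by (simp add: left_regular_eq \<xi>0)
    qed (simp add: left_regular_eq)
  qed (use C in auto)
  also have "\<dots> = (\<Sum>b\<in>?A. (cmod (left_regular s \<xi> (s * b)))\<^sup>2 * g (s * b))"
    by (rule sum.reindex[OF inj, simplified])
  also have "\<dots> = (\<Sum>b\<in>?A. (cmod (\<xi> b))\<^sup>2 * g (s * b))"
    by (intro sum.cong refl) (auto simp: left_regular_eq inv_star_inverse simp flip: mult.assoc)
  finally show ?thesis .
qed

text \<open>Translation in the group moves the mass at every \<open>b\<close>, whereas
  \<open>left_regular s\<close> loses the mass outside the domain of \<open>s\<close>. As
  \<open>left_regular s \<xi>\<close> almost has norm 1, the lost mass is at most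
  \<open>\<kappa>\<close>.\<close>

lemma translated_mean_near:
  assumes C: "finite C" "(\<lambda>b. s * b) ` A \<subseteq> C"
    and one: "(\<Sum>b\<in>A. (cmod (\<xi> b))\<^sup>2) = 1"
    and near: "1 - \<kappa> \<le> (\<Sum>c\<in>C. (cmod (left_regular s \<xi> c))\<^sup>2)"
    and B: "\<And>b. \<bar>g b\<bar> \<le> B"
  shows "\<bar>(\<Sum>b\<in>A. (cmod (\<xi> b))\<^sup>2 * g (s * b)) - (\<Sum>c\<in>C. (cmod (left_regular s \<xi> c))\<^sup>2 * g c)\<bar> \<le> B * \<kappa>"
proof -
  let ?A = "{b \<in> A. inv_star s * s * b = b}"
  have B0: "0 \<le> B" using B[of s] by linarith
  have split: "(\<Sum>b\<in>A. h b) = (\<Sum>b\<in>?A. h b) + (\<Sum>b\<in>A - ?A. h b)" for h :: "'a \<Rightarrow> real"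
    using A by (subst sum.subset_diff[of ?A A]) auto
  have "\<bar>\<Sum>b\<in>A - ?A. (cmod (\<xi> b))\<^sup>2 * g (s * b)\<bar> \<le> (\<Sum>b\<in>A - ?A. (cmod (\<xi> b))\<^sup>2 * B)"
    by (rule order_trans[OF sum_abs]) (intro sum_mono, simp add: abs_mult mult_left_mono B)
  also have "\<dots> = B * (\<Sum>b\<in>A - ?A. (cmod (\<xi> b))\<^sup>2)" by (simp add: sum_distrib_left mult.commute)
  also have "(\<Sum>b\<in>A - ?A. (cmod (\<xi> b))\<^sup>2) \<le> \<kappa>"
    using split[of "\<lambda>b. (cmod (\<xi> b))\<^sup>2"] one near left_regular_sum_reindex[OF C, of "\<lambda>_. 1"] by simp
  finally have "\<bar>\<Sum>b\<in>A - ?A. (cmod (\<xi> b))\<^sup>2 * g (s * b)\<bar> \<le> B * \<kappa>"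
    using B0 by (simp add: mult_left_mono)
  then show ?thesis
    unfolding left_regular_sum_reindex[OF C] split[of "\<lambda>b. (cmod (\<xi> b))\<^sup>2 * g (s * b)"] by simp
qed

end

text \<open>Each term is at most |v - w| (|v| + |w|), and Cauchy-Schwarz bounds the square of the
  sum by 2 q^2 times 4; the factor 3 rounds up the square root of 8.\<close>

lemma sum_power2_diff_le:
  fixes v w :: "'i \<Rightarrow> complex"
  assumes "(\<Sum>c\<in>C. (cmod (v c))\<^sup>2) \<le> 1" "(\<Sum>c\<in>C. (cmod (w c))\<^sup>2) \<le> 1"
    and d: "(\<Sum>c\<in>C. (cmod (v c - w c))\<^sup>2) \<le> 2 * q\<^sup>2" and q: "0 \<le> q"
  shows "(\<Sum>c\<in>C. \<bar>(cmod (v c))\<^sup>2 - (cmod (w c))\<^sup>2\<bar>) \<le> 3 * q"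
proof (rule power2_le_imp_le)
  have "\<bar>(cmod (v c))\<^sup>2 - (cmod (w c))\<^sup>2\<bar> \<le> cmod (v c - w c) * (cmod (v c) + cmod (w c))" for c
  proof -
    have "\<bar>(cmod (v c))\<^sup>2 - (cmod (w c))\<^sup>2\<bar> = \<bar>cmod (v c) - cmod (w c)\<bar> * (cmod (v c) + cmod (w c))"
      by (simp add: power2_eq_square square_diff_square_factored abs_mult)
    also have "\<dots> \<le> cmod (v c - w c) * (cmod (v c) + cmod (w c))"
      by (intro mult_right_mono norm_triangle_ineq3) simp
    finally show ?thesis .
  qed
  then have "(\<Sum>c\<in>C. \<bar>(cmod (v c))\<^sup>2 - (cmod (w c))\<^sup>2\<bar>)\<^sup>2 \<le>
      (\<Sum>c\<in>C. cmod (v c - w c) * (cmod (v c) + cmod (w c)))\<^sup>2"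
    by (intro power_mono sum_mono sum_nonneg) auto
  also have "\<dots> \<le> (\<Sum>c\<in>C. (cmod (v c - w c))\<^sup>2) * (\<Sum>c\<in>C. (cmod (v c) + cmod (w c))\<^sup>2)"
    by (rule Cauchy_Schwarz_ineq_sum)
  also have "\<dots> \<le> (2 * q\<^sup>2) * 4"
  proof (intro mult_mono d sum_nonneg)
    have "(cmod (v c) + cmod (w c))\<^sup>2 \<le> 2 * (cmod (v c))\<^sup>2 + 2 * (cmod (w c))\<^sup>2" for c
      using zero_le_power2[of "cmod (v c) - cmod (w c)"] by (simp add: power2_eq_square algebra_simps)
    then have "(\<Sum>c\<in>C. (cmod (v c) + cmod (w c))\<^sup>2) \<le> (\<Sum>c\<in>C. 2 * (cmod (v c))\<^sup>2 + 2 * (cmod (w c))\<^sup>2)"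
      by (intro sum_mono)
    also have "\<dots> \<le> 4" using assms by (simp add: sum.distrib flip: sum_distrib_left)
    finally show "(\<Sum>c\<in>C. (cmod (v c) + cmod (w c))\<^sup>2) \<le> 4" .
  qed auto
  also have "\<dots> \<le> (3 * q)\<^sup>2" by (simp add: power_mult_distrib)
  finally show "(\<Sum>c\<in>C. \<bar>(cmod (v c))\<^sup>2 - (cmod (w c))\<^sup>2\<bar>)\<^sup>2 \<le> (3 * q)\<^sup>2" .
qed (use q in simp)

lemma weak_containment_almost_fixed:
  assumes wc: "weak_containment TYPE('a::inverse_semigroup)" and K: "finite K" "K \<noteq> {}" and \<kappa>: "\<kappa> > 0"
  obtains A and \<xi> :: "'a::inverse_semigroup \<Rightarrow> complex" where "finite A" "\<And>b. b \<notin> A \<Longrightarrow> \<xi> b = 0"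
    "hnorm ell2 \<xi> = 1" "(real (card K))\<^sup>2 - \<kappa> \<le> (hnorm ell2 (\<Sum>s\<in>K. left_regular s \<xi>))\<^sup>2"
proof -
  interpret Lam: hilb_rep ell2 "left_regular :: 'a \<Rightarrow> _" by (rule hilb_rep_ell2)
  define n where "n = real (card K)"
  have n: "n \<ge> 1" using K by (simp add: n_def Suc_le_eq card_gt_0_iff)
  \<comment> \<open>The second bound makes the square of \<open>(1 - \<delta>) * n\<close> at least
    \<open>n\<^sup>2 - \<kappa>\<close>; the bound 1/2 keeps \<open>1 - \<delta>\<close>
    positive.\<close>
  define \<delta> where "\<delta> = min (1 / 2) (\<kappa> / (2 * n\<^sup>2))"
  have \<delta>: "0 < \<delta>" "\<delta> < 1" using \<kappa> n by (auto simp: \<delta>_def)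
  have "1 \<le> red_norm (average K)"
    by (rule weak_containment_no_gap[OF wc full_norm_average[OF K] triv_char_average[OF K]])
  then have "\<not> (\<forall>A x. finite A \<longrightarrow> (\<forall>b. b \<notin> A \<longrightarrow> x b = 0) \<longrightarrow>
      hnorm ell2 (Lam.ext (average K) x) \<le> (1 - \<delta>) * hnorm ell2 x)"
    using red_norm_le_finite_support[of "1 - \<delta>" "average K"] \<delta> by force
  then obtain A x where A: "finite A" and x0: "\<forall>b. b \<notin> A \<longrightarrow> x b = 0"
    and lt: "(1 - \<delta>) * hnorm ell2 x < hnorm ell2 (Lam.ext (average K) x)" by (auto simp: not_le)
  have x: "x \<in> carrier ell2" using hnorm_ell2_finite(1)[OF A] x0 by blast
  have "hnorm ell2 x \<noteq> 0"
  proof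
    assume "hnorm ell2 x = 0"
    then have "x = 0" using x by (simp add: Lam.hnorm_eq_0_iff)
    then have "Lam.ext (average K) x = 0" using Lam.bounded_op_zero[OF Lam.bounded_op_ext] by blast
    then show False using lt \<open>hnorm ell2 x = 0\<close> by (simp only: Lam.hnorm_zero)
  qed
  then have hx: "hnorm ell2 x > 0" using hnorm_ell2_power2(2)[OF x] by linarith
  define k where "k = complex_of_real (1 / hnorm ell2 x)"
  define \<xi> where "\<xi> = cscale ell2 k x"
  have \<xi>: "\<xi> \<in> carrier ell2" "hnorm ell2 \<xi> = 1"
    using x hx by (simp_all add: \<xi>_def k_def Lam.hnorm_scale norm_divide Lam.carrier_closed(3))
  have "hnorm ell2 (Lam.ext (average K) \<xi>) = hnorm ell2 (Lam.ext (average K) x) / hnorm ell2 x"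
    using x hx by (simp add: \<xi>_def k_def Lam.bounded_op_scale[OF Lam.bounded_op_ext] Lam.hnorm_scale norm_divide)
  then have "1 - \<delta> < hnorm ell2 (Lam.ext (average K) \<xi>)" using lt hx by (simp add: pos_less_divide_eq)
  moreover have "hnorm ell2 (Lam.ext (average K) \<xi>) = hnorm ell2 (\<Sum>s\<in>K. left_regular s \<xi>) / n"
    using \<xi> n by (simp add: Lam.ext_average Lam.hnorm_scale norm_divide Lam.carrier_closed(5) n_def)
  ultimately have "(1 - \<delta>) * n \<le> hnorm ell2 (\<Sum>s\<in>K. left_regular s \<xi>)" using n by (simp add: field_simps)
  then have "((1 - \<delta>) * n)\<^sup>2 \<le> (hnorm ell2 (\<Sum>s\<in>K. left_regular s \<xi>))\<^sup>2"
    using \<delta> n by (intro power_mono) auto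
  moreover have "n\<^sup>2 - \<kappa> \<le> ((1 - \<delta>) * n)\<^sup>2"
  proof -
    have "2 * n\<^sup>2 * \<delta> \<le> 2 * n\<^sup>2 * (\<kappa> / (2 * n\<^sup>2))" by (intro mult_left_mono) (auto simp: \<delta>_def)
    also have "\<dots> = \<kappa>" using n by simp
    finally have "2 * n\<^sup>2 * \<delta> \<le> \<kappa>" .
    moreover have "((1 - \<delta>) * n)\<^sup>2 = n\<^sup>2 - 2 * n\<^sup>2 * \<delta> + (n * \<delta>)\<^sup>2"
      by (simp add: power2_eq_square algebra_simps)
    ultimately show ?thesis using zero_le_power2[of "n * \<delta>"] by linarith
  qed
  ultimately have "(real (card K))\<^sup>2 - \<kappa> \<le> (hnorm ell2 (\<Sum>s\<in>K. left_regular s \<xi>))\<^sup>2"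
    by (simp add: n_def)
  moreover have "\<xi> b = 0" if "b \<notin> A" for b using x0 that by (simp add: \<xi>_def ell2_simps)
  ultimately show thesis using that[OF A] \<xi>(2) by blast
qed

theorem weak_containment_imp_amenable:
  assumes wc: "weak_containment TYPE('a::inverse_semigroup)"
  shows "amenable (max_group_image :: 'a set monoid)"
proof -
  interpret G: group "max_group_image :: 'a set monoid" by (rule group_max_group_image)
  interpret Lam: hilb_rep ell2 "left_regular :: 'a \<Rightarrow> _" by (rule hilb_rep_ell2)
  show ?thesis
  proof (rule G.amenable_if_approx_invariant)
    fix K :: "'a set set" and \<epsilon> :: real
    assume K: "finite K" "K \<subseteq> carrier max_group_image" and \<epsilon>: "\<epsilon> > 0"
    obtain L where L: "finite L" "K = sigma_map ` L"
      using finite_subset_image[OF K(1), of sigma_map UNIV] K(2) by (auto simp: carrier_max_group_image)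
    \<comment> \<open>The semigroup need not have an identity, so an arbitrary idempotent takes its
      place: its image in the group is 1, and \<open>left_regular s \<xi>\<close> is compared with
      \<open>left_regular e \<xi>\<close> instead of \<open>\<xi>\<close>.\<close>
    define e :: 'a where "e = inv_star undefined * undefined"
    have e: "idem e" unfolding e_def by (rule idem_star_mult)
    define K' where "K' = insert e L"
    have K': "finite K'" "K' \<noteq> {}" "e \<in> K'" "L \<subseteq> K'" using L by (auto simp: K'_def)
    \<comment> \<open>The 5 is 1 + 3 + 1: a loss of mass \<open>q\<^sup>2 \<le> q\<close> for each
      of \<open>s\<close> and \<open>e\<close>, and \<open>3 * q\<close> from
      \<open>sum_power2_diff_le\<close>.\<close>
    define q where "q = min 1 (\<epsilon> / 5)"
    have q: "0 < q" "q \<le> 1" "5 * q \<le> \<epsilon>" using \<epsilon> by (auto simp: q_def)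
    obtain A and \<xi> :: "'a \<Rightarrow> complex" where A: "finite A" and \<xi>0: "\<And>b. b \<notin> A \<Longrightarrow> \<xi> b = 0"
      and \<xi>1: "hnorm ell2 \<xi> = 1"
      and avg: "(real (card K'))\<^sup>2 - q\<^sup>2 \<le> (hnorm ell2 (\<Sum>s\<in>K'. left_regular s \<xi>))\<^sup>2"
      by (rule weak_containment_almost_fixed[OF wc K'(1,2), of "q\<^sup>2"]) (use q in auto)
    have \<xi>: "\<xi> \<in> carrier ell2" "(hnorm ell2 \<xi>)\<^sup>2 = (\<Sum>b\<in>A. (cmod (\<xi> b))\<^sup>2)"
      using hnorm_ell2_finite[of A \<xi>] A \<xi>0 by auto
    have one: "(\<Sum>b\<in>A. (cmod (\<xi> b))\<^sup>2) = 1" using \<xi>(2) \<xi>1 by simp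
    define C where "C = (\<Union>s\<in>K'. (\<lambda>b. s * b) ` A)"
    have C: "finite C" "\<And>s. s \<in> K' \<Longrightarrow> (\<lambda>b. s * b) ` A \<subseteq> C" using A K' by (auto simp: C_def)
    let ?v = "\<lambda>s. left_regular s \<xi>"
    have v: "?v s \<in> carrier ell2" "hnorm ell2 (?v s) \<le> 1" for s
      using \<xi>(1) Lam.rep_contraction[OF \<xi>(1), of s] \<xi>1 by auto
    have v0: "?v s c = 0" if "s \<in> K'" "c \<notin> C" for s c
    proof -
      have "inv_star s * c \<notin> A" if "s * inv_star s * c = c"
        using that C(2)[OF \<open>s \<in> K'\<close>] \<open>c \<notin> C\<close> by (metis image_subset_iff mult.assoc)
      then show ?thesis by (simp add: left_regular_eq \<xi>0)
    qed
    have v_sum: "(hnorm ell2 (?v s))\<^sup>2 = (\<Sum>c\<in>C. (cmod (?v s c))\<^sup>2)" if "s \<in> K'" for s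
      using hnorm_ell2_finite(2)[of C "?v s"] C(1) v0[OF that] by blast
    have ip: "1 - q\<^sup>2 \<le> Re (ip ell2 (?v s) (?v t))" if "s \<in> K'" "t \<in> K'" for s t
      by (rule Lam.inner_of_near_unit_average[of K' ?v]) (use v K' avg that in auto)
    have v_le: "(\<Sum>c\<in>C. (cmod (?v s c))\<^sup>2) \<le> 1" if "s \<in> K'" for s
      using v_sum[OF that] v(2)[of s] hnorm_ell2_power2(2)[OF v(1)] by (simp add: power_le_one flip: v_sum[OF that])
    have v_ge: "1 - q\<^sup>2 \<le> (\<Sum>c\<in>C. (cmod (?v s c))\<^sup>2)" if "s \<in> K'" for s
      using ip[OF that that] Lam.ip_self[OF v(1), of s] v_sum[OF that] by (simp del: of_real_power)
    have v_diff: "(\<Sum>c\<in>C. (cmod (?v s c - ?v e c))\<^sup>2) \<le> 2 * q\<^sup>2" if s: "s \<in> K'" for s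
    proof -
      have "(\<Sum>c\<in>C. (cmod (?v s c - ?v e c))\<^sup>2) = (hnorm ell2 (?v s - ?v e))\<^sup>2"
        using hnorm_ell2_finite(2)[OF C(1), of "?v s - ?v e"] v0[OF s] v0[OF K'(3)] by simp
      also have "\<dots> = (hnorm ell2 (?v s))\<^sup>2 - 2 * Re (ip ell2 (?v s) (?v e)) + (hnorm ell2 (?v e))\<^sup>2"
        by (rule Lam.hnorm_diff_power2[OF v(1) v(1)])
      also have "\<dots> \<le> 1 - 2 * (1 - q\<^sup>2) + 1"
        unfolding v_sum[OF s] v_sum[OF K'(3)]
        by (intro add_mono diff_mono mult_left_mono v_le s K'(3) ip) simp
      finally show ?thesis by simp
    qed
    define m where "m f = (\<Sum>b\<in>A. (cmod (\<xi> b))\<^sup>2 * f (sigma_map b))" for f :: "'a set \<Rightarrow> real"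
    have "mean max_group_image m" unfolding m_def[abs_def] by (rule vector_mean_is_mean[OF one])
    moreover have "\<bar>m (\<lambda>x. f (sigma_map s \<otimes>\<^bsub>max_group_image\<^esub> x)) - m f\<bar> \<le> \<epsilon> * B"
      if s: "s \<in> L" and B: "\<forall>x\<in>carrier max_group_image. \<bar>f x\<bar> \<le> B" for s f B
    proof -
      define g where "g b = f (sigma_map b)" for b
      have g: "\<bar>g b\<bar> \<le> B" for b using B by (simp add: g_def)
      have B0: "0 \<le> B" using g[of e] by linarith
      have s': "s \<in> K'" using s K' by blast
      let ?I = "\<lambda>s. \<Sum>c\<in>C. (cmod (?v s c))\<^sup>2 * g c"
      have near: "\<bar>(\<Sum>b\<in>A. (cmod (\<xi> b))\<^sup>2 * g (t * b)) - ?I t\<bar> \<le> B * q\<^sup>2" if "t \<in> K'" for t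
        by (rule translated_mean_near[OF A \<xi>0 C(1) C(2)[OF that] one v_ge[OF that] g])
      have "m (\<lambda>x. f (sigma_map s \<otimes>\<^bsub>max_group_image\<^esub> x)) = (\<Sum>b\<in>A. (cmod (\<xi> b))\<^sup>2 * g (s * b))"
        by (simp add: m_def g_def sigma_map_mult)
      moreover have "m f = (\<Sum>b\<in>A. (cmod (\<xi> b))\<^sup>2 * g (e * b))"
        by (simp add: m_def g_def sigma_map_idem_mult[OF e])
      moreover have "\<bar>?I s - ?I e\<bar> \<le> 3 * q * B"
      proof -
        have "\<bar>?I s - ?I e\<bar> \<le> (\<Sum>c\<in>C. \<bar>(cmod (?v s c))\<^sup>2 - (cmod (?v e c))\<^sup>2\<bar> * B)"
          unfolding sum_subtractf[symmetric] left_diff_distrib[symmetric]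
          by (rule order_trans[OF sum_abs]) (intro sum_mono, simp add: abs_mult mult_left_mono g)
        also have "\<dots> = (\<Sum>c\<in>C. \<bar>(cmod (?v s c))\<^sup>2 - (cmod (?v e c))\<^sup>2\<bar>) * B"
          by (simp add: sum_distrib_right)
        also have "\<dots> \<le> 3 * q * B"
          using sum_power2_diff_le[OF v_le[OF s'] v_le[OF K'(3)] v_diff[OF s']] q B0
          by (intro mult_right_mono) auto
        finally show ?thesis .
      qed
      ultimately have "\<bar>m (\<lambda>x. f (sigma_map s \<otimes>\<^bsub>max_group_image\<^esub> x)) - m f\<bar> \<le> B * q\<^sup>2 + 3 * q * B + B * q\<^sup>2"
        using near[OF s'] near[OF K'(3)] by linarith
      also have "\<dots> = (2 * q\<^sup>2 + 3 * q) * B" by (simp add: algebra_simps)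
      also have "q\<^sup>2 \<le> q" using q by (simp add: power2_eq_square mult_left_le)
      then have "(2 * q\<^sup>2 + 3 * q) * B \<le> \<epsilon> * B" using q B0 by (intro mult_right_mono) auto
      finally show ?thesis .
    qed
    ultimately show "\<exists>m. mean max_group_image m \<and> (\<forall>g\<in>K. \<forall>f B. (\<forall>x\<in>carrier max_group_image. \<bar>f x\<bar> \<le> B) \<longrightarrow>
        \<bar>m (\<lambda>x. f (g \<otimes>\<^bsub>max_group_image\<^esub> x)) - m f\<bar> \<le> \<epsilon> * B)"
      unfolding L(2) by blast
  qed
qed

subsection \<open>Commuting projections\<close>

context hilb_rep
begin

lemma ip_idem:
  assumes e: "idem e" and x: "x \<in> carrier H"
  shows "ip H (\<pi> e x) x = complex_of_real ((hnorm H (\<pi> e x))\<^sup>2)"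
proof -
  have "ip H (\<pi> e x) (\<pi> e x) = ip H (\<pi> (inv_star e) (\<pi> e x)) x"
    using rep_adj[of "\<pi> e x" x "inv_star e"] x by simp
  also have "\<dots> = ip H (\<pi> e x) x"
    using e x by (simp add: idem_inv_star idem_def flip: rep_mult)
  finally show ?thesis using ip_self[of "\<pi> e x"] x by simp
qed

lemma rep_diff: "x \<in> carrier H \<Longrightarrow> y \<in> carrier H \<Longrightarrow> \<pi> s (x - y) = \<pi> s x - \<pi> s y"
  by (rule bounded_op_diff[OF rep_bounded])

text \<open>Pythagoras for \<open>\<pi> f x\<close> and the projection \<open>\<pi> e\<close>, which
  commutes with \<open>\<pi> f\<close>.\<close>

lemma hnorm_idem_split:
  assumes e: "idem e" and f: "idem f" and x: "x \<in> carrier H"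
  shows "(hnorm H (\<pi> f x))\<^sup>2 = (hnorm H (\<pi> f (\<pi> e x)))\<^sup>2 + (hnorm H (\<pi> f (x - \<pi> e x)))\<^sup>2"
proof -
  let ?y = "\<pi> f x"
  have comm: "\<pi> f (\<pi> e x) = \<pi> e ?y"
    using x idem_commute[OF e f] by (simp flip: rep_mult)
  have "(hnorm H (?y - \<pi> e ?y))\<^sup>2 = (hnorm H ?y)\<^sup>2 - 2 * Re (ip H ?y (\<pi> e ?y)) + (hnorm H (\<pi> e ?y))\<^sup>2"
    using x by (intro hnorm_diff_power2) auto
  moreover have "Re (ip H ?y (\<pi> e ?y)) = (hnorm H (\<pi> e ?y))\<^sup>2"
    using ip_idem[OF e, of ?y] ip_cnj[of "\<pi> e ?y" ?y] x by (simp del: of_real_power)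
  ultimately show ?thesis using x comm by (simp add: rep_diff)
qed

text \<open>The vector \<open>x\<close> decomposes orthogonally into joint eigenvectors of the projections \<open>\<pi> (e i)\<close>,
  so that it suffices to bound the sums of the weights over principal filters. For the induction,
  \<open>c0\<close> is the total weight of the projections known to fix \<open>x\<close>, and \<open>m\<close> is the product of their
  indices, which does not exist as an element of the semigroup if there are none.\<close>

lemma projection_sum_le:
  fixes c :: "'i \<Rightarrow> real" and e :: "'i \<Rightarrow> 'a"
  assumes "finite I" "\<And>i. i \<in> I \<Longrightarrow> idem (e i)" "x \<in> carrier H"
    and "\<And>e0. m = Some e0 \<Longrightarrow> idem e0 \<and> \<pi> e0 x = x" "m = None \<Longrightarrow> c0 \<le> R"
    and "\<And>a. idem a \<Longrightarrow> \<forall>e0\<in>set_option m. e0 * a = a \<Longrightarrow> \<pi> a x \<noteq> 0 \<Longrightarrow>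
      c0 + (\<Sum>i\<in>{i\<in>I. e i * a = a}. c i) \<le> R"
  shows "c0 * (hnorm H x)\<^sup>2 + (\<Sum>i\<in>I. c i * (hnorm H (\<pi> (e i) x))\<^sup>2) \<le> R * (hnorm H x)\<^sup>2"
  using assms
proof (induction I arbitrary: x m c0 rule: finite_induct)
  case empty
  \<comment> \<open>If \<open>m\<close> is \<open>Some e0\<close>, then \<open>e0\<close> itself is
    an idempotent at which the weights are bounded, because it fixes the nonzero vector
    \<open>x\<close>.\<close>
  have "c0 \<le> R" if "x \<noteq> 0"
  proof (cases m)
    case (Some e0)
    then show ?thesis using empty.prems(3)[OF Some] empty.prems(5)[of e0] that by (simp add: idem_def)
  qed (use empty.prems in simp)
  then show ?case by (cases "x = 0") (simp_all add: mult_right_mono)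
next
  case (insert j I)
  have ej: "idem (e j)" and ei: "\<And>i. i \<in> I \<Longrightarrow> idem (e i)" using insert.prems(1) by auto
  note x = insert.prems(2) and m = insert.prems(3)
  define x1 where "x1 = \<pi> (e j) x"
  define x2 where "x2 = x - x1"
  have xc: "x1 \<in> carrier H" "x2 \<in> carrier H" using x by (auto simp: x1_def x2_def)
  have jx1: "\<pi> (e j) x1 = x1" using x ej by (simp add: x1_def idem_def flip: rep_mult)
  have mx1: "\<pi> e0 x1 = x1" if "m = Some e0" for e0
    using x idem_commute[OF _ ej, of e0] m[OF that] by (simp add: x1_def flip: rep_mult) (simp add: rep_mult)
  have mx2: "\<pi> e0 x2 = x2" if "m = Some e0" for e0
    using x xc mx1[OF that] m[OF that] by (simp add: x2_def rep_diff)
  have split: "(hnorm H (\<pi> f x))\<^sup>2 = (hnorm H (\<pi> f x1))\<^sup>2 + (hnorm H (\<pi> f x2))\<^sup>2" if "idem f" for f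
    unfolding x1_def x2_def by (rule hnorm_idem_split[OF ej that x])
  have split0: "(hnorm H x)\<^sup>2 = (hnorm H x1)\<^sup>2 + (hnorm H x2)\<^sup>2"
  proof -
    have "(hnorm H x2)\<^sup>2 = (hnorm H x)\<^sup>2 - 2 * Re (ip H x x1) + (hnorm H x1)\<^sup>2"
      unfolding x2_def using x xc by (intro hnorm_diff_power2)
    moreover have "Re (ip H x x1) = (hnorm H x1)\<^sup>2"
      using ip_idem[OF ej x] ip_cnj[of x1 x] x xc by (simp add: x1_def del: of_real_power)
    ultimately show ?thesis by simp
  qed
  have x2': "\<pi> (e j) x2 = 0" using x xc jx1 by (simp add: x2_def rep_diff) (simp add: x1_def)
  define m1 where "m1 = (case m of None \<Rightarrow> e j | Some e0 \<Rightarrow> e j * e0)"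
  \<comment> \<open>On the component fixed by \<open>\<pi> (e j)\<close> the weight
    \<open>c j\<close> joins \<open>c0\<close>, and the idempotents to be tested shrink to those
    below \<open>e j\<close>, whose filter sums already contain \<open>c j\<close>.\<close>
  have I1: "(c0 + c j) * (hnorm H x1)\<^sup>2 + (\<Sum>i\<in>I. c i * (hnorm H (\<pi> (e i) x1))\<^sup>2) \<le> R * (hnorm H x1)\<^sup>2"
  proof (rule insert.IH[where m = "Some m1"])
    show "idem e0 \<and> \<pi> e0 x1 = x1" if "Some m1 = Some e0" for e0
      using that ej m xc jx1 mx1 by (auto simp: m1_def rep_mult intro: idem_mult split: option.splits)
    fix a assume a: "idem a" "\<forall>e0\<in>set_option (Some m1). e0 * a = a" "\<pi> a x1 \<noteq> 0"
    have le: "e j * a = a" "\<forall>e0\<in>set_option m. e0 * a = a"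
      using a(2) m idem_mult_le_iff[OF ej] by (auto simp: m1_def split: option.splits)
    have "\<pi> a x1 = \<pi> a x"
      using x le idem_commute[OF a(1) ej] by (simp add: x1_def flip: rep_mult)
    then have "c0 + (\<Sum>i\<in>{i\<in>insert j I. e i * a = a}. c i) \<le> R"
      using insert.prems(5)[OF a(1) le(2)] a(3) by simp
    moreover have "{i\<in>insert j I. e i * a = a} = insert j {i\<in>I. e i * a = a}" using le by auto
    ultimately show "c0 + c j + (\<Sum>i\<in>{i\<in>I. e i * a = a}. c i) \<le> R"
      using insert.hyps by simp
  qed (use ei xc in auto)
  have I2: "c0 * (hnorm H x2)\<^sup>2 + (\<Sum>i\<in>I. c i * (hnorm H (\<pi> (e i) x2))\<^sup>2) \<le> R * (hnorm H x2)\<^sup>2"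
  proof (rule insert.IH[where m = m])
    fix a assume a: "idem a" "\<forall>e0\<in>set_option m. e0 * a = a" "\<pi> a x2 \<noteq> 0"
    \<comment> \<open>\<open>\<pi> (e j)\<close> kills \<open>x2\<close>, so an idempotent that does
      not kill \<open>x2\<close> cannot lie below \<open>e j\<close>, and \<open>c j\<close> is
      absent from its sum.\<close>
    have nle: "e j * a \<noteq> a"
    proof
      assume "e j * a = a"
      then have "\<pi> a x2 = \<pi> a (\<pi> (e j) x2)"
        using xc idem_commute[OF a(1) ej] by (simp flip: rep_mult)
      then show False using a(3) x2' by simp
    qed
    have "\<pi> a x2 = \<pi> a x - \<pi> (e j) (\<pi> a x)"
      using x xc idem_commute[OF a(1) ej] by (simp add: x2_def x1_def rep_diff flip: rep_mult)
    then have "\<pi> a x \<noteq> 0" using a(3) by auto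
    then have "c0 + (\<Sum>i\<in>{i\<in>insert j I. e i * a = a}. c i) \<le> R"
      using insert.prems(5)[OF a(1,2)] by simp
    moreover have "{i\<in>insert j I. e i * a = a} = {i\<in>I. e i * a = a}" using nle by auto
    ultimately show "c0 + (\<Sum>i\<in>{i\<in>I. e i * a = a}. c i) \<le> R" by simp
  qed (use m ei xc mx2 insert.prems(4) in auto)
  have "(\<Sum>i\<in>I. c i * (hnorm H (\<pi> (e i) x))\<^sup>2) =
      (\<Sum>i\<in>I. c i * (hnorm H (\<pi> (e i) x1))\<^sup>2) + (\<Sum>i\<in>I. c i * (hnorm H (\<pi> (e i) x2))\<^sup>2)"
    unfolding sum.distrib[symmetric] by (intro sum.cong refl) (simp add: split[OF ei] distrib_left)
  then show ?case
    using I1 I2 insert.hyps split0 by (simp add: algebra_simps flip: x1_def)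
qed

lemma hnorm_sum_power2:
  assumes "\<And>s. s \<in> K \<Longrightarrow> y s \<in> carrier H"
  shows "complex_of_real ((hnorm H (\<Sum>s\<in>K. cscale H (c s) (y s)))\<^sup>2) =
    (\<Sum>s\<in>K. \<Sum>t\<in>K. c s * cnj (c t) * ip H (y s) (y t))"
proof -
  let ?S = "\<Sum>s\<in>K. cscale H (c s) (y s)"
  have S: "?S \<in> carrier H" using assms by (intro carrier_closed(5,3))
  have "complex_of_real ((hnorm H ?S)\<^sup>2) = (\<Sum>s\<in>K. ip H (cscale H (c s) (y s)) ?S)"
    unfolding ip_self[OF S, symmetric] using assms S by (intro ip_sum_left carrier_closed(3))
  also have "\<dots> = (\<Sum>s\<in>K. \<Sum>t\<in>K. ip H (cscale H (c s) (y s)) (cscale H (c t) (y t)))"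
    using assms by (intro sum.cong refl ip_sum_right carrier_closed(3))
  also have "\<dots> = (\<Sum>s\<in>K. \<Sum>t\<in>K. c s * cnj (c t) * ip H (y s) (y t))"
    using assms by (intro sum.cong refl) (simp add: ip_scale_left ip_scale_right carrier_closed(3))
  finally show ?thesis .
qed

text \<open>For finite \<open>Z\<close> this is the squared norm of \<open>\<Sum>s. h s (\<pi> s x \<otimes> W s)\<close> in the tensor product
  of \<open>H\<close> with the square-summable functions on \<open>Z\<close>.\<close>

lemma sum_hnorm_weighted:
  fixes W :: "'a \<Rightarrow> 'g \<Rightarrow> real"
  assumes x: "x \<in> carrier H"
  shows "complex_of_real (\<Sum>g\<in>Z. (hnorm H (\<Sum>s\<in>K. cscale H (h s * of_real (W s g)) (\<pi> s x)))\<^sup>2) =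
    (\<Sum>s\<in>K. \<Sum>t\<in>K. h s * cnj (h t) * of_real (\<Sum>g\<in>Z. W s g * W t g) * ip H (\<pi> s x) (\<pi> t x))"
proof -
  have "complex_of_real (\<Sum>g\<in>Z. (hnorm H (\<Sum>s\<in>K. cscale H (h s * of_real (W s g)) (\<pi> s x)))\<^sup>2) =
      (\<Sum>g\<in>Z. \<Sum>s\<in>K. \<Sum>t\<in>K. h s * of_real (W s g) * cnj (h t * of_real (W t g)) * ip H (\<pi> s x) (\<pi> t x))"
    unfolding of_real_sum by (intro sum.cong refl hnorm_sum_power2 rep_closed x)
  also have "\<dots> = (\<Sum>s\<in>K. \<Sum>g\<in>Z. \<Sum>t\<in>K. h s * of_real (W s g) * cnj (h t * of_real (W t g)) * ip H (\<pi> s x) (\<pi> t x))"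
    by (rule sum.swap)
  also have "\<dots> = (\<Sum>s\<in>K. \<Sum>t\<in>K. \<Sum>g\<in>Z. h s * of_real (W s g) * cnj (h t * of_real (W t g)) * ip H (\<pi> s x) (\<pi> t x))"
    by (intro sum.cong refl) (rule sum.swap)
  also have "\<dots> = (\<Sum>s\<in>K. \<Sum>t\<in>K. h s * cnj (h t) * of_real (\<Sum>g\<in>Z. W s g * W t g) * ip H (\<pi> s x) (\<pi> t x))"
    by (intro sum.cong refl) (simp add: sum_distrib_left sum_distrib_right mult_ac)
  finally show ?thesis .
qed

end

subsection \<open>Coefficients supported on idempotents\<close>

lemma ip_basis_vec: "ip ell2 (basis_vec b) (basis_vec c) = (if b = c then 1 else 0)"
proof -
  have "ip ell2 (basis_vec b) (basis_vec c) = (\<Sum>\<^sub>\<infinity>i\<in>{b}. basis_vec b i * cnj (basis_vec c i))"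
    unfolding ell2_simps by (rule infsum_cong_neutral) (auto simp: basis_vec_def)
  then show ?thesis by (simp add: basis_vec_def)
qed

lemma basis_vec_ell2: "basis_vec b \<in> carrier ell2" "hnorm ell2 (basis_vec b) = 1"
  using hnorm_ell2_finite(1)[of "{b}" "basis_vec b"] ip_basis_vec[of b b]
  by (auto simp: basis_vec_def hnorm_def)

text \<open>The left side is the squared norm of
  \<open>rep_ext ell2 left_regular h (basis_vec a)\<close>. The vectors
  \<open>left_regular s (basis_vec a)\<close> are basis vectors or 0, and
  \<open>same_image_iff\<close> decides which nonzero ones coincide.\<close>

lemma red_norm_filter_sum:
  fixes h :: "'a::inverse_semigroup semigroup_algebra"
  assumes E: "E_unitary TYPE('a)" and a: "idem a"
  defines "K \<equiv> Poly_Mapping.keys h"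
  shows "(\<Sum>(s, t)\<in>{(s, t)\<in>K \<times> K. idem (inv_star t * s) \<and> inv_star t * s * a = a}.
    Re (Poly_Mapping.lookup h s * cnj (Poly_Mapping.lookup h t))) \<le> (red_norm h)\<^sup>2"
proof -
  interpret Lam: hilb_rep ell2 "left_regular :: 'a \<Rightarrow> _" by (rule hilb_rep_ell2)
  let ?h = "Poly_Mapping.lookup h"
  let ?d = "basis_vec a :: 'a \<Rightarrow> complex"
  have d: "?d \<in> carrier ell2" "hnorm ell2 ?d = 1" by (rule basis_vec_ell2)+
  have ip0: "ip ell2 (\<lambda>_. 0) y = 0" "ip ell2 y (\<lambda>_. 0) = 0" for y :: "'a \<Rightarrow> complex"
    by (simp_all add: ell2_simps)
  have ip: "ip ell2 (left_regular s ?d) (left_regular t ?d) =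
      (if idem (inv_star t * s) \<and> inv_star t * s * a = a then 1 else 0)" for s t
    unfolding same_image_iff[OF E a, symmetric] left_regular_basis by (simp add: ip_basis_vec ip0)
  have "Lam.ext h ?d = (\<Sum>s\<in>K. cscale ell2 (?h s) (left_regular s ?d))"
    using d by (simp add: rep_ext_def K_def)
  then have "complex_of_real ((hnorm ell2 (Lam.ext h ?d))\<^sup>2) =
      (\<Sum>s\<in>K. \<Sum>t\<in>K. ?h s * cnj (?h t) * ip ell2 (left_regular s ?d) (left_regular t ?d))"
    using Lam.hnorm_sum_power2[of K "\<lambda>s. left_regular s ?d" ?h] d by simp
  also have "\<dots> = (\<Sum>(s, t)\<in>K \<times> K. if idem (inv_star t * s) \<and> inv_star t * s * a = a then ?h s * cnj (?h t) else 0)"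
    unfolding sum.cartesian_product ip by (intro sum.cong refl) auto
  also have "\<dots> = (\<Sum>(s, t)\<in>{(s, t)\<in>K \<times> K. idem (inv_star t * s) \<and> inv_star t * s * a = a}. ?h s * cnj (?h t))"
    by (intro sum.mono_neutral_cong_right) (auto simp: K_def split: if_splits)
  finally have "Re (complex_of_real ((hnorm ell2 (Lam.ext h ?d))\<^sup>2)) =
      Re (\<Sum>(s, t)\<in>{(s, t)\<in>K \<times> K. idem (inv_star t * s) \<and> inv_star t * s * a = a}. ?h s * cnj (?h t))"
    by (rule arg_cong)
  then have "(\<Sum>(s, t)\<in>{(s, t)\<in>K \<times> K. idem (inv_star t * s) \<and> inv_star t * s * a = a}.
      Re (?h s * cnj (?h t))) = (hnorm ell2 (Lam.ext h ?d))\<^sup>2"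
    by (simp add: case_prod_unfold del: of_real_power)
  also have "\<dots> \<le> (red_norm h)\<^sup>2"
    using Lam.ext_norm_bound[OF d(1), of h] d by (intro power_mono) auto
  finally show ?thesis .
qed

text \<open>This is the domination by the left regular representation of the functional that keeps
  \<open>ip H (\<pi> e x) x\<close> at idempotents and is 0 elsewhere. Expanding the squares leaves
  the pairs in a common fibre of \<open>sigma_map\<close>, for which \<open>inv_star t * s\<close>
  is idempotent; the weights of these projections are bounded by \<open>projection_sum_le\<close>
  together with \<open>red_norm_filter_sum\<close>.\<close>

lemma (in hilb_rep) sum_fibres_le_red_norm:
  fixes h :: "'a semigroup_algebra"
  assumes E: "E_unitary TYPE('a)" and x: "x \<in> carrier H"
  defines "K \<equiv> Poly_Mapping.keys h"
  shows "(\<Sum>g\<in>sigma_map ` K. (hnorm H (\<Sum>s\<in>K.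
    cscale H (Poly_Mapping.lookup h s * of_real (if sigma_map s = g then 1 else 0)) (\<pi> s x)))\<^sup>2)
    \<le> (red_norm h)\<^sup>2 * (hnorm H x)\<^sup>2" (is "?L \<le> _")
proof -
  let ?h = "Poly_Mapping.lookup h"
  let ?P = "{(s, t)\<in>K \<times> K. idem (inv_star t * s)}"
  have K: "finite K" by (simp add: K_def)
  have W: "(\<Sum>g\<in>sigma_map ` K. (if sigma_map s = g then 1 else 0) * (if sigma_map t = g then 1 else 0)) =
      (if idem (inv_star t * s) then 1 else (0::real))" if "s \<in> K" for s t
  proof -
    have "(\<Sum>g\<in>sigma_map ` K. (if sigma_map s = g then 1 else 0) * (if sigma_map t = g then 1 else 0)) =
        (\<Sum>g\<in>sigma_map ` K. if sigma_map s = g then (if sigma_map t = g then 1 else (0::real)) else 0)"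
      by (intro sum.cong refl) simp
    also have "\<dots> = (if sigma_map t = sigma_map s then 1 else 0)" using K that by simp
    finally show ?thesis using sigma_map_eq_iff_idem[OF E, of s t] by (simp add: eq_commute)
  qed
  have ip: "ip H (\<pi> s x) (\<pi> t x) = complex_of_real ((hnorm H (\<pi> (inv_star t * s) x))\<^sup>2)"
    if "idem (inv_star t * s)" for s t
    using rep_adj[of "\<pi> s x" x "inv_star t"] ip_idem[OF that x] x by (simp add: rep_mult)
  have "complex_of_real ?L = (\<Sum>s\<in>K. \<Sum>t\<in>K. ?h s * cnj (?h t) *
      of_real (if idem (inv_star t * s) then 1 else 0) * ip H (\<pi> s x) (\<pi> t x))"
    unfolding sum_hnorm_weighted[OF x] by (intro sum.cong refl) (simp only: W)
  also have "\<dots> = (\<Sum>(s, t)\<in>K \<times> K. if idem (inv_star t * s) then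
      ?h s * cnj (?h t) * of_real ((hnorm H (\<pi> (inv_star t * s) x))\<^sup>2) else 0)"
    unfolding sum.cartesian_product by (intro sum.cong refl) (auto simp: ip simp del: of_real_power)
  also have "\<dots> = (\<Sum>(s, t)\<in>?P. ?h s * cnj (?h t) * of_real ((hnorm H (\<pi> (inv_star t * s) x))\<^sup>2))"
    using K by (intro sum.mono_neutral_cong_right) (auto split: if_splits)
  finally have "Re (complex_of_real ?L) = Re (\<Sum>(s, t)\<in>?P. ?h s * cnj (?h t) * of_real ((hnorm H (\<pi> (inv_star t * s) x))\<^sup>2))"
    by (rule arg_cong)
  then have "?L = (\<Sum>p\<in>?P. Re (?h (fst p) * cnj (?h (snd p))) * (hnorm H (\<pi> (inv_star (snd p) * fst p) x))\<^sup>2)"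
    by (simp add: case_prod_unfold del: of_real_power of_real_sum)
  also have "\<dots> = 0 * (hnorm H x)\<^sup>2 + \<dots>" by simp
  also have "\<dots> \<le> (red_norm h)\<^sup>2 * (hnorm H x)\<^sup>2"
  proof (rule projection_sum_le[where m = None])
    fix a :: 'a assume a: "idem a"
    have "{p \<in> ?P. inv_star (snd p) * fst p * a = a} =
        {(s, t)\<in>K \<times> K. idem (inv_star t * s) \<and> inv_star t * s * a = a}" by auto
    then show "0 + (\<Sum>p\<in>{p \<in> ?P. inv_star (snd p) * fst p * a = a}. Re (?h (fst p) * cnj (?h (snd p)))) \<le> (red_norm h)\<^sup>2"
      using red_norm_filter_sum[OF E a, of h] by (simp add: K_def case_prod_unfold)
  qed (use K x finite_subset[of ?P "K \<times> K"] in auto)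
  finally show ?thesis .
qed

subsection \<open>Amenability and weak containment\<close>

text \<open>Iterated squaring removes the constant \<open>C\<close>.\<close>

lemma power_trick:
  fixes p :: "nat \<Rightarrow> real"
  assumes p: "\<And>n. 0 \<le> p n" and D: "0 \<le> D" and r: "0 \<le> r"
    and sq: "\<And>n. (p n)\<^sup>2 \<le> D * p (Suc n)" and le: "\<And>n. p n \<le> C * r ^ 2 ^ n"
  shows "p 0 \<le> D * r"
proof (cases "D = 0")
  case True
  then show ?thesis using sq[of 0] p[of 0] by simp
next
  case False
  then have D: "D > 0" using D by simp
  have it: "(p 0 / D) ^ 2 ^ n \<le> p n / D" for n
  proof (induction n)
    case (Suc n)
    have "(p 0 / D) ^ 2 ^ Suc n = ((p 0 / D) ^ 2 ^ n)\<^sup>2" by (simp add: mult.commute flip: power_mult)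
    also have "\<dots> \<le> (p n / D)\<^sup>2" using Suc p D by (intro power_mono) auto
    also have "\<dots> \<le> D * p (Suc n) / D\<^sup>2" using sq[of n] D by (simp add: power_divide divide_right_mono)
    also have "\<dots> = p (Suc n) / D" using D by (simp add: power2_eq_square)
    finally show ?case .
  qed simp
  show ?thesis
  proof (cases "r = 0")
    case True
    then show ?thesis using le[of 0] p[of 0] by simp
  next
    case False
    then have r: "r > 0" using r by simp
    \<comment> \<open>All the powers \<open>z ^ 2 ^ n\<close> are bounded by \<open>C / D\<close>,
      which forces \<open>z \<le> 1\<close>.\<close>
    define z where "z = p 0 / D / r"
    have "z \<le> 1"
    proof (rule ccontr)
      assume "\<not> z \<le> 1"
      then have z: "z > 1" by simp
      obtain n where n: "C / D < z ^ n" using real_arch_pow[OF z] by blast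
      have "z ^ n \<le> z ^ 2 ^ n" using z less_exp[of n] by (intro power_increasing) auto
      also have "\<dots> = (p 0 / D) ^ 2 ^ n / r ^ 2 ^ n" by (simp add: z_def power_divide power_mult_distrib)
      also have "\<dots> \<le> p n / D / r ^ 2 ^ n" using it[of n] r by (intro divide_right_mono) auto
      also have "\<dots> \<le> C * r ^ 2 ^ n / D / r ^ 2 ^ n"
        using le[of n] D r by (intro divide_right_mono) auto
      also have "\<dots> = C / D" using r by simp
      finally show False using n by simp
    qed
    then show ?thesis using r D by (simp add: z_def field_simps)
  qed
qed

lemma power2_sum_mult_le:
  fixes a b :: "'i \<Rightarrow> real"
  shows "(\<Sum>i\<in>I. \<bar>a i\<bar> * b i)\<^sup>2 \<le> (\<Sum>i\<in>I. (a i)\<^sup>2) * (\<Sum>i\<in>I. (b i)\<^sup>2)"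
  using Cauchy_Schwarz_ineq_sum[of "\<lambda>i. \<bar>a i\<bar>" b I] by simp

text \<open>The setting of the vector x \<otimes> \<xi>, acted on by the tensor product of \<pi>
  with the left regular representation of the group composed with \<open>sigma_map\<close>. Here
  \<open>W s\<close> is the translate of \<xi> by the image of \<open>s\<close>, \<open>k s\<close>
  its inner product with \<xi>, \<open>\<psi>\<close> the functional given by the vector x \<otimes>
  \<xi>, \<open>v h g\<close> the component at \<open>g\<close> of \<open>h\<close> applied to this
  vector, and \<open>V h\<close> the squared norm of the result.\<close>

locale twisted_state = hilb_rep H \<pi>
  for H :: "('h::ab_group_add, 'm) hilbert_scheme" and \<pi> :: "'a::inverse_semigroup \<Rightarrow> 'h \<Rightarrow> 'h" +
  fixes x :: 'h and \<xi> :: "'a set \<Rightarrow> real" and Y :: "'a set set"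
  assumes E: "E_unitary TYPE('a)" and x: "x \<in> carrier H"
    and Y: "finite Y" "Y \<subseteq> carrier max_group_image"
    and \<xi>0: "\<And>y. y \<notin> Y \<Longrightarrow> \<xi> y = 0" and \<xi>1: "(\<Sum>y\<in>Y. (\<xi> y)\<^sup>2) = 1"
begin

sublocale G: group "max_group_image :: 'a set monoid"
  by (rule group_max_group_image)

definition W :: "'a \<Rightarrow> 'a set \<Rightarrow> real"
  where "W s g = \<xi> (inv\<^bsub>max_group_image\<^esub> (sigma_map s) \<otimes>\<^bsub>max_group_image\<^esub> g)"

definition k :: "'a \<Rightarrow> real"
  where "k s = (\<Sum>y\<in>Y. W s y * \<xi> y)"

definition \<psi> :: "'a semigroup_algebra \<Rightarrow> complex"
  where "\<psi> = sa_sum (\<lambda>s c. c * (of_real (k s) * ip H (\<pi> s x) x))"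

text \<open>Large enough to contain \<open>Y\<close> and the part in the group of the support of
  \<open>W t\<close> for every \<open>t\<close> in the support of \<open>h\<close>.\<close>

definition Z :: "'a semigroup_algebra \<Rightarrow> 'a set set"
  where "Z h = Y \<union> (\<Union>t\<in>Poly_Mapping.keys h. (\<lambda>y. sigma_map t \<otimes>\<^bsub>max_group_image\<^esub> y) ` Y)"

definition v :: "'a semigroup_algebra \<Rightarrow> 'a set \<Rightarrow> 'h"
  where "v h g = (\<Sum>s\<in>Poly_Mapping.keys h. cscale H (Poly_Mapping.lookup h s * of_real (W s g)) (\<pi> s x))"

definition V :: "'a semigroup_algebra \<Rightarrow> real"
  where "V h = (\<Sum>g\<in>Z h. (hnorm H (v h g))\<^sup>2)"

lemma Z: "finite (Z h)" "Z h \<subseteq> carrier max_group_image" "Y \<subseteq> Z h"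
  using Y by (auto simp: Z_def)

lemma v_closed: "v h g \<in> carrier H"
  unfolding v_def by (intro carrier_closed(5,3) rep_closed x)

lemma V_nonneg: "0 \<le> V h"
  unfolding V_def by (intro sum_nonneg) simp

text \<open>Unitarity of the left regular representation of the group: translating both vectors by
  the image of \<open>t\<close> preserves their inner product.\<close>

lemma k_mult:
  assumes t: "t \<in> Poly_Mapping.keys h"
  shows "k (inv_star t * s) = (\<Sum>g\<in>Z h. W s g * W t g)"
proof -
  let ?m = "\<lambda>y. sigma_map t \<otimes>\<^bsub>max_group_image\<^esub> y"
  have "(\<Sum>g\<in>Z h. W s g * W t g) = (\<Sum>g\<in>Z h. W t g * W s g)" by (simp add: mult.commute)
  also have "\<dots> = (\<Sum>y\<in>Y. \<xi> y * W s (?m y))"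
    unfolding W_def[of t] using Z Y \<xi>0 t by (intro G.sum_translate) (auto simp: Z_def)
  also have "\<dots> = (\<Sum>y\<in>Y. W (inv_star t * s) y * \<xi> y)"
  proof (intro sum.cong refl)
    fix y assume "y \<in> Y"
    then have y: "y \<in> carrier max_group_image" using Y by blast
    then show "\<xi> y * W s (?m y) = W (inv_star t * s) y * \<xi> y"
      by (simp add: W_def sigma_map_inv_star G.inv_mult_group G.m_assoc flip: sigma_map_mult)
  qed
  finally show ?thesis by (simp add: k_def)
qed

lemma \<psi>_star_mult_expand:
  "\<psi> (sa_mult (sa_star h) h) = (\<Sum>s\<in>Poly_Mapping.keys h. \<Sum>t\<in>Poly_Mapping.keys h.
    Poly_Mapping.lookup h s * cnj (Poly_Mapping.lookup h t) * of_real (k (inv_star t * s)) * ip H (\<pi> s x) (\<pi> t x))"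
proof -
  let ?F = "\<lambda>s c. c * (of_real (k s) * ip H (\<pi> s x) x)"
  have "\<psi> (sa_mult (sa_star h) h) = sa_sum (\<lambda>t c. sa_sum (\<lambda>s d. ?F (t * s) (c * d)) h) (sa_star h)"
    unfolding \<psi>_def by (rule sa_sum_mult) (simp_all add: distrib_right)
  also have "\<dots> = sa_sum (\<lambda>t c. sa_sum (\<lambda>s d. ?F (inv_star t * s) (cnj c * d)) h) h"
    by (rule sa_sum_star) (simp_all add: sa_sum_def distrib_right sum.distrib)
  also have "\<dots> = (\<Sum>t\<in>Poly_Mapping.keys h. \<Sum>s\<in>Poly_Mapping.keys h.
      Poly_Mapping.lookup h s * cnj (Poly_Mapping.lookup h t) * of_real (k (inv_star t * s)) * ip H (\<pi> s x) (\<pi> t x))"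
    unfolding sa_sum_def using x rep_adj[of "\<pi> _ x" x "inv_star _"]
    by (intro sum.cong refl) (simp add: rep_mult)
  finally show ?thesis by (rule trans) (rule sum.swap)
qed

lemma \<psi>_star_mult: "\<psi> (sa_mult (sa_star h) h) = complex_of_real (V h)"
proof -
  have "complex_of_real (V h) = (\<Sum>s\<in>Poly_Mapping.keys h. \<Sum>t\<in>Poly_Mapping.keys h.
      Poly_Mapping.lookup h s * cnj (Poly_Mapping.lookup h t) * of_real (\<Sum>g\<in>Z h. W s g * W t g) *
      ip H (\<pi> s x) (\<pi> t x))"
    unfolding V_def v_def by (rule sum_hnorm_weighted[OF x])
  also have "\<dots> = \<psi> (sa_mult (sa_star h) h)"
    unfolding \<psi>_star_mult_expand by (intro sum.cong refl) (simp only: k_mult)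
  finally show ?thesis ..
qed

text \<open>\<open>\<psi> h\<close> is the inner product of the family \<open>v h\<close> with x
  \<otimes> \<xi>, whose norm is \<open>hnorm H x\<close>; only the components at points of
  \<open>Y\<close> meet \<xi>.\<close>

lemma \<psi>_Cauchy_Schwarz: "(cmod (\<psi> h))\<^sup>2 \<le> (hnorm H x)\<^sup>2 * V h"
proof -
  let ?h = "Poly_Mapping.lookup h" and ?K = "Poly_Mapping.keys h"
  have "\<psi> h = (\<Sum>s\<in>?K. \<Sum>y\<in>Y. of_real (\<xi> y) * (?h s * of_real (W s y) * ip H (\<pi> s x) x))"
    by (simp add: \<psi>_def sa_sum_def k_def sum_distrib_left sum_distrib_right mult_ac)
  also have "\<dots> = (\<Sum>y\<in>Y. of_real (\<xi> y) * (\<Sum>s\<in>?K. ?h s * of_real (W s y) * ip H (\<pi> s x) x))"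
    by (subst sum.swap) (simp add: sum_distrib_left)
  also have "\<dots> = (\<Sum>y\<in>Y. of_real (\<xi> y) * ip H (v h y) x)"
    using x by (simp add: v_def ip_sum_left ip_scale_left carrier_closed(3))
  finally have "cmod (\<psi> h) \<le> (\<Sum>y\<in>Y. cmod (of_real (\<xi> y) * ip H (v h y) x))"
    by (simp only: norm_sum)
  also have "\<dots> \<le> (\<Sum>y\<in>Y. \<bar>\<xi> y\<bar> * (hnorm H (v h y) * hnorm H x))"
    by (intro sum_mono) (simp add: norm_mult mult_left_mono Cauchy_Schwarz v_closed x)
  finally have "(cmod (\<psi> h))\<^sup>2 \<le> (\<Sum>y\<in>Y. \<bar>\<xi> y\<bar> * (hnorm H (v h y) * hnorm H x))\<^sup>2"
    by (intro power_mono) auto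
  also have "\<dots> \<le> (\<Sum>y\<in>Y. (\<xi> y)\<^sup>2) * (\<Sum>y\<in>Y. (hnorm H (v h y) * hnorm H x)\<^sup>2)"
    by (rule power2_sum_mult_le)
  also have "\<dots> = (hnorm H x)\<^sup>2 * (\<Sum>y\<in>Y. (hnorm H (v h y))\<^sup>2)"
    by (simp add: \<xi>1 power_mult_distrib sum_distrib_left mult.commute)
  also have "\<dots> \<le> (hnorm H x)\<^sup>2 * V h"
    unfolding V_def using Z by (intro mult_left_mono sum_mono2) auto
  finally show ?thesis .
qed

text \<open>With \<xi> expanded in point masses, \<open>v h\<close> becomes a combination of
  \<open>card Y\<close> right translates of the function \<open>q\<close>, which collects
  \<open>h\<close> along the fibres of \<open>sigma_map\<close>. Each translate is bounded by
  \<open>sum_fibres_le_red_norm\<close>, and Cauchy-Schwarz costs the factor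
  \<open>card Y\<close>.\<close>

lemma V_le: "V h \<le> real (card Y) * (hnorm H x)\<^sup>2 * (red_norm h)\<^sup>2"
proof -
  let ?h = "Poly_Mapping.lookup h" and ?K = "Poly_Mapping.keys h"
  let ?G = "max_group_image :: 'a set monoid"
  define q where "q g = (\<Sum>s\<in>?K. cscale H (?h s * of_real (if sigma_map s = g then 1 else 0)) (\<pi> s x))" for g
  have qc: "q g \<in> carrier H" for g unfolding q_def by (intro carrier_closed(5,3) rep_closed x)
  have q0: "q g = 0" if "g \<notin> sigma_map ` ?K" for g
    unfolding q_def using that by (intro sum.neutral) auto
  have v_eq: "v h g = (\<Sum>y\<in>Y. cscale H (of_real (\<xi> y)) (q (g \<otimes>\<^bsub>?G\<^esub> inv\<^bsub>?G\<^esub> y)))" if g: "g \<in> carrier ?G" for g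
  proof -
    have "W s g = (\<Sum>y\<in>Y. \<xi> y * (if sigma_map s = g \<otimes>\<^bsub>?G\<^esub> inv\<^bsub>?G\<^esub> y then 1 else 0))" for s
    proof -
      have "sigma_map s = g \<otimes>\<^bsub>?G\<^esub> inv\<^bsub>?G\<^esub> y \<longleftrightarrow> y = inv\<^bsub>?G\<^esub> (sigma_map s) \<otimes>\<^bsub>?G\<^esub> g" if "y \<in> Y" for y
      proof -
        have y: "y \<in> carrier ?G" using that Y by blast
        show ?thesis
          using G.inv_solve_right[of "sigma_map s" g y] G.inv_solve_left[of y "sigma_map s" g] y g by auto
      qed
      then have "(\<Sum>y\<in>Y. \<xi> y * (if sigma_map s = g \<otimes>\<^bsub>?G\<^esub> inv\<^bsub>?G\<^esub> y then 1 else 0)) =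
          (\<Sum>y\<in>Y. if y = inv\<^bsub>?G\<^esub> (sigma_map s) \<otimes>\<^bsub>?G\<^esub> g then \<xi> y else 0)"
        by (intro sum.cong refl) simp
      then show ?thesis using Y by (simp add: W_def \<xi>0)
    qed
    then have "v h g = (\<Sum>s\<in>?K. \<Sum>y\<in>Y. cscale H (of_real (\<xi> y))
        (cscale H (?h s * of_real (if sigma_map s = g \<otimes>\<^bsub>?G\<^esub> inv\<^bsub>?G\<^esub> y then 1 else 0)) (\<pi> s x)))"
      unfolding v_def
      by (intro sum.cong refl) (simp add: sum_distrib_left scale_sum_left mult_ac)
    also have "\<dots> = (\<Sum>y\<in>Y. cscale H (of_real (\<xi> y)) (q (g \<otimes>\<^bsub>?G\<^esub> inv\<^bsub>?G\<^esub> y)))"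
      unfolding q_def scale_sum_right by (rule sum.swap)
    finally show ?thesis .
  qed
  have "(hnorm H (v h g))\<^sup>2 \<le> (\<Sum>y\<in>Y. (hnorm H (q (g \<otimes>\<^bsub>?G\<^esub> inv\<^bsub>?G\<^esub> y)))\<^sup>2)" if g: "g \<in> carrier ?G" for g
  proof -
    have "hnorm H (v h g) \<le> (\<Sum>y\<in>Y. \<bar>\<xi> y\<bar> * hnorm H (q (g \<otimes>\<^bsub>?G\<^esub> inv\<^bsub>?G\<^esub> y)))"
      unfolding v_eq[OF g]
      by (rule order_trans[OF hnorm_sum]) (simp_all add: carrier_closed(3) qc hnorm_scale)
    then have "(hnorm H (v h g))\<^sup>2 \<le> (\<Sum>y\<in>Y. \<bar>\<xi> y\<bar> * hnorm H (q (g \<otimes>\<^bsub>?G\<^esub> inv\<^bsub>?G\<^esub> y)))\<^sup>2"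
      by (intro power_mono hnorm_nonneg v_closed)
    also have "\<dots> \<le> (\<Sum>y\<in>Y. (\<xi> y)\<^sup>2) * (\<Sum>y\<in>Y. (hnorm H (q (g \<otimes>\<^bsub>?G\<^esub> inv\<^bsub>?G\<^esub> y)))\<^sup>2)"
      by (rule power2_sum_mult_le)
    finally show ?thesis by (simp add: \<xi>1)
  qed
  then have "V h \<le> (\<Sum>g\<in>Z h. \<Sum>y\<in>Y. (hnorm H (q (g \<otimes>\<^bsub>?G\<^esub> inv\<^bsub>?G\<^esub> y)))\<^sup>2)"
    unfolding V_def using Z(2) by (intro sum_mono) blast
  also have "\<dots> = (\<Sum>y\<in>Y. \<Sum>g\<in>Z h. (hnorm H (q (g \<otimes>\<^bsub>?G\<^esub> inv\<^bsub>?G\<^esub> y)))\<^sup>2)" by (rule sum.swap)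
  also have "\<dots> \<le> (\<Sum>y\<in>Y. (red_norm h)\<^sup>2 * (hnorm H x)\<^sup>2)"
  proof (rule sum_mono)
    fix y assume "y \<in> Y"
    then have y: "y \<in> carrier ?G" using Y by blast
    let ?r = "\<lambda>g. g \<otimes>\<^bsub>?G\<^esub> inv\<^bsub>?G\<^esub> y"
    have inj: "inj_on ?r (Z h)"
      using Z(2) y by (auto simp: inj_on_def subset_iff)
    have "(\<Sum>g\<in>Z h. (hnorm H (q (?r g)))\<^sup>2) = (\<Sum>g\<in>?r ` Z h. (hnorm H (q g))\<^sup>2)"
      by (simp add: sum.reindex[OF inj])
    also have "\<dots> = (\<Sum>g\<in>?r ` Z h \<inter> sigma_map ` ?K. (hnorm H (q g))\<^sup>2)"
      using Z(1) q0 by (intro sum.mono_neutral_right) auto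
    also have "\<dots> \<le> (\<Sum>g\<in>sigma_map ` ?K. (hnorm H (q g))\<^sup>2)"
      by (intro sum_mono2) auto
    also have "\<dots> \<le> (red_norm h)\<^sup>2 * (hnorm H x)\<^sup>2"
      unfolding q_def by (rule sum_fibres_le_red_norm[OF E x])
    finally show "(\<Sum>g\<in>Z h. (hnorm H (q (?r g)))\<^sup>2) \<le> (red_norm h)\<^sup>2 * (hnorm H x)\<^sup>2" .
  qed
  finally show ?thesis by (simp add: mult_ac)
qed

text \<open>For h in the sequence of iterated squares, \<open>V h\<close> is the value of
  \<open>\<psi>\<close> at the next square, so \<open>\<psi>_Cauchy_Schwarz\<close> is the squaring
  hypothesis of \<open>power_trick\<close>, which removes the factor \<open>card Y\<close>.\<close>

lemma V_le_red_norm: "V f \<le> (hnorm H x)\<^sup>2 * (red_norm f)\<^sup>2"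
proof -
  interpret Lam: hilb_rep ell2 "left_regular :: 'a \<Rightarrow> _" by (rule hilb_rep_ell2)
  have "V (square_iter f 0) \<le> (hnorm H x)\<^sup>2 * (red_norm f)\<^sup>2"
  proof (rule power_trick)
    fix n
    show "(V (square_iter f n))\<^sup>2 \<le> (hnorm H x)\<^sup>2 * V (square_iter f (Suc n))"
      using \<psi>_Cauchy_Schwarz[of "square_iter f (Suc n)"] by (simp add: \<psi>_star_mult)
    have "V (square_iter f n) \<le> real (card Y) * (hnorm H x)\<^sup>2 * (red_norm (square_iter f n))\<^sup>2"
      by (rule V_le)
    also have "\<dots> \<le> real (card Y) * (hnorm H x)\<^sup>2 * (red_norm f ^ 2 ^ n)\<^sup>2"
      by (intro mult_left_mono power_mono red_norm_square_iter Lam.ext_norm_nonneg) auto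
    finally show "V (square_iter f n) \<le> real (card Y) * (hnorm H x)\<^sup>2 * (red_norm f)\<^sup>2 ^ 2 ^ n"
      by (simp add: mult.commute flip: power_mult)
  qed (simp_all add: V_nonneg)
  then show ?thesis by simp
qed

text \<open>Replacing every coefficient \<open>k (inv_star t * s)\<close> in the expansion of
  \<open>V f\<close> by 1 gives the squared norm of \<open>ext f x\<close>.\<close>

lemma hnorm_ext_le:
  assumes near: "\<And>s t. s \<in> Poly_Mapping.keys f \<Longrightarrow> t \<in> Poly_Mapping.keys f \<Longrightarrow> \<bar>k (inv_star t * s) - 1\<bar> \<le> \<epsilon>"
  shows "(hnorm H (ext f x))\<^sup>2 \<le> (hnorm H x)\<^sup>2 *
    ((red_norm f)\<^sup>2 + \<epsilon> * (\<Sum>s\<in>Poly_Mapping.keys f. cmod (Poly_Mapping.lookup f s))\<^sup>2)"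
proof -
  let ?f = "Poly_Mapping.lookup f" and ?K = "Poly_Mapping.keys f"
  have "complex_of_real ((hnorm H (ext f x))\<^sup>2) - complex_of_real (V f) =
      (\<Sum>s\<in>?K. \<Sum>t\<in>?K. ?f s * cnj (?f t) * of_real (1 - k (inv_star t * s)) * ip H (\<pi> s x) (\<pi> t x))"
  proof -
    have "complex_of_real ((hnorm H (ext f x))\<^sup>2) = (\<Sum>s\<in>?K. \<Sum>t\<in>?K. ?f s * cnj (?f t) * ip H (\<pi> s x) (\<pi> t x))"
      using x hnorm_sum_power2[of ?K "\<lambda>s. \<pi> s x" ?f] by (simp add: rep_ext_def)
    then show ?thesis
      unfolding \<psi>_star_mult[symmetric] \<psi>_star_mult_expand
      by (simp add: sum_subtractf[symmetric] algebra_simps del: of_real_power)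
  qed
  also have "cmod \<dots> \<le> (\<Sum>s\<in>?K. \<Sum>t\<in>?K. cmod (?f s) * cmod (?f t) * (\<epsilon> * (hnorm H x)\<^sup>2))"
  proof (intro order_trans[OF norm_sum] sum_mono)
    fix s t assume s: "s \<in> ?K" and t: "t \<in> ?K"
    have "cmod (ip H (\<pi> s x) (\<pi> t x)) \<le> hnorm H (\<pi> s x) * hnorm H (\<pi> t x)"
      using x by (intro Cauchy_Schwarz) auto
    also have "\<dots> \<le> hnorm H x * hnorm H x"
      using x by (intro mult_mono rep_contraction) auto
    finally have "cmod (of_real (1 - k (inv_star t * s)) * ip H (\<pi> s x) (\<pi> t x)) \<le> \<epsilon> * (hnorm H x)\<^sup>2"
      unfolding norm_mult norm_of_real power2_eq_square
      using near[OF s t] by (intro mult_mono) auto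
    then have "cmod (?f s) * cmod (?f t) * cmod (of_real (1 - k (inv_star t * s)) * ip H (\<pi> s x) (\<pi> t x)) \<le>
        cmod (?f s) * cmod (?f t) * (\<epsilon> * (hnorm H x)\<^sup>2)"
      by (intro mult_left_mono) auto
    then show "cmod (?f s * cnj (?f t) * of_real (1 - k (inv_star t * s)) * ip H (\<pi> s x) (\<pi> t x)) \<le>
        cmod (?f s) * cmod (?f t) * (\<epsilon> * (hnorm H x)\<^sup>2)"
      by (simp add: norm_mult mult.assoc)
  qed
  also have "\<dots> = (\<Sum>s\<in>?K. cmod (?f s))\<^sup>2 * (\<epsilon> * (hnorm H x)\<^sup>2)"
    unfolding power2_eq_square[of "\<Sum>s\<in>?K. cmod (?f s)"] sum_product by (simp only: sum_distrib_right)
  finally have "cmod (complex_of_real ((hnorm H (ext f x))\<^sup>2 - V f)) \<le> (\<Sum>s\<in>?K. cmod (?f s))\<^sup>2 * (\<epsilon> * (hnorm H x)\<^sup>2)"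
    by (simp only: of_real_diff)
  then have "(hnorm H (ext f x))\<^sup>2 - V f \<le> (\<Sum>s\<in>?K. cmod (?f s))\<^sup>2 * (\<epsilon> * (hnorm H x)\<^sup>2)"
    unfolding norm_of_real by linarith
  then show ?thesis using V_le_red_norm[of f] by (simp add: algebra_simps)
qed

end

text \<open>Square roots of the normalized \<open>\<eta>\<close> turn small variation of sums into
  small variation of squares, by (a - b)^2 \<le> |a^2 - b^2| for a, b \<ge> 0; for unit vectors,
  small distance means inner product near 1.\<close>

lemma (in group) reiter_l2:
  assumes am: "amenable G" and K: "finite K" "K \<subseteq> carrier G" and \<epsilon>: "\<epsilon> > 0"
  obtains Y and \<xi> :: "'a \<Rightarrow> real" where "finite Y" "Y \<subseteq> carrier G" "\<And>y. y \<notin> Y \<Longrightarrow> \<xi> y = 0"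
    "(\<Sum>y\<in>Y. (\<xi> y)\<^sup>2) = 1" "\<And>g. g \<in> K \<Longrightarrow> \<bar>(\<Sum>y\<in>Y. \<xi> (inv g \<otimes> y) * \<xi> y) - 1\<bar> \<le> \<epsilon>"
proof -
  obtain \<eta> :: "'a \<Rightarrow> real" and Y where Y: "finite Y" "Y \<subseteq> carrier G" and \<eta>: "\<And>x. 0 \<le> \<eta> x"
    and \<eta>0: "\<And>x. x \<notin> Y \<Longrightarrow> \<eta> x = 0"
    and var: "(\<Sum>g\<in>K. \<Sum>y\<in>Y \<union> (\<lambda>x. g \<otimes> x) ` Y. \<bar>\<eta> (inv g \<otimes> y) - \<eta> y\<bar>) < \<epsilon> * (\<Sum>x\<in>Y. \<eta> x)"
    using amenable_imp_reiter[OF am K \<epsilon>] by auto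
  define S where "S = (\<Sum>x\<in>Y. \<eta> x)"
  have "0 \<le> (\<Sum>g\<in>K. \<Sum>y\<in>Y \<union> (\<lambda>x. g \<otimes> x) ` Y. \<bar>\<eta> (inv g \<otimes> y) - \<eta> y\<bar>)"
    by (intro sum_nonneg) auto
  then have "0 < \<epsilon> * S" using var by (simp add: S_def)
  then have S: "S > 0" using \<epsilon> by (simp add: zero_less_mult_iff)
  define \<xi> where "\<xi> y = sqrt (\<eta> y / S)" for y
  have \<xi>2: "(\<xi> y)\<^sup>2 = \<eta> y / S" for y using \<eta> S by (simp add: \<xi>_def)
  have \<xi>0: "\<xi> y = 0" if "y \<notin> Y" for y using \<eta>0[OF that] by (simp add: \<xi>_def)
  have \<xi>1: "(\<Sum>y\<in>Y. (\<xi> y)\<^sup>2) = 1" using S by (simp add: \<xi>2 S_def flip: sum_divide_distrib)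
  have near: "\<bar>(\<Sum>y\<in>Y. \<xi> (inv g \<otimes> y) * \<xi> y) - 1\<bar> \<le> \<epsilon>" if gK: "g \<in> K" for g
  proof -
    have g: "g \<in> carrier G" using gK K by blast
    define X where "X = Y \<union> (\<lambda>x. g \<otimes> x) ` Y"
    have X: "finite X" "X \<subseteq> carrier G" using Y g by (auto simp: X_def)
    have s1: "(\<Sum>y\<in>X. (\<xi> (inv g \<otimes> y))\<^sup>2) = 1"
      using sum_translate[of X g Y "\<lambda>y. (\<xi> y)\<^sup>2" "\<lambda>_. 1"] X Y g \<xi>0 \<xi>1 by (auto simp: X_def)
    have s2: "(\<Sum>y\<in>X. (\<xi> y)\<^sup>2) = 1"
      unfolding \<xi>1[symmetric] using X by (intro sum.mono_neutral_right) (auto simp: X_def \<xi>0)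
    have s3: "(\<Sum>y\<in>X. \<xi> (inv g \<otimes> y) * \<xi> y) = (\<Sum>y\<in>Y. \<xi> (inv g \<otimes> y) * \<xi> y)"
      using X by (intro sum.mono_neutral_right) (auto simp: X_def \<xi>0)
    have "(\<xi> (inv g \<otimes> y) - \<xi> y)\<^sup>2 \<le> \<bar>\<eta> (inv g \<otimes> y) - \<eta> y\<bar> / S" for y
    proof -
      define a b where "a = \<xi> (inv g \<otimes> y)" and "b = \<xi> y"
      have ab: "0 \<le> a" "0 \<le> b" using \<eta> S by (auto simp: a_def b_def \<xi>_def)
      have "(a - b)\<^sup>2 = \<bar>a - b\<bar> * \<bar>a - b\<bar>" by (simp add: power2_eq_square)
      also have "\<dots> \<le> \<bar>a - b\<bar> * \<bar>a + b\<bar>" using ab by (intro mult_left_mono) auto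
      also have "\<dots> = \<bar>a\<^sup>2 - b\<^sup>2\<bar>" by (simp add: power2_eq_square square_diff_square_factored mult.commute flip: abs_mult)
      also have "\<dots> = \<bar>\<eta> (inv g \<otimes> y) - \<eta> y\<bar> / S"
        using S by (simp add: a_def b_def \<xi>2 flip: diff_divide_distrib)
      finally show ?thesis by (simp add: a_def b_def)
    qed
    then have "(\<Sum>y\<in>X. (\<xi> (inv g \<otimes> y) - \<xi> y)\<^sup>2) \<le> (\<Sum>y\<in>X. \<bar>\<eta> (inv g \<otimes> y) - \<eta> y\<bar> / S)" by (intro sum_mono)
    also have "\<dots> = (\<Sum>y\<in>X. \<bar>\<eta> (inv g \<otimes> y) - \<eta> y\<bar>) / S" by (simp add: sum_divide_distrib)
    also have "(\<Sum>y\<in>X. \<bar>\<eta> (inv g \<otimes> y) - \<eta> y\<bar>) \<le> (\<Sum>g\<in>K. \<Sum>y\<in>Y \<union> (\<lambda>x. g \<otimes> x) ` Y. \<bar>\<eta> (inv g \<otimes> y) - \<eta> y\<bar>)"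
      unfolding X_def using K gK
      by (intro member_le_sum[of g K "\<lambda>g. \<Sum>y\<in>Y \<union> (\<lambda>x. g \<otimes> x) ` Y. \<bar>\<eta> (inv g \<otimes> y) - \<eta> y\<bar>"] sum_nonneg) auto
    also have "\<dots> \<le> \<epsilon> * S" using var by (simp add: S_def)
    finally have "(\<Sum>y\<in>X. (\<xi> (inv g \<otimes> y) - \<xi> y)\<^sup>2) \<le> \<epsilon>" using S by (simp add: divide_right_mono)
    moreover have "(\<Sum>y\<in>X. (\<xi> (inv g \<otimes> y) - \<xi> y)\<^sup>2) = 2 - 2 * (\<Sum>y\<in>Y. \<xi> (inv g \<otimes> y) * \<xi> y)"
      unfolding s3[symmetric]
      by (simp add: power2_diff sum.distrib sum_subtractf s1 s2 sum_distrib_left mult.assoc)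
    moreover have "0 \<le> (\<Sum>y\<in>X. (\<xi> (inv g \<otimes> y) - \<xi> y)\<^sup>2)" by (intro sum_nonneg) simp
    ultimately show ?thesis using \<epsilon> by linarith
  qed
  show thesis by (rule that[OF Y \<xi>0 \<xi>1 near])
qed

lemma full_norm_le_red_norm:
  fixes f :: "'a::inverse_semigroup semigroup_algebra"
  assumes E: "E_unitary TYPE('a)" and am: "amenable (max_group_image :: 'a set monoid)"
  shows "full_norm f \<le> red_norm f"
proof (rule hilb_rep_ext_norm_le_full)
  interpret Lam: hilb_rep ell2 "left_regular :: 'a \<Rightarrow> _" by (rule hilb_rep_ell2)
  interpret G: group "max_group_image :: 'a set monoid" by (rule group_max_group_image)
  show "0 \<le> red_norm f" by (rule Lam.ext_norm_nonneg)
  fix H :: "('a option \<Rightarrow> complex) hilbert" and \<pi> :: "'a \<Rightarrow> _" assume "hilb_rep H \<pi>"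
  then interpret R: hilb_rep H \<pi> .
  show "R.ext_norm f \<le> red_norm f"
  proof (rule R.ext_norm_le)
    fix x assume x: "x \<in> carrier H"
    let ?K = "Poly_Mapping.keys f"
    \<comment> \<open>The finitely many group elements at which \<open>hnorm_ext_le\<close> needs
      coefficients near 1.\<close>
    define L where "L = (\<lambda>(s, t). sigma_map (inv_star t * s)) ` (?K \<times> ?K)"
    define M where "M = (hnorm H x)\<^sup>2 * (\<Sum>s\<in>?K. cmod (Poly_Mapping.lookup f s))\<^sup>2"
    have M: "0 \<le> M" by (simp add: M_def)
    have L: "finite L" "L \<subseteq> carrier max_group_image" by (auto simp: L_def)
    have le: "(hnorm H (R.ext f x))\<^sup>2 \<le> (hnorm H x)\<^sup>2 * (red_norm f)\<^sup>2 + \<delta> * M" if \<delta>: "\<delta> > 0" for \<delta>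
    proof -
      obtain Y and \<xi> :: "'a set \<Rightarrow> real" where *: "finite Y" "Y \<subseteq> carrier max_group_image"
        "\<And>y. y \<notin> Y \<Longrightarrow> \<xi> y = 0" "(\<Sum>y\<in>Y. (\<xi> y)\<^sup>2) = 1"
        and near: "\<And>g. g \<in> L \<Longrightarrow>
          \<bar>(\<Sum>y\<in>Y. \<xi> (inv\<^bsub>max_group_image\<^esub> g \<otimes>\<^bsub>max_group_image\<^esub> y) * \<xi> y) - 1\<bar> \<le> \<delta>"
        by (rule G.reiter_l2[OF am L \<delta>]) blast
      interpret twisted_state H \<pi> x \<xi> Y
        by unfold_locales (use E x * in auto)
      have "\<bar>k (inv_star t * s) - 1\<bar> \<le> \<delta>" if "s \<in> ?K" "t \<in> ?K" for s t
        using near[of "sigma_map (inv_star t * s)"] that by (auto simp: k_def W_def L_def)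
      from hnorm_ext_le[OF this] show ?thesis by (simp add: M_def algebra_simps)
    qed
    have "(hnorm H (R.ext f x))\<^sup>2 \<le> (hnorm H x)\<^sup>2 * (red_norm f)\<^sup>2 + \<epsilon>" if \<epsilon>: "\<epsilon> > 0" for \<epsilon>
    proof -
      have "\<epsilon> / (M + 1) * M \<le> \<epsilon>" using M \<epsilon> by (simp add: field_simps)
      then show ?thesis using le[of "\<epsilon> / (M + 1)"] M \<epsilon> by simp
    qed
    then have "(hnorm H (R.ext f x))\<^sup>2 \<le> (hnorm H x)\<^sup>2 * (red_norm f)\<^sup>2" by (rule field_le_epsilon)
    then have "(hnorm H (R.ext f x))\<^sup>2 \<le> (red_norm f * hnorm H x)\<^sup>2"
      by (simp add: power_mult_distrib mult.commute)
    then show "hnorm H (R.ext f x) \<le> red_norm f * hnorm H x"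
      by (rule power2_le_imp_le) (simp add: x Lam.ext_norm_nonneg)
  qed (rule Lam.ext_norm_nonneg)
qed

theorem corollary2p6:
  assumes "E_unitary TYPE('a::inverse_semigroup)"
  shows "weak_containment TYPE('a) \<longleftrightarrow> amenable (max_group_image :: 'a set monoid)"
  using weak_containment_imp_amenable weak_containmentI[OF full_norm_le_red_norm[OF assms]] by blast

end
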